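(* Assume $d \ge 2\log n$. There exist universal constants $c_1,c_2,c_3>0$ such that, for $n$ large enough, with probability $1-o(1)$ (as $n\to\infty$), any maximum likelihood pair $(\hat\pi,\hat Q)$ satisfies \[ \mathrm{ov}(\pi^\star,\hat\pi)\;\ge\; 1-\max\left(60\sigma^2,\; c_1\frac{d}{n},\; c_2\frac{\log n}{d\log d}\right) \] and \[ \frac{\ell^2(Q^\star,\hat Q)}{2d}\;\le\; c_1\frac{d}{n}+c_2\sigma^2+c_3\max\left(\frac{d\log n}{n},\sqrt{\frac{\log n}{n}}\right). \]
   Context: Standing model: $n\ge 1$ and $d=d_n\ge 1$ are integers ($d$ may depend on $n$; asymptotics are as $n\to\infty$). $X=(x_1,\dots,x_n)\in\mathbb R^{d\times n}$ and $Z=(z_1,\dots,z_n)\in\mathbb R^{d\times n}$ have all columns i.i.d. $\mathcal N(0,I_d)$, with $X$ and $Z$ independent. $Q^\star\in\mathcal O(d)$ is a fixed orthogonal matrix, $\pi^\star\in\mathcal S_n$ a fixed permutation of $[n]$, $\sigma>0$ a noise level (possibly depending on $n$), and $y_i=Q^\star x_{\pi^\star(i)}+\sigma z_i$ for $i\in[n]$, $Y=(y_1,\dots,y_n)$. Metrics: $\mathrm{ov}(\pi,\pi')=\frac1n\#\{i\in[n]:\pi(i)=\pi'(i)\}$; $c^2(\pi,\pi')=\frac1n\sum_{i=1}^n\|x_{\pi(i)}-x_{\pi'(i)}\|^2$; $\ell^2(Q,Q')=\|Q-Q'\|_F^2$. A maximum likelihood pair is any $(\hat\pi,\hat Q)\in\operatorname{argmin}_{(\pi,Q)\in\mathcal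 S_n\times\mathcal O(d)}\frac1n\sum_{i=1}^n\|x_{\pi(i)}-Q^\top y_i\|^2$. *)

theory Defs
  imports "HOL-Probability.Probability" "HOL-Combinatorics.Permutations"
begin

text \<open>Finite-dimensional objects of size depending on n are encoded explicitly:
  a d x n matrix is a function (nat \<times> nat) \<Rightarrow> real, entry (k,i) = k-th coordinate of
  column i (k < d, i < n); a d x d matrix is nat \<Rightarrow> nat \<Rightarrow> real, zero outside {..<d}^2;
  permutations of [n] are permutations of {..<n}.\<close>

definition orth_mat :: "nat \<Rightarrow> (nat \<Rightarrow> nat \<Rightarrow> real) \<Rightarrow> bool" where
  "orth_mat d Q \<longleftrightarrow>
     (\<forall>i j. \<not> (i < d \<and> j < d) \<longrightarrow> Q i j = 0) \<and>
     (\<forall>i<d. \<forall>j<d. (\<Sum>k<d. Q k i * Q k j) = (if i = j then 1 else 0))"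

definition gauss_model :: "nat \<Rightarrow> nat \<Rightarrow> (((nat \<times> nat) \<Rightarrow> real) \<times> ((nat \<times> nat) \<Rightarrow> real)) measure" where
  "gauss_model d n =
     (PiM ({..<d} \<times> {..<n}) (\<lambda>_. density lborel std_normal_density)) \<Otimes>\<^sub>M
     (PiM ({..<d} \<times> {..<n}) (\<lambda>_. density lborel std_normal_density))"

definition obs :: "nat \<Rightarrow> (nat \<Rightarrow> nat \<Rightarrow> real) \<Rightarrow> (nat \<Rightarrow> nat) \<Rightarrow> real \<Rightarrow>
    ((nat \<times> nat) \<Rightarrow> real) \<Rightarrow> ((nat \<times> nat) \<Rightarrow> real) \<Rightarrow> nat \<Rightarrow> nat \<Rightarrow> real" where
  "obs d Qs ps s X Z i k = (\<Sum>l<d. Qs k l * X (l, ps i)) + s * Z (k, i)"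

definition ml_obj :: "nat \<Rightarrow> nat \<Rightarrow> ((nat \<times> nat) \<Rightarrow> real) \<Rightarrow> (nat \<Rightarrow> nat \<Rightarrow> real) \<Rightarrow>
    (nat \<Rightarrow> nat) \<Rightarrow> (nat \<Rightarrow> nat \<Rightarrow> real) \<Rightarrow> real" where
  "ml_obj d n X Y p Q = (1 / real n) * (\<Sum>i<n. \<Sum>k<d. (X (k, p i) - (\<Sum>l<d. Q l k * Y i l))\<^sup>2)"

definition is_ml_pair :: "nat \<Rightarrow> nat \<Rightarrow> ((nat \<times> nat) \<Rightarrow> real) \<Rightarrow> (nat \<Rightarrow> nat \<Rightarrow> real) \<Rightarrow>
    (nat \<Rightarrow> nat) \<Rightarrow> (nat \<Rightarrow> nat \<Rightarrow> real) \<Rightarrow> bool" where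
  "is_ml_pair d n X Y p Q \<longleftrightarrow> p permutes {..<n} \<and> orth_mat d Q \<and>
     (\<forall>p' Q'. p' permutes {..<n} \<longrightarrow> orth_mat d Q' \<longrightarrow> ml_obj d n X Y p Q \<le> ml_obj d n X Y p' Q')"

definition overlap :: "nat \<Rightarrow> (nat \<Rightarrow> nat) \<Rightarrow> (nat \<Rightarrow> nat) \<Rightarrow> real" where
  "overlap n p p' = real (card {i \<in> {..<n}. p i = p' i}) / real n"

definition ell2 :: "nat \<Rightarrow> (nat \<Rightarrow> nat \<Rightarrow> real) \<Rightarrow> (nat \<Rightarrow> nat \<Rightarrow> real) \<Rightarrow> real" where
  "ell2 d Q Q' = (\<Sum>i<d. \<Sum>j<d. (Q i j - Q' i j)\<^sup>2)"

end

theory Submission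
  imports Defs
begin

text \<open>Maximality of the likelihood at (p, Q) gives a nonnegative gain, the sum over the columns i of
  2 s <V_i, z_i> - |V_i|^2, where V_i = Q x_{p i} - Q* x_{q i} and q is the true permutation.
  Where p and q agree, V_i = (Q - Q*) x_{q i} is linear in Q - Q*, and the supremum of the gain over
  all matrices is s^2 times the squared norm of the projection of the noise onto a space of dimension
  at most d^2, whatever the number of columns. Only the k columns where p and q differ need a net of
  matrices Q, for which a fixed resolution suffices. There the probability that the gain is not
  negative is at most 2^(-k d), up to factors exp (k d / 20) and 2^(d^2 / 2): half of the columns can be put in
  triangular form and integrated out one after the other, and 1 + 2 * 15/2 = 16. As n^k <= exp (k d / 2)
  by d >= 2 log n, and log 2 >= 2/3, a union bound shows k <= C d. The gain of Q - Q* over all columns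
  is then at least of order - d^2, and the smallest singular value of X is of order sqrt n.\<close>

section \<open>Gaussian integrals\<close>

text \<open>A net that serves all n columns is the obstacle: its rounding error has order \<epsilon>
  d n and would have to stay below d k, so \<epsilon> would shrink like k / n and the entropy of the
  net would gain a factor log (n / k). On the k moved columns the error is \<epsilon> d k, the order
  of the exponent to be beaten, so \<epsilon> can be absolute. The net then costs exp (C d^2), which
  exp (- c d k) absorbs once k exceeds a multiple of d; this is the origin of the term d / n. The
  constant 60 belongs to the Chernoff parameter \<lambda>. For a fixed residual V the mean of exp
  (\<lambda> gain) is exp ((2 \<lambda>^2 s^2 - \<lambda>) |V|^2), minimal at \<lambda> = 1 / (4
  s^2), which is 15 when 60 s^2 = 1. This leaves -15/2 |V|^2, and the same \<lambda> turns the
  projected noise s^2 Y into Y / 4, whose exponential is still integrable. For 60 s^2 > 1 both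
  bounds of the theorem are trivial. The other numerical constants only make every loss fit between
  1/2, the price of n^k, and 2/3.\<close>

abbreviation std_gauss :: "'i set \<Rightarrow> ('i \<Rightarrow> real) measure" where
  "std_gauss I \<equiv> Pi\<^sub>M I (\<lambda>_. density lborel std_normal_density)"

lemma prob_space_std_normal: "prob_space (density lborel std_normal_density)"
  by (rule prob_space_normal_density) simp

lemma product_sigma_finite_std_normal:
  "product_sigma_finite (\<lambda>_::'i. density lborel std_normal_density)"
  by (simp add: product_sigma_finite_def prob_space_std_normal prob_space_imp_sigma_finite)

lemma prob_space_std_gauss: "prob_space (std_gauss I)"
  by (intro prob_space_PiM prob_space_std_normal)

lemma borel_measurable_std_gauss_coord [measurable]:
  "(\<lambda>X. X i) \<in> borel_measurable (std_gauss I)"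
proof (cases "i \<in> I")
  case True
  then have "(\<lambda>X. X i) \<in> measurable (std_gauss I) (density lborel std_normal_density)"
    by (rule measurable_component_singleton)
  then show ?thesis by (simp add: measurable_def)
next
  case False
  have "(\<lambda>X. X i) \<in> borel_measurable (std_gauss I) \<longleftrightarrow>
      (\<lambda>X. undefined :: real) \<in> borel_measurable (std_gauss I)"
    using False by (intro measurable_cong) (auto simp: space_PiM PiE_def extensional_def)
  then show ?thesis by simp
qed

text \<open>Chernoff bound in additive form. \<open>S\<close> may be nonmeasurable, because
  \<open>emeasure\<close> is 0 outside \<open>sets M\<close>; events given by a supremum over an
  arbitrary set of matrices can therefore be bounded directly.\<close>

lemma emeasure_le_nn_integral_exp:
  assumes "\<And>x. x \<in> S \<Longrightarrow> 0 \<le> g x"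
  shows "emeasure M S \<le> (\<integral>\<^sup>+x. ennreal (exp (g x)) \<partial>M)"
proof (cases "S \<in> sets M")
  case True
  then have "emeasure M S = (\<integral>\<^sup>+x. indicator S x \<partial>M)" by simp
  also have "\<dots> \<le> (\<integral>\<^sup>+x. ennreal (exp (g x)) \<partial>M)"
    using assms by (intro nn_integral_mono) (simp add: indicator_def)
  finally show ?thesis .
qed (simp add: emeasure_notin_sets)

lemma nn_integral_normal_density:
  assumes "s > 0"
  shows "(\<integral>\<^sup>+x. ennreal (normal_density m s x) \<partial>lborel) = 1"
proof -
  have "(\<integral>\<^sup>+x. ennreal (normal_density m s x) \<partial>lborel) = ennreal (\<integral>x. normal_density m s x \<partial>lborel)"
    using assms by (intro nn_integral_eq_integral) auto
  then show ?thesis using assms by simp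
qed

text \<open>Completing the square: the tilted density is a constant times the Gaussian density of
  mean \<open>m\<close> and variance \<open>1 / c\<close>. Negative \<open>l\<close> is allowed
  while \<open>c\<close> stays positive (\<open>l = -1/4\<close> gives the moment of exp (x^2 / 4));
  the shift \<open>b\<close> stands for coordinates that are integrated later.\<close>

lemma nn_integral_std_normal_exp_square:
  assumes c: "1 + 2 * l * w\<^sup>2 > 0"
  shows "(\<integral>\<^sup>+x. ennreal (exp (- l * (b + w * x)\<^sup>2)) \<partial>density lborel std_normal_density)
     = ennreal (exp (- (l / (1 + 2 * l * w\<^sup>2)) * b\<^sup>2) / sqrt (1 + 2 * l * w\<^sup>2))"
proof -
  define c where "c = 1 + 2 * l * w\<^sup>2"
  have cp: "c > 0" using assms by (simp add: c_def)
  define A where "A = exp (- (l / c) * b\<^sup>2) / sqrt c"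
  define m where "m = - (2 * l * b * w / c)"
  have eq: "std_normal_density x * exp (- l * (b + w * x)\<^sup>2) = A * normal_density m (1 / sqrt c) x" for x
  proof -
    have s: "(1 / sqrt c)\<^sup>2 = 1 / c" using cp by (simp add: power_divide)
    have e: "- x\<^sup>2 / 2 + - l * (b + w * x)\<^sup>2 = - (l / c) * b\<^sup>2 + - (x - m)\<^sup>2 / (2 * (1 / c))"
    proof -
      have "- (l / c) * b\<^sup>2 + - (x - m)\<^sup>2 / (2 * (1 / c)) = - (l * b\<^sup>2 + (c * x - c * m)\<^sup>2 / 2) / c"
        using cp by (simp add: field_simps power2_eq_square)
      also have "c * x - c * m = c * x + 2 * l * b * w" using cp by (simp add: m_def)
      also have "- (l * b\<^sup>2 + (c * x + 2 * l * b * w)\<^sup>2 / 2) / c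
           = - (l * b\<^sup>2 * (1 + 2 * l * w\<^sup>2) + c * (c * x\<^sup>2 + 4 * l * b * w * x) / 2) / c"
        by (simp add: field_simps power2_eq_square)
      also have "\<dots> = - (c * (l * b\<^sup>2) + c * (c * x\<^sup>2 + 4 * l * b * w * x) / 2) / c"
        by (simp add: c_def algebra_simps)
      also have "\<dots> = - (l * b\<^sup>2 + (c * x\<^sup>2 + 4 * l * b * w * x) / 2)"
        using cp by (simp add: field_simps)
      also have "\<dots> = - x\<^sup>2 / 2 + - l * (b + w * x)\<^sup>2"
        by (simp add: c_def field_simps power2_eq_square)
      finally show ?thesis by simp
    qed
    have "std_normal_density x * exp (- l * (b + w * x)\<^sup>2)
        = (1 / sqrt (2 * pi)) * exp (- x\<^sup>2 / 2 + - l * (b + w * x)\<^sup>2)"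
      unfolding std_normal_density_def by (simp only: exp_add mult.assoc)
    also have "\<dots> = (1 / sqrt (2 * pi)) * exp (- (l / c) * b\<^sup>2 + - (x - m)\<^sup>2 / (2 * (1 / c)))"
      by (simp only: e)
    also have "\<dots> = A * normal_density m (1 / sqrt c) x"
      using cp unfolding normal_density_def s A_def exp_add
      by (simp add: real_sqrt_divide real_sqrt_mult)
    finally show ?thesis .
  qed
  have A0: "A \<ge> 0" using cp by (simp add: A_def)
  have "(\<integral>\<^sup>+x. ennreal (exp (- l * (b + w * x)\<^sup>2)) \<partial>density lborel std_normal_density)
     = (\<integral>\<^sup>+x. ennreal (std_normal_density x) * ennreal (exp (- l * (b + w * x)\<^sup>2)) \<partial>lborel)"
    by (intro nn_integral_density) auto
  also have "\<dots> = (\<integral>\<^sup>+x. ennreal A * ennreal (normal_density m (1 / sqrt c) x) \<partial>lborel)"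
    by (intro nn_integral_cong) (simp add: ennreal_mult[symmetric] eq[simplified] A0)
  also have "\<dots> = ennreal A"
    using cp by (subst nn_integral_cmult) (auto simp: nn_integral_normal_density)
  finally show ?thesis by (simp add: A_def c_def)
qed

lemma nn_integral_std_normal_exp_linear:
  "(\<integral>\<^sup>+x. ennreal (exp (a * x)) \<partial>density lborel std_normal_density) = ennreal (exp (a\<^sup>2 / 2))"
proof -
  have eq: "std_normal_density x * exp (a * x) = exp (a\<^sup>2 / 2) * normal_density a 1 x" for x
  proof -
    have "- x\<^sup>2 / 2 + a * x = a\<^sup>2 / 2 + - (x - a)\<^sup>2 / 2"
      by (simp add: field_simps power2_eq_square)
    then show ?thesis unfolding std_normal_density_def normal_density_def
      by (simp add: exp_add[symmetric])
  qed
  have "(\<integral>\<^sup>+x. ennreal (exp (a * x)) \<partial>density lborel std_normal_density)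
     = (\<integral>\<^sup>+x. ennreal (std_normal_density x) * ennreal (exp (a * x)) \<partial>lborel)"
    by (intro nn_integral_density) auto
  also have "\<dots> = (\<integral>\<^sup>+x. ennreal (exp (a\<^sup>2 / 2)) * ennreal (normal_density a 1 x) \<partial>lborel)"
    by (intro nn_integral_cong) (simp add: ennreal_mult[symmetric] eq[simplified])
  also have "\<dots> = ennreal (exp (a\<^sup>2 / 2))"
    by (subst nn_integral_cmult) (auto simp: nn_integral_normal_density)
  finally show ?thesis .
qed

lemma nn_integral_std_gauss_exp_linear:
  assumes "finite I"
  shows "(\<integral>\<^sup>+X. ennreal (exp (\<Sum>i\<in>I. a i * X i)) \<partial>std_gauss I) = ennreal (exp ((\<Sum>i\<in>I. (a i)\<^sup>2) / 2))"
proof -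
  interpret product_sigma_finite "\<lambda>_::'a. density lborel std_normal_density"
    by (rule product_sigma_finite_std_normal)
  have "(\<integral>\<^sup>+X. ennreal (exp (\<Sum>i\<in>I. a i * X i)) \<partial>std_gauss I)
      = (\<integral>\<^sup>+X. (\<Prod>i\<in>I. ennreal (exp (a i * X i))) \<partial>std_gauss I)"
    using assms by (simp add: exp_sum prod_ennreal)
  also have "\<dots> = (\<Prod>i\<in>I. ennreal (exp ((a i)\<^sup>2 / 2)))"
    using assms by (subst product_nn_integral_prod) (auto simp: nn_integral_std_normal_exp_linear)
  also have "\<dots> = ennreal (exp ((\<Sum>i\<in>I. (a i)\<^sup>2) / 2))"
    using assms by (simp add: prod_ennreal exp_sum[symmetric] sum_divide_distrib)
  finally show ?thesis .
qed

lemma nn_integral_std_gauss_exp_square: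
  assumes "finite I"
  shows "(\<integral>\<^sup>+X. ennreal (exp ((\<Sum>i\<in>I. (X i)\<^sup>2) / 4)) \<partial>std_gauss I) = ennreal (sqrt 2 ^ card I)"
proof -
  interpret product_sigma_finite "\<lambda>_::'a. density lborel std_normal_density"
    by (rule product_sigma_finite_std_normal)
  have one: "(\<integral>\<^sup>+x. ennreal (exp (x\<^sup>2 / 4)) \<partial>density lborel std_normal_density) = ennreal (sqrt 2)"
    using nn_integral_std_normal_exp_square[of "-(1/4)" 1 0]
    by (simp add: real_sqrt_divide field_simps)
  have "(\<integral>\<^sup>+X. ennreal (exp ((\<Sum>i\<in>I. (X i)\<^sup>2) / 4)) \<partial>std_gauss I)
      = (\<integral>\<^sup>+X. (\<Prod>i\<in>I. ennreal (exp ((X i)\<^sup>2 / 4))) \<partial>std_gauss I)"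
    using assms by (simp add: exp_sum prod_ennreal sum_divide_distrib)
  also have "\<dots> = (\<Prod>i\<in>I. ennreal (sqrt 2))"
    using assms by (subst product_nn_integral_prod) (auto simp: one)
  finally show ?thesis by (simp add: prod_ennreal ennreal_power)
qed

text \<open>Integrating out the coordinates in decreasing rank: the coordinate of highest rank occurs
  in a single square, whose centre does not depend on it.\<close>

lemma nn_integral_std_gauss_exp_triangular:
  fixes r :: "'i \<Rightarrow> 'r::linorder"
  assumes "finite I" "S \<subseteq> I" "l \<ge> 0"
    and tri: "\<And>s i. s \<in> S \<Longrightarrow> i \<in> I \<Longrightarrow> \<beta> s i \<noteq> 0 \<Longrightarrow> r i < r s"
  shows "(\<integral>\<^sup>+X. ennreal (exp (- l * (\<Sum>s\<in>S. (X s - (\<Sum>i\<in>I. \<beta> s i * X i))\<^sup>2))) \<partial>std_gauss I)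
     \<le> ennreal ((1 / sqrt (1 + 2 * l)) ^ card S)"
  using assms(1,2,4)
proof (induction I arbitrary: S rule: finite_ranking_induct[where f = r])
  case empty
  then show ?case by (simp add: space_PiM)
next
  case (insert x I)
  interpret product_sigma_finite "\<lambda>_::'i. density lborel std_normal_density"
    by (rule product_sigma_finite_std_normal)
  show ?case
  proof (cases "x \<in> I")
    case True
    then show ?thesis using insert by (simp add: insert_absorb)
  next
    case False
    define S' where "S' = S - {x}"
    have S': "S' \<subseteq> I" "finite S'" using insert.prems insert.hyps by (auto simp: S'_def finite_subset)
    have fS: "finite S" using S'(2) by (simp add: S'_def)
    \<comment> \<open>The new \<open>x\<close> has the largest rank so far, and strict triangularity
      also covers \<open>s = x\<close>: no centre contains the new coordinate.\<close>
    have z: "\<beta> s x = 0" if "s \<in> S" for s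
      using insert.prems(2)[of s x] insert.hyps(2)[of s] insert.prems(1) that by force
    have sm: "(\<Sum>i\<in>insert x I. \<beta> s i * (X(x := y)) i) = (\<Sum>i\<in>I. \<beta> s i * X i)" if "s \<in> S" for s X y
    proof -
      have "(\<Sum>i\<in>insert x I. \<beta> s i * (X(x := y)) i) = \<beta> s x * y + (\<Sum>i\<in>I. \<beta> s i * (X(x := y)) i)"
        using insert.hyps(1) False by simp
      also have "(\<Sum>i\<in>I. \<beta> s i * (X(x := y)) i) = (\<Sum>i\<in>I. \<beta> s i * X i)"
        using False by (intro sum.cong) auto
      finally show ?thesis using z[OF that] by simp
    qed
    define G where "G X = (\<Sum>s\<in>S'. (X s - (\<Sum>i\<in>I. \<beta> s i * X i))\<^sup>2)" for X
    have G: "(\<Sum>s\<in>S'. ((X(x := y)) s - (\<Sum>i\<in>insert x I. \<beta> s i * (X(x := y)) i))\<^sup>2) = G X" for X y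
      unfolding G_def
    proof (rule sum.cong)
      fix s assume "s \<in> S'"
      then have "s \<in> S" "s \<noteq> x" by (auto simp: S'_def)
      then show "((X(x := y)) s - (\<Sum>i\<in>insert x I. \<beta> s i * (X(x := y)) i))\<^sup>2
          = (X s - (\<Sum>i\<in>I. \<beta> s i * X i))\<^sup>2"
        by (simp only: sm) simp
    qed simp
    have Gm [measurable]: "G \<in> borel_measurable (std_gauss I)"
      unfolding G_def by measurable
    have IH: "(\<integral>\<^sup>+X. ennreal (exp (- l * G X)) \<partial>std_gauss I) \<le> ennreal ((1 / sqrt (1 + 2 * l)) ^ card S')"
      unfolding G_def using S' by (intro insert.IH) (auto simp: S'_def intro!: insert.prems(2))
    have fold: "(\<integral>\<^sup>+X. ennreal (exp (- l * (\<Sum>s\<in>S. (X s - (\<Sum>i\<in>insert x I. \<beta> s i * X i))\<^sup>2))) \<partial>std_gauss (insert x I))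
       = (\<integral>\<^sup>+X. \<integral>\<^sup>+y. ennreal (exp (- l * (\<Sum>s\<in>S. ((X(x := y)) s - (\<Sum>i\<in>insert x I. \<beta> s i * (X(x := y)) i))\<^sup>2)))
             \<partial>density lborel std_normal_density \<partial>std_gauss I)"
      using insert.hyps(1) False by (subst product_nn_integral_insert) (auto)
    show ?thesis
    proof (cases "x \<in> S")
      case True
      define q where "q X = (\<Sum>i\<in>I. \<beta> x i * X i)" for X
      have "(\<Sum>s\<in>S. ((X(x := y)) s - (\<Sum>i\<in>insert x I. \<beta> s i * (X(x := y)) i))\<^sup>2) = (y - q X)\<^sup>2 + G X" for X y
      proof -
        have "(\<Sum>s\<in>S. ((X(x := y)) s - (\<Sum>i\<in>insert x I. \<beta> s i * (X(x := y)) i))\<^sup>2)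
          = ((X(x := y)) x - (\<Sum>i\<in>insert x I. \<beta> x i * (X(x := y)) i))\<^sup>2
            + (\<Sum>s\<in>S'. ((X(x := y)) s - (\<Sum>i\<in>insert x I. \<beta> s i * (X(x := y)) i))\<^sup>2)"
          using True fS unfolding S'_def by (rule sum.remove[rotated])
        also have "((X(x := y)) x - (\<Sum>i\<in>insert x I. \<beta> x i * (X(x := y)) i))\<^sup>2 = (y - q X)\<^sup>2"
          by (simp only: sm[OF True] q_def) simp
        finally show ?thesis by (simp only: G)
      qed
      note eq = this
      have "(\<integral>\<^sup>+X. ennreal (exp (- l * (\<Sum>s\<in>S. (X s - (\<Sum>i\<in>insert x I. \<beta> s i * X i))\<^sup>2))) \<partial>std_gauss (insert x I))
       = (\<integral>\<^sup>+X. \<integral>\<^sup>+y. ennreal (exp (- l * G X)) * ennreal (exp (- l * (- q X + 1 * y)\<^sup>2))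
             \<partial>density lborel std_normal_density \<partial>std_gauss I)"
        unfolding fold eq by (intro nn_integral_cong)
          (simp add: ennreal_mult[symmetric] exp_add[symmetric] algebra_simps power2_eq_square)
      also have "\<dots> = (\<integral>\<^sup>+X. ennreal (exp (- l * G X)) * ennreal (exp (- (l / (1 + 2 * l * 1\<^sup>2)) * (- q X)\<^sup>2) / sqrt (1 + 2 * l * 1\<^sup>2)) \<partial>std_gauss I)"
        using \<open>l \<ge> 0\<close> by (intro nn_integral_cong, subst nn_integral_cmult, simp,
            subst nn_integral_std_normal_exp_square) auto
      \<comment> \<open>The centre survives only in a factor at most 1. Dropping it makes the bound
        independent of \<open>\<beta>\<close>, so that it also covers grid matrices, which are not
        orthogonal.\<close>
      also have "\<dots> \<le> (\<integral>\<^sup>+X. ennreal (exp (- l * G X)) * ennreal (1 / sqrt (1 + 2 * l)) \<partial>std_gauss I)"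
        using \<open>l \<ge> 0\<close> by (intro nn_integral_mono mult_left_mono ennreal_leI)
          (auto intro!: divide_right_mono)
      also have "\<dots> = (\<integral>\<^sup>+X. ennreal (exp (- l * G X)) \<partial>std_gauss I) * ennreal (1 / sqrt (1 + 2 * l))"
        by (subst nn_integral_multc) auto
      also have "\<dots> \<le> ennreal ((1 / sqrt (1 + 2 * l)) ^ card S') * ennreal (1 / sqrt (1 + 2 * l))"
        by (intro mult_right_mono IH) simp
      also have "\<dots> = ennreal ((1 / sqrt (1 + 2 * l)) ^ Suc (card S'))"
        using \<open>l \<ge> 0\<close> by (simp add: ennreal_mult[symmetric] mult.commute)
      also have "Suc (card S') = card S"
        using True fS unfolding S'_def by (rule card.remove[symmetric, rotated])
      finally show ?thesis .
    next
      case False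
      then have SS: "S' = S" by (simp add: S'_def)
      interpret N: prob_space "density lborel std_normal_density" by (rule prob_space_std_normal)
      have "(\<integral>\<^sup>+X. ennreal (exp (- l * (\<Sum>s\<in>S. (X s - (\<Sum>i\<in>insert x I. \<beta> s i * X i))\<^sup>2))) \<partial>std_gauss (insert x I))
         = (\<integral>\<^sup>+X. ennreal (exp (- l * G X)) \<partial>std_gauss I)"
        unfolding fold G[unfolded SS] using N.emeasure_space_1 by (intro nn_integral_cong) simp
      then show ?thesis using IH SS by simp
    qed
  qed
qed

section \<open>Maximal gain over all rotations\<close>

text \<open>The linear forms over the classes of \<open>c\<close> are independent centred Gaussians,
  so the Laplace transform of their weighted squares factorises. With \<open>c = snd\<close> the
  classes are the columns of X; this is the small-ball estimate behind the smallest singular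
  value.\<close>

lemma nn_integral_std_gauss_exp_projections:
  fixes c :: "'i \<Rightarrow> 'j"
  assumes "finite I" "finite A" "c ` I \<subseteq> A" "\<And>j. j \<in> A \<Longrightarrow> l j \<ge> 0"
  shows "(\<integral>\<^sup>+X. ennreal (exp (- (\<Sum>j\<in>A. l j * (\<Sum>i | i \<in> I \<and> c i = j. w i * X i)\<^sup>2))) \<partial>std_gauss I)
     = ennreal (\<Prod>j\<in>A. 1 / sqrt (1 + 2 * l j * (\<Sum>i | i \<in> I \<and> c i = j. (w i)\<^sup>2)))"
  using assms(1,3,4)
proof (induction I arbitrary: l rule: finite_induct)
  case empty
  then show ?case by (simp add: space_PiM)
next
  case (insert x I)
  interpret product_sigma_finite "\<lambda>_::'i. density lborel std_normal_density"
    by (rule product_sigma_finite_std_normal)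
  define j0 where "j0 = c x"
  have j0: "j0 \<in> A" using insert.prems(1) by (simp add: j0_def)
  define P where "P j X = (\<Sum>i | i \<in> I \<and> c i = j. w i * X i)" for j X
  define s where "s j = (\<Sum>i | i \<in> I \<and> c i = j. (w i)\<^sup>2)" for j
  have fin: "finite {i. i \<in> I \<and> c i = j}" for j using insert.hyps(1) by simp
  have st: "{i. i \<in> insert x I \<and> c i = j} = (if j = j0 then insert x {i. i \<in> I \<and> c i = j} else {i. i \<in> I \<and> c i = j})" for j
    by (auto simp: j0_def)
  have P': "(\<Sum>i | i \<in> insert x I \<and> c i = j. w i * (X(x := y)) i) = P j X + (if j = j0 then w x * y else 0)" for j X y
  proof -
    have e: "(\<Sum>i | i \<in> I \<and> c i = j. w i * (X(x := y)) i) = P j X"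
      unfolding P_def using insert.hyps(2) by (intro sum.cong) auto
    show ?thesis unfolding st using fin[of j] insert.hyps(2) e by (auto simp del: fun_upd_apply) simp
  qed
  have s': "(\<Sum>i | i \<in> insert x I \<and> c i = j. (w i)\<^sup>2) = s j + (if j = j0 then (w x)\<^sup>2 else 0)" for j
    unfolding st s_def using fin[of j] insert.hyps(2) by auto
  have Pm [measurable]: "P j \<in> borel_measurable (std_gauss I)" for j
    unfolding P_def by measurable
  define k where "k = 1 + 2 * l j0 * (w x)\<^sup>2"
  have l0: "l j0 \<ge> 0" using insert.prems(2) j0 by simp
  have k: "k > 0" unfolding k_def using l0 by (smt (verit) mult_nonneg_nonneg zero_le_power2)
  \<comment> \<open>Integrating out \<open>x\<close> shrinks the weight of its class from
    \<open>l j0\<close> to \<open>l j0 / k\<close>; hence the induction leaves \<open>l\<close>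
    arbitrary.\<close>
  define l' where "l' = l(j0 := l j0 / k)"
  define G where "G X = (\<Sum>j\<in>A - {j0}. l j * (P j X)\<^sup>2)" for X
  have Gm [measurable]: "G \<in> borel_measurable (std_gauss I)"
    unfolding G_def by measurable
  have "(\<Sum>j\<in>A. l j * (\<Sum>i | i \<in> insert x I \<and> c i = j. w i * (X(x := y)) i)\<^sup>2)
     = l j0 * (P j0 X + w x * y)\<^sup>2 + G X" for X y
    unfolding P' using j0 \<open>finite A\<close> by (subst sum.remove[of A j0]) (auto simp: G_def intro!: sum.cong)
  note e1 = this
  have e2: "(\<Sum>j\<in>A. l' j * (P j X)\<^sup>2) = l j0 / k * (P j0 X)\<^sup>2 + G X" for X
    using j0 \<open>finite A\<close> by (subst sum.remove[of A j0]) (auto simp: G_def l'_def intro!: sum.cong)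
  have "(\<integral>\<^sup>+X. ennreal (exp (- (\<Sum>j\<in>A. l j * (\<Sum>i | i \<in> insert x I \<and> c i = j. w i * X i)\<^sup>2))) \<partial>std_gauss (insert x I))
     = (\<integral>\<^sup>+X. \<integral>\<^sup>+y. ennreal (exp (- (\<Sum>j\<in>A. l j * (\<Sum>i | i \<in> insert x I \<and> c i = j. w i * (X(x := y)) i)\<^sup>2)))
             \<partial>density lborel std_normal_density \<partial>std_gauss I)"
    using insert.hyps by (subst product_nn_integral_insert) auto
  also have "\<dots> = (\<integral>\<^sup>+X. \<integral>\<^sup>+y. ennreal (exp (- G X)) * ennreal (exp (- l j0 * (P j0 X + w x * y)\<^sup>2))
             \<partial>density lborel std_normal_density \<partial>std_gauss I)"
    unfolding e1 by (intro nn_integral_cong) (simp add: ennreal_mult[symmetric] exp_add[symmetric])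
  also have "\<dots> = (\<integral>\<^sup>+X. ennreal (exp (- G X)) * ennreal (exp (- (l j0 / k) * (P j0 X)\<^sup>2) / sqrt k) \<partial>std_gauss I)"
    using k unfolding k_def by (intro nn_integral_cong, subst nn_integral_cmult, simp,
        subst nn_integral_std_normal_exp_square) auto
  also have "\<dots> = (\<integral>\<^sup>+X. ennreal (exp (- (\<Sum>j\<in>A. l' j * (P j X)\<^sup>2))) * ennreal (1 / sqrt k) \<partial>std_gauss I)"
    unfolding e2 using k by (intro nn_integral_cong) (simp add: ennreal_mult[symmetric] exp_add[symmetric] add.commute)
  also have "\<dots> = (\<integral>\<^sup>+X. ennreal (exp (- (\<Sum>j\<in>A. l' j * (P j X)\<^sup>2))) \<partial>std_gauss I) * ennreal (1 / sqrt k)"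
    by (subst nn_integral_multc) auto
  also have "(\<integral>\<^sup>+X. ennreal (exp (- (\<Sum>j\<in>A. l' j * (P j X)\<^sup>2))) \<partial>std_gauss I)
      = ennreal (\<Prod>j\<in>A. 1 / sqrt (1 + 2 * l' j * s j))"
    unfolding P_def s_def using insert.prems k by (intro insert.IH) (auto simp: l'_def)
  also have "\<dots> * ennreal (1 / sqrt k) = ennreal ((\<Prod>j\<in>A. 1 / sqrt (1 + 2 * l' j * s j)) * (1 / sqrt k))"
    using k by (subst ennreal_mult'') auto
  also have "(\<Prod>j\<in>A. 1 / sqrt (1 + 2 * l' j * s j)) * (1 / sqrt k)
      = (\<Prod>j\<in>A. 1 / sqrt (1 + 2 * l j * (\<Sum>i | i \<in> insert x I \<and> c i = j. (w i)\<^sup>2)))"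
  proof -
    \<comment> \<open>The factors telescope: multiplying by \<open>k\<close> restores the variance
      that \<open>x\<close> contributes to its class.\<close>
    have "k * (1 + 2 * (l j0 / k) * s j0) = 1 + 2 * l j0 * (s j0 + (w x)\<^sup>2)"
      using k by (simp add: field_simps) (simp add: k_def algebra_simps)
    then have "sqrt k * sqrt (1 + 2 * (l j0 / k) * s j0) = sqrt (1 + 2 * l j0 * (s j0 + (w x)\<^sup>2))"
      by (simp add: real_sqrt_mult[symmetric])
    then have *: "1 / sqrt (1 + 2 * l' j0 * s j0) * (1 / sqrt k) = 1 / sqrt (1 + 2 * l j0 * (s j0 + (w x)\<^sup>2))"
      by (simp add: l'_def mult.commute)
    have "(\<Prod>j\<in>A. 1 / sqrt (1 + 2 * l' j * s j)) * (1 / sqrt k)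
       = (1 / sqrt (1 + 2 * l' j0 * s j0) * (1 / sqrt k)) * (\<Prod>j\<in>A-{j0}. 1 / sqrt (1 + 2 * l' j * s j))"
      using j0 \<open>finite A\<close> by (subst prod.remove[of A j0]) auto
    also have "(\<Prod>j\<in>A-{j0}. 1 / sqrt (1 + 2 * l' j * s j)) = (\<Prod>j\<in>A-{j0}. 1 / sqrt (1 + 2 * l j * (\<Sum>i | i \<in> insert x I \<and> c i = j. (w i)\<^sup>2)))"
      unfolding s' by (intro prod.cong) (auto simp: l'_def)
    finally show ?thesis unfolding * s' using j0 \<open>finite A\<close>
      by (subst (2) prod.remove[of A j0]) auto
  qed
  finally show ?case .
qed

text \<open>Gram-Schmidt on the rows of the data restricted to \<open>F\<close>. These rows may be
  dependent, for instance when \<open>F\<close> has fewer than \<open>d\<close> elements; a row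
  whose new component \<open>v\<close> vanishes adds no basis vector, so only
  \<open>m \<le> d\<close> is claimed.\<close>

lemma gram_schmidt_functions:
  fixes r :: "nat \<Rightarrow> 'j \<Rightarrow> real"
  assumes "finite F"
  obtains m u c where "m \<le> d"
    "\<And>b b'. b < m \<Longrightarrow> b' < m \<Longrightarrow> (\<Sum>j\<in>F. u b j * u b' j) = (if b = b' then 1 else (0::real))"
    "\<And>l j. l < d \<Longrightarrow> j \<in> F \<Longrightarrow> r l j = (\<Sum>b<m. c l b * u b j)"
proof -
  have "\<exists>m\<le>d. \<exists>u c. (\<forall>b<m. \<forall>b'<m. (\<Sum>j\<in>F. u b j * u b' j) = (if b = b' then 1 else (0::real))) \<and>
     (\<forall>l<d. \<forall>j\<in>F. r l j = (\<Sum>b<m. c l b * u b j))"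
  proof (induction d)
    case 0
    show ?case by (rule exI[of _ 0]) simp
  next
    case (Suc d)
    then obtain m u c where m: "m \<le> d"
      and o': "\<forall>b<m. \<forall>b'<m. (\<Sum>j\<in>F. u b j * u b' j) = (if b = b' then 1 else (0::real))"
      and rep': "\<forall>l<d. \<forall>j\<in>F. r l j = (\<Sum>b<m. c l b * u b j)"
      by (elim exE conjE) (rule that)
    have o: "(\<Sum>j\<in>F. u b j * u b' j) = (if b = b' then 1 else (0::real))" if "b < m" "b' < m" for b b'
      using o'[rule_format, OF that] .
    have rep: "r l j = (\<Sum>b<m. c l b * u b j)" if "l < d" "j \<in> F" for l j
      using rep'[rule_format, OF that] .
    define e where "e b = (\<Sum>j\<in>F. r d j * u b j)" for b
    define v where "v j = r d j - (\<Sum>b<m. e b * u b j)" for j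
    define n where "n = (\<Sum>j\<in>F. (v j)\<^sup>2)"
    have vo: "(\<Sum>j\<in>F. v j * u b j) = 0" if "b < m" for b
    proof -
      have "(\<Sum>j\<in>F. v j * u b j) = e b - (\<Sum>j\<in>F. \<Sum>b'<m. e b' * (u b' j * u b j))"
        unfolding v_def e_def by (simp add: left_diff_distrib sum_subtractf sum_distrib_right mult.assoc)
      also have "(\<Sum>j\<in>F. \<Sum>b'<m. e b' * (u b' j * u b j)) = (\<Sum>b'<m. e b' * (\<Sum>j\<in>F. u b' j * u b j))"
        by (subst sum.swap) (simp add: sum_distrib_left)
      also have "\<dots> = (\<Sum>b'<m. if b' = b then e b' else 0)"
        using that by (intro sum.cong) (auto simp: o)
      also have "\<dots> = e b" using that by simp
      finally show ?thesis by simp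
    qed
    show ?case
    proof (cases "n = 0")
      case True
      then have "\<forall>j\<in>F. v j = 0" using assms by (simp add: n_def sum_nonneg_eq_0_iff)
      then have "\<forall>j\<in>F. r d j = (\<Sum>b<m. e b * u b j)" by (simp add: v_def)
      then show ?thesis using m o rep
        by (intro exI[of _ m] exI[of _ u] exI[of _ "c(d := e)"] conjI) (auto simp: less_Suc_eq)
    next
      case False
      then have n: "n > 0" unfolding n_def by (simp add: sum_nonneg less_le)
      define u' where "u' = u(m := (\<lambda>j. v j / sqrt n))"
      define c' where "c' l b = (if l < d then if b < m then c l b else 0 else if b < m then e b else sqrt n)" for l b
      have "(\<Sum>j\<in>F. u' m j * u' m j) = (\<Sum>j\<in>F. (v j)\<^sup>2) / n"
        unfolding u'_def using n by (simp add: sum_divide_distrib power2_eq_square)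
      then have mm: "(\<Sum>j\<in>F. u' m j * u' m j) = 1" using n by (simp add: n_def[symmetric])
      have mb: "(\<Sum>j\<in>F. u' m j * u' b j) = 0" if "b < m" for b
        unfolding u'_def using that vo[OF that] by (simp add: sum_divide_distrib[symmetric])
      have bm: "(\<Sum>j\<in>F. u' b j * u' m j) = 0" if "b < m" for b
        using mb[OF that] by (simp add: mult.commute)
      have bb: "(\<Sum>j\<in>F. u' b j * u' b' j) = (if b = b' then 1 else 0)" if "b < m" "b' < m" for b b'
        unfolding u'_def using that o by simp
      have rp: "r l j = (\<Sum>b<Suc m. c' l b * u' b j)" if "l < Suc d" "j \<in> F" for l j
      proof (cases "l < d")
        case True
        then show ?thesis using rep[OF True that(2)] by (simp add: c'_def u'_def)
      next
        case False
        then have "l = d" using that by simp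
        then show ?thesis using n by (simp add: c'_def u'_def v_def)
      qed
      show ?thesis using m mm mb bm bb rp
        by (intro exI[of _ "Suc m"] exI[of _ u'] exI[of _ c'] conjI) (auto simp: less_Suc_eq)
    qed
  qed
  then show ?thesis
    by (elim exE conjE) (rule that, auto)
qed

text \<open>Hubbard--Stratonovich: each factor exp (y^2 / 4) is written as a Gaussian average of
  exponentials linear in y, after which the integral over Z is explicit.\<close>

lemma nn_integral_std_gauss_exp_linear_plus_squares:
  fixes u :: "nat \<Rightarrow> 'j \<Rightarrow> real"
  assumes A: "finite A" "F \<subseteq> A"
    and o: "\<And>b b'. b < m \<Longrightarrow> b' < m \<Longrightarrow> (\<Sum>j\<in>F. u b j * u b' j) = (if b = b' then 1 else (0::real))"
  shows "(\<integral>\<^sup>+Z. ennreal (exp ((\<Sum>a<d. \<Sum>j\<in>A - F. \<alpha> a j * Z (a, j))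
           + (\<Sum>a<d. \<Sum>b<m. (\<Sum>j\<in>F. u b j * Z (a, j))\<^sup>2) / 4)) \<partial>std_gauss ({..<d} \<times> A))
       = ennreal (exp ((\<Sum>a<d. \<Sum>j\<in>A - F. (\<alpha> a j)\<^sup>2) / 2) * sqrt 2 ^ (d * m))"
proof -
  let ?I = "{..<d} \<times> A" and ?P = "{..<d} \<times> {..<m}"
  interpret G1: prob_space "std_gauss ?I" by (rule prob_space_std_gauss)
  interpret G2: prob_space "std_gauss ?P" by (rule prob_space_std_gauss)
  interpret pair_sigma_finite "std_gauss ?I" "std_gauss ?P" by standard
  define L where "L Z = (\<Sum>a<d. \<Sum>j\<in>A - F. \<alpha> a j * Z (a, j))" for Z :: "nat \<times> 'j \<Rightarrow> real"
  define Y where "Y Z p = (\<Sum>j\<in>F. u (snd p) j * Z (fst p, j))" for Z :: "nat \<times> 'j \<Rightarrow> real" and p :: "nat \<times> nat"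
  have Lm [measurable]: "L \<in> borel_measurable (std_gauss ?I)" unfolding L_def by measurable
  have Ym [measurable]: "(\<lambda>Z. Y Z p) \<in> borel_measurable (std_gauss ?I)" for p unfolding Y_def by measurable
  \<comment> \<open>The scale 1 / sqrt 2 is there because exp (y^2 / 4) is the mean of exp (y g /
    sqrt 2) over a standard Gaussian g. For fixed \<open>g\<close> the exponent is linear in Z with
    coefficients \<open>\<gamma> g\<close>.\<close>
  define \<gamma> where "\<gamma> g p = (if snd p \<in> F then (\<Sum>b<m. g (fst p, b) * u b (snd p)) / sqrt 2 else \<alpha> (fst p) (snd p))"
    for g :: "nat \<times> nat \<Rightarrow> real" and p
  have split: "(\<Sum>p\<in>?I. f p) = (\<Sum>a<d. \<Sum>j\<in>F. f (a, j)) + (\<Sum>a<d. \<Sum>j\<in>A - F. f (a, j))" for f :: "nat \<times> 'j \<Rightarrow> real"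
  proof -
    have "(\<Sum>p\<in>?I. f p) = (\<Sum>a<d. \<Sum>j\<in>A. f (a, j))" by (simp add: sum.cartesian_product)
    also have "\<dots> = (\<Sum>a<d. (\<Sum>j\<in>F. f (a, j)) + (\<Sum>j\<in>A - F. f (a, j)))"
      using A by (intro sum.cong) (auto simp: sum.subset_diff add.commute)
    finally show ?thesis by (simp add: sum.distrib)
  qed
  have lin: "L Z + (\<Sum>p\<in>?P. Y Z p / sqrt 2 * g p) = (\<Sum>p\<in>?I. \<gamma> g p * Z p)" for Z g
  proof -
    have "(\<Sum>p\<in>?P. Y Z p / sqrt 2 * g p) = (\<Sum>a<d. \<Sum>b<m. Y Z (a, b) / sqrt 2 * g (a, b))"
      by (simp add: sum.cartesian_product)
    also have "\<dots> = (\<Sum>a<d. \<Sum>b<m. \<Sum>j\<in>F. g (a, b) * u b j / sqrt 2 * Z (a, j))"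
      by (simp add: Y_def sum_distrib_left sum_divide_distrib mult_ac)
    also have "\<dots> = (\<Sum>a<d. \<Sum>j\<in>F. \<gamma> g (a, j) * Z (a, j))"
      by (intro sum.cong refl, subst sum.swap)
        (auto simp: \<gamma>_def sum_distrib_right sum_divide_distrib)
    finally show ?thesis unfolding split L_def by (simp add: \<gamma>_def)
  qed
  \<comment> \<open>Orthonormality of \<open>u\<close> makes the part over \<open>F\<close> equal to
    |g|^2 / 2, so the integral over Z leaves exp (|g|^2 / 4), of mean sqrt 2 per coordinate of
    \<open>g\<close>.\<close>
  have sq: "(\<Sum>p\<in>?I. (\<gamma> g p)\<^sup>2) = (\<Sum>p\<in>?P. (g p)\<^sup>2) / 2 + (\<Sum>a<d. \<Sum>j\<in>A - F. (\<alpha> a j)\<^sup>2)" for g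
  proof -
    have "(\<Sum>j\<in>F. (\<gamma> g (a, j))\<^sup>2) = (\<Sum>b<m. (g (a, b))\<^sup>2) / 2" for a
    proof -
      have "(\<Sum>j\<in>F. (\<gamma> g (a, j))\<^sup>2) = (\<Sum>j\<in>F. \<Sum>b<m. \<Sum>b'<m. g (a, b) * g (a, b') * (u b j * u b' j)) / 2"
        by (simp add: \<gamma>_def power_divide power2_eq_square sum_product sum_divide_distrib mult_ac)
      also have "(\<Sum>j\<in>F. \<Sum>b<m. \<Sum>b'<m. g (a, b) * g (a, b') * (u b j * u b' j))
         = (\<Sum>b<m. \<Sum>j\<in>F. \<Sum>b'<m. g (a, b) * g (a, b') * (u b j * u b' j))"
        by (rule sum.swap)
      also have "\<dots> = (\<Sum>b<m. \<Sum>b'<m. g (a, b) * g (a, b') * (\<Sum>j\<in>F. u b j * u b' j))"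
        by (intro sum.cong refl, subst sum.swap) (simp add: sum_distrib_left)
      also have "\<dots> = (\<Sum>b<m. \<Sum>b'<m. if b' = b then g (a, b) * g (a, b') else 0)"
        by (intro sum.cong refl) (auto simp: o)
      also have "\<dots> = (\<Sum>b<m. (g (a, b))\<^sup>2)" by (simp add: power2_eq_square)
      finally show ?thesis .
    qed
    moreover have "(\<Sum>p\<in>?P. (g p)\<^sup>2) = (\<Sum>a<d. \<Sum>b<m. (g (a, b))\<^sup>2)" by (simp add: sum.cartesian_product)
    ultimately show ?thesis unfolding split by (simp add: \<gamma>_def sum_divide_distrib)
  qed
  have "(\<integral>\<^sup>+Z. ennreal (exp (L Z + (\<Sum>a<d. \<Sum>b<m. (\<Sum>j\<in>F. u b j * Z (a, j))\<^sup>2) / 4)) \<partial>std_gauss ?I)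
     = (\<integral>\<^sup>+Z. \<integral>\<^sup>+g. ennreal (exp (\<Sum>p\<in>?I. \<gamma> g p * Z p)) \<partial>std_gauss ?P \<partial>std_gauss ?I)"
  proof (rule nn_integral_cong)
    fix Z :: "nat \<times> 'j \<Rightarrow> real"
    have "(\<Sum>a<d. \<Sum>b<m. (\<Sum>j\<in>F. u b j * Z (a, j))\<^sup>2) = (\<Sum>p\<in>?P. (Y Z p)\<^sup>2)"
      by (simp add: sum.cartesian_product Y_def split_beta)
    then have "ennreal (exp (L Z + (\<Sum>a<d. \<Sum>b<m. (\<Sum>j\<in>F. u b j * Z (a, j))\<^sup>2) / 4))
      = ennreal (exp (L Z)) * ennreal (exp ((\<Sum>p\<in>?P. (Y Z p / sqrt 2)\<^sup>2) / 2))"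
      by (simp add: exp_add ennreal_mult power_divide sum_divide_distrib)
    also have "\<dots> = ennreal (exp (L Z)) * (\<integral>\<^sup>+g. ennreal (exp (\<Sum>p\<in>?P. Y Z p / sqrt 2 * g p)) \<partial>std_gauss ?P)"
      by (subst nn_integral_std_gauss_exp_linear) auto
    also have "\<dots> = (\<integral>\<^sup>+g. ennreal (exp (L Z)) * ennreal (exp (\<Sum>p\<in>?P. Y Z p / sqrt 2 * g p)) \<partial>std_gauss ?P)"
      by (subst nn_integral_cmult) auto
    also have "\<dots> = (\<integral>\<^sup>+g. ennreal (exp (\<Sum>p\<in>?I. \<gamma> g p * Z p)) \<partial>std_gauss ?P)"
      unfolding lin[symmetric] by (simp add: exp_add ennreal_mult)
    finally show "ennreal (exp (L Z + (\<Sum>a<d. \<Sum>b<m. (\<Sum>j\<in>F. u b j * Z (a, j))\<^sup>2) / 4))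
      = (\<integral>\<^sup>+g. ennreal (exp (\<Sum>p\<in>?I. \<gamma> g p * Z p)) \<partial>std_gauss ?P)" .
  qed
  also have "\<dots> = (\<integral>\<^sup>+g. \<integral>\<^sup>+Z. ennreal (exp (\<Sum>p\<in>?I. \<gamma> g p * Z p)) \<partial>std_gauss ?I \<partial>std_gauss ?P)"
    unfolding lin[symmetric] by (rule Fubini'[symmetric]) measurable
  also have "\<dots> = (\<integral>\<^sup>+g. ennreal (exp ((\<Sum>a<d. \<Sum>j\<in>A - F. (\<alpha> a j)\<^sup>2) / 2)) * ennreal (exp ((\<Sum>p\<in>?P. (g p)\<^sup>2) / 4)) \<partial>std_gauss ?P)"
    using A by (intro nn_integral_cong, subst nn_integral_std_gauss_exp_linear)
      (auto simp: sq ennreal_mult[symmetric] exp_add[symmetric] add_divide_distrib add.commute)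
  also have "\<dots> = ennreal (exp ((\<Sum>a<d. \<Sum>j\<in>A - F. (\<alpha> a j)\<^sup>2) / 2)) * ennreal (sqrt 2 ^ (d * m))"
    by (subst nn_integral_cmult) (auto simp: nn_integral_std_gauss_exp_square)
  finally show ?thesis by (simp add: ennreal_mult L_def)
qed

text \<open>This is |s Z|^2 - |V - s Z|^2, the drop in squared residuals when the true fit is
  displaced by \<open>V\<close>; in other words 2 s^2 times a log-likelihood ratio.\<close>

definition gain :: "nat \<Rightarrow> real \<Rightarrow> 'j set \<Rightarrow> (nat \<Rightarrow> 'j \<Rightarrow> real) \<Rightarrow> (nat \<times> 'j \<Rightarrow> real) \<Rightarrow> real" where
  "gain d s A V Z = (\<Sum>a<d. \<Sum>i\<in>A. 2 * s * V a i * Z (a, i) - (V a i)\<^sup>2)"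

text \<open>In the basis \<open>u\<close> the gain separates into terms 2 s e y - e^2, each at most
  s^2 y^2. The bound no longer contains the coefficients \<open>e\<close>, so it holds for all
  matrices acting on the rows at once.\<close>

lemma gain_le_projection:
  fixes u :: "nat \<Rightarrow> 'j \<Rightarrow> real"
  assumes o: "\<And>b b'. b < m \<Longrightarrow> b' < m \<Longrightarrow> (\<Sum>j\<in>F. u b j * u b' j) = (if b = b' then 1 else (0::real))"
    and V: "\<And>a i. a < d \<Longrightarrow> i \<in> F \<Longrightarrow> V a i = (\<Sum>b<m. e a b * u b i)"
  shows "gain d s F V Z \<le> s\<^sup>2 * (\<Sum>a<d. \<Sum>b<m. (\<Sum>j\<in>F. u b j * Z (a, j))\<^sup>2)"
  unfolding gain_def sum_distrib_left
proof (rule sum_mono)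
  fix a assume "a \<in> {..<d}"
  then have V: "V a i = (\<Sum>b<m. e a b * u b i)" if "i \<in> F" for i using V that by simp
  have 1: "(\<Sum>i\<in>F. V a i * Z (a, i)) = (\<Sum>b<m. e a b * (\<Sum>j\<in>F. u b j * Z (a, j)))"
  proof -
    have "(\<Sum>i\<in>F. V a i * Z (a, i)) = (\<Sum>i\<in>F. \<Sum>b<m. e a b * (u b i * Z (a, i)))"
      by (intro sum.cong) (auto simp: V sum_distrib_left mult_ac)
    then show ?thesis by (subst (asm) sum.swap) (simp add: sum_distrib_left)
  qed
  have 2: "(\<Sum>i\<in>F. (V a i)\<^sup>2) = (\<Sum>b<m. (e a b)\<^sup>2)"
  proof -
    have "(\<Sum>i\<in>F. (V a i)\<^sup>2) = (\<Sum>j\<in>F. \<Sum>b<m. \<Sum>b'<m. e a b * e a b' * (u b j * u b' j))"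
      by (intro sum.cong) (auto simp: V power2_eq_square sum_product mult_ac)
    also have "\<dots> = (\<Sum>b<m. \<Sum>j\<in>F. \<Sum>b'<m. e a b * e a b' * (u b j * u b' j))"
      by (rule sum.swap)
    also have "\<dots> = (\<Sum>b<m. \<Sum>b'<m. e a b * e a b' * (\<Sum>j\<in>F. u b j * u b' j))"
      by (intro sum.cong refl, subst sum.swap) (simp add: sum_distrib_left)
    also have "\<dots> = (\<Sum>b<m. \<Sum>b'<m. if b' = b then e a b * e a b' else 0)"
      by (intro sum.cong refl) (auto simp: o)
    also have "\<dots> = (\<Sum>b<m. (e a b)\<^sup>2)"
      by (intro sum.cong refl) (auto simp: power2_eq_square sum.delta)
    finally show ?thesis .
  qed
  have "(\<Sum>i\<in>F. 2 * s * V a i * Z (a, i) - (V a i)\<^sup>2)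
     = 2 * s * (\<Sum>i\<in>F. V a i * Z (a, i)) - (\<Sum>i\<in>F. (V a i)\<^sup>2)"
    by (simp add: sum_subtractf sum_distrib_left mult_ac)
  also have "\<dots> = (\<Sum>b<m. 2 * s * (e a b * (\<Sum>j\<in>F. u b j * Z (a, j))) - (e a b)\<^sup>2)"
    unfolding 1 2 by (simp only: sum_subtractf sum_distrib_left)
  also have "\<dots> \<le> (\<Sum>b<m. s\<^sup>2 * (\<Sum>j\<in>F. u b j * Z (a, j))\<^sup>2)"
  proof (rule sum_mono)
    fix b
    have "0 \<le> (s * (\<Sum>j\<in>F. u b j * Z (a, j)) - e a b)\<^sup>2" by simp
    then show "2 * s * (e a b * (\<Sum>j\<in>F. u b j * Z (a, j))) - (e a b)\<^sup>2 \<le> s\<^sup>2 * (\<Sum>j\<in>F. u b j * Z (a, j))\<^sup>2"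
      by (simp add: power2_eq_square algebra_simps)
  qed
  finally show "(\<Sum>i\<in>F. 2 * s * V a i * Z (a, i) - (V a i)\<^sup>2) \<le> (\<Sum>b<m. s\<^sup>2 * (\<Sum>j\<in>F. u b j * Z (a, j))\<^sup>2)" .
qed

text \<open>Markov's inequality for exp (15 gain), with X frozen in \<open>r\<close> and
  \<open>W\<close>. On \<open>F\<close> the projection bound removes \<open>D\<close>, and 15 s^2
  \<le> 1/4 leaves exp (Y / 4); thus \<open>C\<close> may be uncountable and costs only sqrt 2 ^ (d
  * d). On \<open>A - F\<close> the displacement is fixed and contributes its Gaussian
  moment.\<close>

lemma emeasure_gain_le:
  fixes r :: "nat \<Rightarrow> 'j \<Rightarrow> real" and C :: "(nat \<times> nat \<Rightarrow> real) set"
  assumes A: "finite A" "F \<subseteq> A" and s: "60 * s\<^sup>2 \<le> 1"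
  shows "emeasure (std_gauss ({..<d} \<times> A)) {Z \<in> space (std_gauss ({..<d} \<times> A)).
       \<exists>D\<in>C. gain d s F (\<lambda>a i. \<Sum>l<d. D (a, l) * r l i) Z + gain d s (A - F) W Z \<ge> - t}
     \<le> ennreal (exp (15 * t) * sqrt 2 ^ (d * d) * exp (- (15/2) * (\<Sum>a<d. \<Sum>i\<in>A - F. (W a i)\<^sup>2)))"
    (is "emeasure ?M ?S \<le> _")
proof -
  have fF: "finite F" using A finite_subset by auto
  obtain m u c where m: "m \<le> d"
    and o: "\<And>b b'. b < m \<Longrightarrow> b' < m \<Longrightarrow> (\<Sum>j\<in>F. u b j * u b' j) = (if b = b' then 1 else (0::real))"
    and rep: "\<And>l j. l < d \<Longrightarrow> j \<in> F \<Longrightarrow> r l j = (\<Sum>b<m. c l b * u b j)"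
    by (rule gram_schmidt_functions[OF fF, where d = d and r = r]) (rule that)
  define w where "w = (\<Sum>a<d. \<Sum>i\<in>A - F. (W a i)\<^sup>2)"
  have w: "w \<ge> 0" unfolding w_def by (intro sum_nonneg) auto
  define \<alpha> where "\<alpha> a i = 30 * s * W a i" for a i
  define H where "H Z = (\<Sum>a<d. \<Sum>j\<in>A - F. \<alpha> a j * Z (a, j)) + (\<Sum>a<d. \<Sum>b<m. (\<Sum>j\<in>F. u b j * Z (a, j))\<^sup>2) / 4"
    for Z :: "nat \<times> 'j \<Rightarrow> real"
  have Hm [measurable]: "H \<in> borel_measurable ?M" unfolding H_def by measurable
  have key: "0 \<le> 15 * t - 15 * w + H Z" if ZS: "Z \<in> ?S" for Z
  proof -
    obtain D where D: "gain d s F (\<lambda>a i. \<Sum>l<d. D (a, l) * r l i) Z + gain d s (A - F) W Z \<ge> - t"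
      using ZS by auto
    define Y where "Y = (\<Sum>a<d. \<Sum>b<m. (\<Sum>j\<in>F. u b j * Z (a, j))\<^sup>2)"
    have Y: "Y \<ge> 0" unfolding Y_def by (intro sum_nonneg) auto
    have "gain d s F (\<lambda>a i. \<Sum>l<d. D (a, l) * r l i) Z \<le> s\<^sup>2 * Y"
      unfolding Y_def
    proof (rule gain_le_projection[OF o])
      fix a i assume "i \<in> F"
      have "(\<Sum>l<d. D (a, l) * r l i) = (\<Sum>l<d. \<Sum>b<m. D (a, l) * c l b * u b i)"
        using \<open>i \<in> F\<close> by (intro sum.cong) (auto simp: rep sum_distrib_left mult.assoc)
      then show "(\<Sum>l<d. D (a, l) * r l i) = (\<Sum>b<m. (\<Sum>l<d. D (a, l) * c l b) * u b i)"
        by (subst (asm) sum.swap) (simp add: sum_distrib_right)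
    qed
    moreover have "60 * (s\<^sup>2 * Y) \<le> Y" using mult_right_mono[OF s Y] by simp
    moreover have "15 * gain d s (A - F) W Z = (\<Sum>a<d. \<Sum>j\<in>A - F. \<alpha> a j * Z (a, j)) - 15 * w"
      unfolding gain_def w_def \<alpha>_def by (simp add: sum_subtractf sum_distrib_left right_diff_distrib mult_ac)
    ultimately show ?thesis using D unfolding H_def Y_def[symmetric] by linarith
  qed
  \<comment> \<open>Here 30^2 s^2 / 2 \<le> 15/2; combined with the deterministic term -15
    \<open>w\<close> this leaves -15/2 \<open>w\<close>.\<close>
  have al: "(\<Sum>a<d. \<Sum>j\<in>A - F. (\<alpha> a j)\<^sup>2) / 2 \<le> 15 / 2 * w"
  proof -
    have "(\<Sum>a<d. \<Sum>j\<in>A - F. (\<alpha> a j)\<^sup>2) = 900 * s\<^sup>2 * w"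
      unfolding \<alpha>_def w_def by (simp add: power_mult_distrib sum_distrib_left mult_ac)
    moreover have "60 * s\<^sup>2 * w \<le> 1 * w" using s w by (intro mult_right_mono) auto
    ultimately show ?thesis by linarith
  qed
  have "emeasure ?M ?S \<le> (\<integral>\<^sup>+Z. ennreal (exp (15 * t - 15 * w + H Z)) \<partial>?M)"
    by (rule emeasure_le_nn_integral_exp) (rule key)
  also have "\<dots> = (\<integral>\<^sup>+Z. ennreal (exp (15 * t - 15 * w)) * ennreal (exp (H Z)) \<partial>?M)"
    by (simp only: exp_add ennreal_mult[OF exp_ge_zero exp_ge_zero])
  also have "\<dots> = ennreal (exp (15 * t - 15 * w)) * ennreal (exp ((\<Sum>a<d. \<Sum>j\<in>A - F. (\<alpha> a j)\<^sup>2) / 2) * sqrt 2 ^ (d * m))"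
    using nn_integral_std_gauss_exp_linear_plus_squares[OF A o, where d = d and \<alpha> = \<alpha>]
    by (subst nn_integral_cmult) (auto simp: H_def)
  also have "\<dots> \<le> ennreal (exp (15 * t - 15 * w)) * ennreal (exp (15 / 2 * w) * sqrt 2 ^ (d * d))"
  proof (intro mult_left_mono ennreal_leI mult_mono power_increasing)
    show "exp ((\<Sum>a<d. \<Sum>j\<in>A - F. (\<alpha> a j)\<^sup>2) / 2) \<le> exp (15 / 2 * w)" using al by simp
    show "m \<le> d" by (rule m)
  qed simp_all
  also have "\<dots> = ennreal (exp (15 * t) * sqrt 2 ^ (d * d) * exp (- (15/2) * w))"
  proof -
    have "exp (15 * t - 15 * w) * (exp (15 / 2 * w) * sqrt 2 ^ (d * d)) = exp (15 * t) * sqrt 2 ^ (d * d) * exp (- (15/2) * w)"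
    proof -
      have "exp (15 * t - 15 * w) * exp (15 / 2 * w) = exp (15 * t) * exp (- (15/2) * w)"
        by (simp add: exp_add[symmetric])
      then show ?thesis by (simp add: mult.assoc[symmetric])
    qed
    then show ?thesis by (simp add: ennreal_mult[symmetric])
  qed
  finally show ?thesis by (simp add: w_def)
qed

section \<open>Rounding, counting and permuted residuals\<close>

text \<open>Each coordinate is rounded up or down so that the cross term with the error accumulated
  so far is nonpositive; hence the squared errors merely add up.\<close>

lemma exists_rounding:
  fixes q :: "'i \<Rightarrow> real" and x :: "'i \<Rightarrow> 'j \<Rightarrow> real"
  assumes "finite L" "\<delta> > 0"
  obtains m :: "'i \<Rightarrow> int" where "\<And>l. l \<in> L \<Longrightarrow> \<bar>q l - \<delta> * real_of_int (m l)\<bar> \<le> \<delta>"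
    "(\<Sum>j\<in>K. (\<Sum>l\<in>L. (q l - \<delta> * real_of_int (m l)) * x l j)\<^sup>2) \<le> \<delta>\<^sup>2 * (\<Sum>l\<in>L. \<Sum>j\<in>K. (x l j)\<^sup>2)"
proof -
  have "\<exists>m :: 'i \<Rightarrow> int. (\<forall>l\<in>L. \<bar>q l - \<delta> * real_of_int (m l)\<bar> \<le> \<delta>) \<and>
    (\<Sum>j\<in>K. (\<Sum>l\<in>L. (q l - \<delta> * real_of_int (m l)) * x l j)\<^sup>2) \<le> \<delta>\<^sup>2 * (\<Sum>l\<in>L. \<Sum>j\<in>K. (x l j)\<^sup>2)"
    using assms(1)
  proof (induction L rule: finite_induct)
    case (insert l L)
    then obtain m :: "'i \<Rightarrow> int" where m1: "\<forall>l\<in>L. \<bar>q l - \<delta> * real_of_int (m l)\<bar> \<le> \<delta>"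
      and m2: "(\<Sum>j\<in>K. (\<Sum>l\<in>L. (q l - \<delta> * real_of_int (m l)) * x l j)\<^sup>2) \<le> \<delta>\<^sup>2 * (\<Sum>l\<in>L. \<Sum>j\<in>K. (x l j)\<^sup>2)"
      by blast
    define w where "w j = (\<Sum>l\<in>L. (q l - \<delta> * real_of_int (m l)) * x l j)" for j
    define c where "c = (\<Sum>j\<in>K. w j * x l j)"
    define z where "z = (if c \<ge> 0 then \<lceil>q l / \<delta>\<rceil> else \<lfloor>q l / \<delta>\<rfloor>)"
    define e where "e = q l - \<delta> * real_of_int z"
    have e': "e = \<delta> * (q l / \<delta> - real_of_int z)" using \<open>\<delta> > 0\<close> by (simp add: e_def right_diff_distrib)
    have fr: "\<bar>q l / \<delta> - real_of_int z\<bar> \<le> 1" unfolding z_def by (auto simp: abs_le_iff) linarith+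
    then have eb: "\<bar>e\<bar> \<le> \<delta>" unfolding e' using \<open>\<delta> > 0\<close> by (simp add: abs_mult mult_left_le)
    have ec: "e * c \<le> 0"
    proof (cases "c \<ge> 0")
      case True
      then have "q l / \<delta> - real_of_int z \<le> 0" by (simp add: z_def)
      then have "e \<le> 0" unfolding e' using \<open>\<delta> > 0\<close> by (simp add: mult_le_0_iff)
      then show ?thesis using True by (simp add: mult_le_0_iff)
    next
      case False
      then have "q l / \<delta> - real_of_int z \<ge> 0" by (simp add: z_def)
      then have "e \<ge> 0" unfolding e' using \<open>\<delta> > 0\<close> by simp
      then show ?thesis using False by (simp add: mult_le_0_iff)
    qed
    define m' where "m' = m(l := z)"
    have s: "(\<Sum>l\<in>insert l L. (q l - \<delta> * real_of_int (m' l)) * x l j) = e * x l j + w j" for j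
    proof -
      have "(\<Sum>l\<in>L. (q l - \<delta> * real_of_int (m' l)) * x l j) = w j"
        unfolding w_def m'_def using insert.hyps by (intro sum.cong) auto
      then show ?thesis using insert.hyps by (simp add: e_def m'_def)
    qed
    have "(\<Sum>j\<in>K. (e * x l j + w j)\<^sup>2) = e\<^sup>2 * (\<Sum>j\<in>K. (x l j)\<^sup>2) + 2 * (e * c) + (\<Sum>j\<in>K. (w j)\<^sup>2)"
      by (simp add: power2_sum power_mult_distrib sum.distrib sum_distrib_left c_def mult_ac)
    also have "\<dots> \<le> \<delta>\<^sup>2 * (\<Sum>j\<in>K. (x l j)\<^sup>2) + 0 + \<delta>\<^sup>2 * (\<Sum>l\<in>L. \<Sum>j\<in>K. (x l j)\<^sup>2)"
    proof (intro add_mono mult_right_mono)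
      show "e\<^sup>2 \<le> \<delta>\<^sup>2" using eb \<open>\<delta> > 0\<close> by (simp add: abs_le_square_iff[symmetric])
      show "2 * (e * c) \<le> 0" using ec by linarith
      show "(\<Sum>j\<in>K. (w j)\<^sup>2) \<le> \<delta>\<^sup>2 * (\<Sum>l\<in>L. \<Sum>j\<in>K. (x l j)\<^sup>2)"
        using m2 by (simp add: w_def)
    qed (simp add: sum_nonneg)
    also have "\<dots> = \<delta>\<^sup>2 * (\<Sum>l\<in>insert l L. \<Sum>j\<in>K. (x l j)\<^sup>2)"
      using insert.hyps by (simp add: algebra_simps)
    finally have "(\<Sum>j\<in>K. (\<Sum>l\<in>insert l L. (q l - \<delta> * real_of_int (m' l)) * x l j)\<^sup>2) \<le> \<dots>"
      unfolding s .
    moreover have "\<forall>l\<in>insert l L. \<bar>q l - \<delta> * real_of_int (m' l)\<bar> \<le> \<delta>"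
      using m1 eb by (auto simp: m'_def e_def)
    ultimately show ?case by blast
  qed simp
  then show ?thesis using that by blast
qed

text \<open>A ball instead of a cube: at spacing \<epsilon> / sqrt d the cube of matrices with
  entries in [-1, 1] holds about (sqrt d / \<epsilon>) ^ (d * d) grid points, a loss of log d in the
  exponent, while the ball keeps the count exponential in \<open>card I\<close>.\<close>

definition int_ball :: "'i set \<Rightarrow> real \<Rightarrow> ('i \<Rightarrow> int) set" where
  "int_ball I \<rho> = {m \<in> I \<rightarrow>\<^sub>E UNIV. (\<Sum>i\<in>I. (real_of_int (m i))\<^sup>2) \<le> \<rho> * real (card I)}"

text \<open>Compare exp (- z^2) with 2^(-|z|) and sum the geometric series; the subtracted tail
  carries the induction.\<close>

lemma sum_exp_minus_square_le: "(\<Sum>z\<in>{- int R..int R}. exp (- (real_of_int z)\<^sup>2)) \<le> 3 - 2 * (1/2) ^ R"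
proof (induction R)
  case (Suc R)
  have "{- int (Suc R)..int (Suc R)} = insert (- int (Suc R)) (insert (int (Suc R)) {- int R..int R})" by auto
  then have "(\<Sum>z\<in>{- int (Suc R)..int (Suc R)}. exp (- (real_of_int z)\<^sup>2))
      = 2 * exp (- (real (Suc R))\<^sup>2) + (\<Sum>z\<in>{- int R..int R}. exp (- (real_of_int z)\<^sup>2))"
    by (simp add: power2_eq_square algebra_simps)
  moreover have "exp (- (real (Suc R))\<^sup>2) \<le> (1/2) ^ Suc R"
  proof -
    have "exp (- (real (Suc R))\<^sup>2) \<le> exp (real (Suc R) * (-1))"
      using self_le_power[of "real (Suc R)" 2] by simp
    also have "\<dots> = exp (-1) ^ Suc R" by (rule exp_of_nat_mult)
    also have "\<dots> \<le> (1/2) ^ Suc R"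
    proof (rule power_mono)
      have "2 \<le> exp (1::real)" using exp_ge_add_one_self[of 1] by simp
      then show "exp (-1) \<le> (1/2 :: real)" by (simp add: exp_minus field_simps)
    qed simp
    finally show ?thesis .
  qed
  ultimately show ?case using Suc by simp
qed simp

text \<open>Every point of the ball has weight exp (\<rho> |I|) exp (- |m|^2) \<ge> 1. Summed over a
  box that contains the ball, the weights factorise over the coordinates, and each factor is at most
  3.\<close>

lemma finite_int_ball [simp]: "finite I \<Longrightarrow> finite (int_ball I \<rho>)"
  and card_int_ball_le: "finite I \<Longrightarrow> real (card (int_ball I \<rho>)) \<le> (3 * exp \<rho>) ^ card I"
proof -
  assume I: "finite I"
  define R where "R = nat \<lceil>\<rho> * real (card I)\<rceil>"
  have R: "\<rho> * real (card I) \<le> real R" unfolding R_def by linarith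
  define B where "B = I \<rightarrow>\<^sub>E {- int R..int R}"
  have fB: "finite B" unfolding B_def using I by (intro finite_PiE) auto
  have sub: "int_ball I \<rho> \<subseteq> B"
  proof
    fix m assume m: "m \<in> int_ball I \<rho>"
    have "m i \<in> {- int R..int R}" if "i \<in> I" for i
    proof -
      have "\<bar>m i\<bar> \<le> (m i)\<^sup>2"
        using self_le_power[of "\<bar>m i\<bar>" 2] by (cases "m i = 0") auto
      then have "\<bar>real_of_int (m i)\<bar> \<le> (real_of_int (m i))\<^sup>2"
        by (metis of_int_abs of_int_le_iff of_int_power)
      also have "\<dots> \<le> (\<Sum>i\<in>I. (real_of_int (m i))\<^sup>2)"
        using I that by (intro member_le_sum) auto
      also have "\<dots> \<le> real R" using m R by (auto simp: int_ball_def)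
      finally show ?thesis by simp linarith
    qed
    then show "m \<in> B" using m by (auto simp: B_def int_ball_def PiE_iff)
  qed
  show f: "finite (int_ball I \<rho>)" using fB sub by (rule rev_finite_subset)
  have "real (card (int_ball I \<rho>)) = (\<Sum>m\<in>int_ball I \<rho>. 1)" by simp
  also have "\<dots> \<le> (\<Sum>m\<in>int_ball I \<rho>. exp (\<rho> * real (card I)) * (\<Prod>i\<in>I. exp (- (real_of_int (m i))\<^sup>2)))"
    using I by (intro sum_mono) (auto simp: int_ball_def exp_sum[symmetric] exp_add[symmetric] sum_negf)
  also have "\<dots> \<le> (\<Sum>m\<in>B. exp (\<rho> * real (card I)) * (\<Prod>i\<in>I. exp (- (real_of_int (m i))\<^sup>2)))"
    using fB sub by (intro sum_mono2) (simp_all add: prod_nonneg)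
  also have "\<dots> = exp (\<rho> * real (card I)) * (\<Prod>i\<in>I. \<Sum>z\<in>{- int R..int R}. exp (- (real_of_int z)\<^sup>2))"
    unfolding B_def using I by (subst prod_sum_PiE) (auto simp: sum_distrib_left)
  also have "\<dots> \<le> exp (\<rho> * real (card I)) * (\<Prod>i\<in>I. 3)"
  proof (intro mult_left_mono prod_mono conjI)
    show "(\<Sum>z\<in>{- int R..int R}. exp (- (real_of_int z)\<^sup>2)) \<le> 3"
      by (rule order.trans[OF sum_exp_minus_square_le]) simp
  qed (auto intro!: sum_nonneg)
  also have "\<dots> = (3 * exp \<rho>) ^ card I"
    by (simp add: power_mult_distrib exp_of_nat_mult[symmetric] mult.commute)
  finally show "real (card (int_ball I \<rho>)) \<le> (3 * exp \<rho>) ^ card I" .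
qed

text \<open>Write p = t o q with t = p o q^-1. Then t permutes the image under q of the k
  disagreeing indices, so there are at most (n choose k) k! choices.\<close>

lemma card_permutations_at_distance_le:
  assumes q: "q permutes {..<n}"
  shows "card {p. p permutes {..<n} \<and> card {i \<in> {..<n}. p i \<noteq> q i} = k} \<le> n ^ k"
proof -
  define Ks where "Ks = {K. K \<subseteq> {..<n} \<and> card K = k}"
  have fKs: "finite Ks" unfolding Ks_def by (rule finite_subset[of _ "Pow {..<n}"]) auto
  have fp: "finite {t. t permutes K}" if "K \<in> Ks" for K
    using that by (intro finite_permutations) (auto simp: Ks_def intro: finite_subset)
  have sub: "{p. p permutes {..<n} \<and> card {i \<in> {..<n}. p i \<noteq> q i} = k}
      \<subseteq> (\<Union>K\<in>Ks. (\<lambda>t. t \<circ> q) ` {t. t permutes K})"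
  proof
    fix p assume "p \<in> {p. p permutes {..<n} \<and> card {i \<in> {..<n}. p i \<noteq> q i} = k}"
    then have p: "p permutes {..<n}" and k: "card {i \<in> {..<n}. p i \<noteq> q i} = k" by auto
    define K where "K = q ` {i \<in> {..<n}. p i \<noteq> q i}"
    have "card K = k" unfolding K_def k[symmetric]
      by (rule card_image) (use permutes_inj[OF q] in \<open>auto simp: inj_on_def\<close>)
    moreover have "K \<subseteq> {..<n}" unfolding K_def using permutes_in_image[OF q] by auto
    ultimately have K: "K \<in> Ks" by (simp add: Ks_def)
    have t: "p \<circ> inv q permutes {..<n}" using p q by (intro permutes_compose permutes_inv)
    have "p \<circ> inv q permutes K"
    proof (rule permutes_superset[OF t])
      show "(p \<circ> inv q) j = j" if "j \<in> {..<n} - K" for j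
      proof -
        have "inv q j \<in> {..<n}" using permutes_in_image[OF permutes_inv[OF q]] that by blast
        moreover have "q (inv q j) = j" using permutes_inverses(1)[OF q] .
        ultimately show ?thesis using that unfolding K_def by (force simp: image_iff)
      qed
    qed
    moreover have "(p \<circ> inv q) \<circ> q = p" using permutes_inverses(2)[OF q] by (auto simp: fun_eq_iff)
    ultimately show "p \<in> (\<Union>K\<in>Ks. (\<lambda>t. t \<circ> q) ` {t. t permutes K})"
      using K by (intro UN_I[of K] image_eqI[of _ _ "p \<circ> inv q"]) auto
  qed
  have "card {p. p permutes {..<n} \<and> card {i \<in> {..<n}. p i \<noteq> q i} = k}
     \<le> card (\<Union>K\<in>Ks. (\<lambda>t. t \<circ> q) ` {t. t permutes K})"
    using fKs fp by (intro card_mono sub) auto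
  also have "\<dots> \<le> (\<Sum>K\<in>Ks. card ((\<lambda>t. t \<circ> q) ` {t. t permutes K}))"
    using fKs by (rule card_UN_le)
  also have "\<dots> \<le> (\<Sum>K\<in>Ks. fact k)"
  proof (rule sum_mono)
    fix K assume K: "K \<in> Ks"
    then have "card {t. t permutes K} = fact k"
      by (intro card_permutations) (auto simp: Ks_def intro: finite_subset)
    then show "card ((\<lambda>t. t \<circ> q) ` {t. t permutes K}) \<le> fact k"
      using card_image_le[OF fp[OF K]] by metis
  qed
  also have "\<dots> = (n choose k) * fact k"
    unfolding Ks_def by (simp add: n_subsets)
  also have "\<dots> \<le> n ^ k" by (rule binomial_fact_pow)
  finally show ?thesis .
qed

text \<open>With columns ranked by \<open>f\<close>, \<open>X (a, q i)\<close> is the leading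
  coordinate of its square, and the centre involves only column \<open>p i\<close>, of strictly
  smaller rank. Each of the d * card J squares contributes 1 / sqrt 16, whatever \<open>B\<close>
  is. Integer ranks let the order be reversed by negation.\<close>

lemma nn_integral_exp_residual_ranked:
  fixes f :: "nat \<Rightarrow> int"
  assumes p: "p permutes {..<n}" and q: "q permutes {..<n}"
    and J: "J \<subseteq> {..<n}" "\<And>i. i \<in> J \<Longrightarrow> f (p i) < f (q i)"
  shows "(\<integral>\<^sup>+X. ennreal (exp (- (15/2) * (\<Sum>a<d. \<Sum>i\<in>J. ((\<Sum>l<d. B a l * X (l, p i)) - X (a, q i))\<^sup>2)))
        \<partial>std_gauss ({..<d} \<times> {..<n})) \<le> ennreal ((1/4) ^ (d * card J))"
proof -
  let ?I = "{..<d} \<times> {..<n}"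
  define S where "S = {..<d} \<times> q ` J"
  define \<beta> where "\<beta> s i = (if snd i = p (inv q (snd s)) then B (fst s) (fst i) else 0)" for s i :: "nat \<times> nat"
  have fJ: "finite J" using J(1) finite_subset by blast
  have iq: "inv q (q i) = i" for i using permutes_inverses(2)[OF q] .
  have inj: "inj_on q J" using permutes_inj[OF q] by (rule inj_on_subset) simp
  have cS: "card S = d * card J" unfolding S_def by (simp add: card_image[OF inj] card_cartesian_product)
  have SI: "S \<subseteq> ?I" unfolding S_def using J(1) permutes_in_image[OF q] by auto
  have \<beta>: "(\<Sum>i\<in>?I. \<beta> (a, q i') i * X i) = (\<Sum>l<d. B a l * X (l, p i'))" if "i' \<in> J" for a i' and X :: "nat \<times> nat \<Rightarrow> real"
  proof -
    have pn: "p i' < n" using J(1) that permutes_in_image[OF p] by blast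
    have "(\<Sum>i\<in>?I. \<beta> (a, q i') i * X i) = (\<Sum>l<d. \<Sum>j<n. \<beta> (a, q i') (l, j) * X (l, j))"
      by (simp add: sum.cartesian_product)
    also have "\<dots> = (\<Sum>l<d. \<Sum>j<n. if j = p i' then B a l * X (l, j) else 0)"
      by (intro sum.cong refl) (simp add: \<beta>_def iq)
    finally show ?thesis using pn by (simp add: sum.delta)
  qed
  have S: "(\<Sum>a<d. \<Sum>i\<in>J. ((\<Sum>l<d. B a l * X (l, p i)) - X (a, q i))\<^sup>2)
     = (\<Sum>s\<in>S. (X s - (\<Sum>i\<in>?I. \<beta> s i * X i))\<^sup>2)" for X
  proof -
    have "(\<Sum>s\<in>S. (X s - (\<Sum>i\<in>?I. \<beta> s i * X i))\<^sup>2)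
      = (\<Sum>a<d. \<Sum>j\<in>q ` J. (X (a, j) - (\<Sum>i\<in>?I. \<beta> (a, j) i * X i))\<^sup>2)"
      unfolding S_def by (simp add: sum.cartesian_product)
    also have "\<dots> = (\<Sum>a<d. \<Sum>i\<in>J. (X (a, q i) - (\<Sum>l<d. B a l * X (l, p i)))\<^sup>2)"
      by (simp add: sum.reindex[OF inj] \<beta>)
    finally show ?thesis by (simp add: power2_commute)
  qed
  have "(\<integral>\<^sup>+X. ennreal (exp (- (15/2) * (\<Sum>s\<in>S. (X s - (\<Sum>i\<in>?I. \<beta> s i * X i))\<^sup>2))) \<partial>std_gauss ?I)
     \<le> ennreal ((1 / sqrt (1 + 2 * (15/2))) ^ card S)"
  proof (rule nn_integral_std_gauss_exp_triangular[OF _ SI, where r = "\<lambda>i. f (snd i)"])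
    fix s i assume "s \<in> S" "\<beta> s i \<noteq> 0"
    then show "f (snd i) < f (snd s)" using J(2) by (auto simp: S_def \<beta>_def iq split: if_splits)
  qed auto
  moreover have "sqrt (1 + 2 * (15/2)) = (4 :: real)" by (rule real_sqrt_unique) auto
  ultimately show ?thesis unfolding S cS by simp
qed

text \<open>Half of the moved indices satisfy p i < q i or half satisfy q i < p i, so some linear order
  on the columns leaves at least half of the residuals in triangular form.\<close>

lemma nn_integral_exp_residual:
  fixes p q :: "nat \<Rightarrow> nat"
  assumes p: "p permutes {..<n}" and q: "q permutes {..<n}"
    and K: "K = {i \<in> {..<n}. p i \<noteq> q i}"
  shows "(\<integral>\<^sup>+X. ennreal (exp (- (15/2) * (\<Sum>a<d. \<Sum>i\<in>K. ((\<Sum>l<d. B a l * X (l, p i)) - X (a, q i))\<^sup>2)))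
        \<partial>std_gauss ({..<d} \<times> {..<n})) \<le> ennreal ((1/2) ^ (d * card K))"
proof -
  have fK: "finite K" unfolding K by (rule finite_subset[of _ "{..<n}"]) auto
  have main: ?thesis if J: "J \<subseteq> K" "card K \<le> 2 * card J" "\<And>i. i \<in> J \<Longrightarrow> f (p i) < f (q i)" for J and f :: "nat \<Rightarrow> int"
  proof -
    have fJ: "finite J" using fK J(1) by (rule rev_finite_subset)
    have "(\<integral>\<^sup>+X. ennreal (exp (- (15/2) * (\<Sum>a<d. \<Sum>i\<in>K. ((\<Sum>l<d. B a l * X (l, p i)) - X (a, q i))\<^sup>2)))
        \<partial>std_gauss ({..<d} \<times> {..<n}))
      \<le> (\<integral>\<^sup>+X. ennreal (exp (- (15/2) * (\<Sum>a<d. \<Sum>i\<in>J. ((\<Sum>l<d. B a l * X (l, p i)) - X (a, q i))\<^sup>2)))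
        \<partial>std_gauss ({..<d} \<times> {..<n}))"
      using fK J(1) by (intro nn_integral_mono ennreal_leI) (auto intro!: sum_mono sum_mono2)
    also have "\<dots> \<le> ennreal ((1/4) ^ (d * card J))"
      using J(1) K by (intro nn_integral_exp_residual_ranked[OF p q _ J(3)]) auto
    also have "((1/4) ^ (d * card J) :: real) = (1/2) ^ (2 * (d * card J))"
      unfolding power_mult by (simp add: power2_eq_square)
    also have "ennreal \<dots> \<le> ennreal ((1/2) ^ (d * card K))"
      using J(2) mult_le_mono2[OF J(2), of d] by (intro ennreal_leI power_decreasing) auto
    finally show ?thesis .
  qed
  define J1 where "J1 = {i \<in> K. p i < q i}"
  define J2 where "J2 = {i \<in> K. q i < p i}"
  have "card K = card J1 + card J2"
    unfolding J1_def J2_def using fK by (subst card_Un_disjoint[symmetric]) (auto simp: K intro!: arg_cong[where f = card])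
  then consider "card K \<le> 2 * card J1" | "card K \<le> 2 * card J2" by linarith
  then show ?thesis
  proof cases
    case 1
    then show ?thesis by (intro main[of J1 int]) (auto simp: J1_def)
  next
    case 2
    then show ?thesis by (intro main[of J2 "\<lambda>i. - int i"]) (auto simp: J2_def)
  qed
qed

section \<open>Orthogonal matrices and the likelihood gain\<close>

lemma isometry_of_orthonormal_columns:
  fixes M :: "nat \<Rightarrow> nat \<Rightarrow> real"
  assumes "\<And>i j. i < d \<Longrightarrow> j < d \<Longrightarrow> (\<Sum>k<d. M k i * M k j) = (if i = j then 1 else 0)"
  shows "(\<Sum>k<d. (\<Sum>i<d. M k i * x i)\<^sup>2) = (\<Sum>i<d. (x i)\<^sup>2)"
proof -
  have "(\<Sum>k<d. (\<Sum>i<d. M k i * x i)\<^sup>2) = (\<Sum>k<d. \<Sum>i<d. \<Sum>j<d. x i * x j * (M k i * M k j))"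
    by (simp add: power2_eq_square sum_product mult_ac)
  also have "\<dots> = (\<Sum>i<d. \<Sum>k<d. \<Sum>j<d. x i * x j * (M k i * M k j))" by (rule sum.swap)
  also have "\<dots> = (\<Sum>i<d. \<Sum>j<d. x i * x j * (\<Sum>k<d. M k i * M k j))"
    by (rule sum.cong[OF refl], subst sum.swap) (simp add: sum_distrib_left)
  also have "\<dots> = (\<Sum>i<d. \<Sum>j<d. if j = i then x i * x j else 0)"
    by (intro sum.cong refl) (auto simp: assms)
  also have "\<dots> = (\<Sum>i<d. (x i)\<^sup>2)" by (simp add: power2_eq_square)
  finally show ?thesis .
qed

lemma orth_mat_columns:
  "orth_mat d Q \<Longrightarrow> i < d \<Longrightarrow> j < d \<Longrightarrow> (\<Sum>k<d. Q k i * Q k j) = (if i = j then 1 else 0)"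
  by (simp add: orth_mat_def)

lemma orth_mat_norm: "orth_mat d Q \<Longrightarrow> (\<Sum>k<d. (\<Sum>i<d. Q k i * x i)\<^sup>2) = (\<Sum>i<d. (x i)\<^sup>2)"
  by (rule isometry_of_orthonormal_columns) (rule orth_mat_columns)

lemma orth_mat_sum_squares:
  assumes "orth_mat d Q"
  shows "(\<Sum>k<d. \<Sum>i<d. (Q k i)\<^sup>2) = real d"
proof -
  have "(\<Sum>k<d. \<Sum>i<d. (Q k i)\<^sup>2) = (\<Sum>i<d. \<Sum>k<d. Q k i * Q k i)"
    by (subst sum.swap) (simp add: power2_eq_square)
  also have "\<dots> = (\<Sum>i<d. 1)" using orth_mat_columns[OF assms] by (intro sum.cong) auto
  finally show ?thesis by simp
qed

text \<open>Q Q^T is the identity, because the squared Frobenius norm of I - Q Q^T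
  equals d - 2 tr(Q Q^T) + tr(Q Q^T Q Q^T) = d - 2 d + d.\<close>

lemma orth_mat_rows:
  assumes Q: "orth_mat d Q" and ij: "i < d" "j < d"
  shows "(\<Sum>k<d. Q i k * Q j k) = (if i = j then 1 else 0)"
proof -
  define P where "P i j = (\<Sum>k<d. Q i k * Q j k)" for i j
  have "(\<Sum>i<d. \<Sum>j<d. (P i j)\<^sup>2) = (\<Sum>i<d. \<Sum>j<d. (\<Sum>k<d. Q j k * Q i k)\<^sup>2)"
    by (simp add: P_def mult.commute)
  also have "\<dots> = (\<Sum>i<d. \<Sum>k<d. (Q i k)\<^sup>2)" by (simp only: orth_mat_norm[OF Q])
  finally have PP: "(\<Sum>i<d. \<Sum>j<d. (P i j)\<^sup>2) = d" using orth_mat_sum_squares[OF Q] by simp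
  have tr: "(\<Sum>i<d. P i i) = d"
    using orth_mat_sum_squares[OF Q] by (simp add: P_def power2_eq_square)
  define R where "R i j = (P i j - (if j = i then 1 else 0))\<^sup>2" for i j
  have R0: "R i j \<ge> 0" for i j by (simp add: R_def)
  have "(\<Sum>i<d. \<Sum>j<d. R i j) = (\<Sum>i<d. \<Sum>j<d. (P i j)\<^sup>2 + (if j = i then 1 - 2 * P i j else 0))"
    by (intro sum.cong refl) (auto simp: R_def power2_eq_square algebra_simps)
  also have "\<dots> = d + (\<Sum>i<d. 1 - 2 * P i i)"
    by (simp add: sum.distrib PP)
  also have "\<dots> = 0" by (simp add: sum_subtractf sum_distrib_left[symmetric] tr)
  finally have "R i j = 0"
    using ij R0 by (simp add: sum_nonneg_eq_0_iff sum_nonneg)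
  then show ?thesis by (auto simp: R_def P_def split: if_splits)
qed

text \<open>Apply the isometry Q to the residual on the left and use Q Q^T = 1. This expresses the
  objective through Q x, and also moves the true rotation from one column of a residual to the
  other.\<close>

lemma orth_mat_residual:
  assumes Q: "orth_mat d Q"
  shows "(\<Sum>k<d. (x k - (\<Sum>l<d. Q l k * y l))\<^sup>2) = (\<Sum>l<d. ((\<Sum>k<d. Q l k * x k) - y l)\<^sup>2)"
proof -
  have "(\<Sum>k<d. Q l k * (x k - (\<Sum>j<d. Q j k * y j))) = (\<Sum>k<d. Q l k * x k) - y l" if "l < d" for l
  proof -
    have "(\<Sum>k<d. Q l k * (\<Sum>j<d. Q j k * y j)) = (\<Sum>k<d. \<Sum>j<d. y j * (Q l k * Q j k))"
      by (simp add: sum_distrib_left mult_ac)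
    also have "\<dots> = (\<Sum>j<d. y j * (\<Sum>k<d. Q l k * Q j k))"
      by (subst sum.swap) (simp add: sum_distrib_left)
    also have "\<dots> = (\<Sum>j<d. if j = l then y j else 0)"
      using that by (intro sum.cong refl) (auto simp: orth_mat_rows[OF Q])
    also have "\<dots> = y l" using that by simp
    finally show ?thesis by (simp add: right_diff_distrib sum_subtractf)
  qed
  then show ?thesis
    using orth_mat_norm[OF Q, of "\<lambda>k. x k - (\<Sum>l<d. Q l k * y l)"] by simp
qed

text \<open>From |Q - Q'|^2 \<le> 2 |Q|^2 + 2 |Q'|^2. Hence ell2 / (2 d) \<le> 2, and the rotation
  bound is trivial once its right-hand side reaches 2.\<close>

lemma ell2_le:
  assumes "orth_mat d Q" "orth_mat d Q'"
  shows "ell2 d Q Q' \<le> 4 * real d"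
proof -
  have "ell2 d Q Q' \<le> (\<Sum>i<d. \<Sum>j<d. 2 * (Q i j)\<^sup>2 + 2 * (Q' i j)\<^sup>2)"
    unfolding ell2_def
  proof (intro sum_mono)
    fix i j
    have "0 \<le> (Q i j + Q' i j)\<^sup>2" by simp
    then show "(Q i j - Q' i j)\<^sup>2 \<le> 2 * (Q i j)\<^sup>2 + 2 * (Q' i j)\<^sup>2"
      by (simp add: power2_eq_square algebra_simps)
  qed
  also have "\<dots> = 4 * real d"
    using assms by (simp add: sum.distrib sum_distrib_left[symmetric] orth_mat_sum_squares)
  finally show ?thesis .
qed

lemma gain_split:
  assumes "finite A" "F \<subseteq> A"
  shows "gain d s A V Z = gain d s F V Z + gain d s (A - F) V Z"
  unfolding gain_def using assms
  by (subst sum.distrib[symmetric]) (intro sum.cong refl, simp add: sum.subset_diff add.commute)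

lemma gain_cong:
  "(\<And>a i. a < d \<Longrightarrow> i \<in> A \<Longrightarrow> V a i = V' a i) \<Longrightarrow> gain d s A V Z = gain d s A V' Z"
  unfolding gain_def by (intro sum.cong refl) auto

text \<open>The estimator is compared with the truth only; the common term y drops out because
  orthogonal matrices preserve its norm.\<close>

lemma is_ml_pair_gain_nonneg:
  assumes ml: "is_ml_pair d n X (obs d Qs ps s X Z) p Q"
    and Qs: "orth_mat d Qs" and ps: "ps permutes {..<n}" and n: "n \<ge> 1"
  shows "0 \<le> gain d s {..<n} (\<lambda>a i. (\<Sum>l<d. Q a l * X (l, p i)) - (\<Sum>l<d. Qs a l * X (l, ps i))) Z"
proof -
  have Q: "orth_mat d Q" using ml by (simp add: is_ml_pair_def)
  let ?V = "\<lambda>a i. (\<Sum>l<d. Q a l * X (l, p i)) - (\<Sum>l<d. Qs a l * X (l, ps i))"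
  have obj: "real n * ml_obj d n X (obs d Qs ps s X Z) p' Q'
     = (\<Sum>i<n. \<Sum>a<d. ((\<Sum>l<d. Q' a l * X (l, p' i)) - obs d Qs ps s X Z i a)\<^sup>2)"
    if "orth_mat d Q'" for p' Q'
    using n that by (simp add: ml_obj_def orth_mat_residual)
  have "ml_obj d n X (obs d Qs ps s X Z) p Q \<le> ml_obj d n X (obs d Qs ps s X Z) ps Qs"
    using ml Qs ps by (auto simp: is_ml_pair_def)
  then have "real n * ml_obj d n X (obs d Qs ps s X Z) p Q \<le> real n * ml_obj d n X (obs d Qs ps s X Z) ps Qs"
    by (rule mult_left_mono) simp
  then have "0 \<le> (\<Sum>i<n. \<Sum>a<d. (s * Z (a, i))\<^sup>2) - (\<Sum>i<n. \<Sum>a<d. (?V a i - s * Z (a, i))\<^sup>2)"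
    unfolding obj[OF Q] obj[OF Qs] by (simp add: obs_def diff_diff_eq)
  also have "\<dots> = (\<Sum>i<n. \<Sum>a<d. 2 * s * ?V a i * Z (a, i) - (?V a i)\<^sup>2)"
    unfolding sum_subtractf[symmetric] by (intro sum.cong refl) (simp add: power2_eq_square algebra_simps)
  finally show ?thesis unfolding gain_def by (subst sum.swap)
qed

text \<open>From (\<delta> m)^2 \<le> 2 q^2 + 2 (q - \<delta> m)^2. With \<delta> = \<epsilon> /
  sqrt d, an orthogonal matrix or a unit vector gets mean square at most 2 / \<epsilon>^2 + 2, the
  radius of the grids below.\<close>

lemma rounded_sum_squares_le:
  assumes "\<delta> > 0" "\<And>l. l \<in> L \<Longrightarrow> \<bar>q l - \<delta> * real_of_int (m l)\<bar> \<le> \<delta>"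
  shows "(\<Sum>l\<in>L. (real_of_int (m l))\<^sup>2) \<le> 2 / \<delta>\<^sup>2 * (\<Sum>l\<in>L. (q l)\<^sup>2) + 2 * real (card L)"
proof -
  have "(real_of_int (m l))\<^sup>2 \<le> 2 / \<delta>\<^sup>2 * (q l)\<^sup>2 + 2" if "l \<in> L" for l
  proof -
    let ?y = "q l - \<delta> * real_of_int (m l)"
    have y: "?y\<^sup>2 \<le> \<delta>\<^sup>2" using assms(2)[OF that] assms(1) by (simp add: abs_le_square_iff[symmetric])
    have "0 \<le> (q l + ?y)\<^sup>2" by simp
    then have "(\<delta> * real_of_int (m l))\<^sup>2 \<le> 2 * (q l)\<^sup>2 + 2 * ?y\<^sup>2"
      by (simp add: power2_eq_square algebra_simps)
    then have "\<delta>\<^sup>2 * (real_of_int (m l))\<^sup>2 \<le> 2 * (q l)\<^sup>2 + 2 * \<delta>\<^sup>2"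
      using y unfolding power_mult_distrib by linarith
    then show ?thesis using assms(1) by (simp add: field_simps)
  qed
  then have "(\<Sum>l\<in>L. (real_of_int (m l))\<^sup>2) \<le> (\<Sum>l\<in>L. 2 / \<delta>\<^sup>2 * (q l)\<^sup>2 + 2)"
    by (rule sum_mono)
  then show ?thesis by (simp add: sum.distrib sum_distrib_left)
qed

section \<open>Rounding to a net and stability of the gain\<close>

lemma orth_difference_column_le:
  assumes "orth_mat d Q" "orth_mat d Q'" "(\<Sum>l<d. (x l)\<^sup>2) \<le> c" "(\<Sum>l<d. (y l)\<^sup>2) \<le> c"
  shows "(\<Sum>a<d. ((\<Sum>l<d. Q a l * x l) - (\<Sum>l<d. Q' a l * y l))\<^sup>2) \<le> 4 * c"
proof -
  have "(\<Sum>a<d. ((\<Sum>l<d. Q a l * x l) - (\<Sum>l<d. Q' a l * y l))\<^sup>2)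
     \<le> (\<Sum>a<d. 2 * (\<Sum>l<d. Q a l * x l)\<^sup>2 + 2 * (\<Sum>l<d. Q' a l * y l)\<^sup>2)"
  proof (rule sum_mono)
    fix a
    have "0 \<le> ((\<Sum>l<d. Q a l * x l) + (\<Sum>l<d. Q' a l * y l))\<^sup>2" by simp
    then show "((\<Sum>l<d. Q a l * x l) - (\<Sum>l<d. Q' a l * y l))\<^sup>2
        \<le> 2 * (\<Sum>l<d. Q a l * x l)\<^sup>2 + 2 * (\<Sum>l<d. Q' a l * y l)\<^sup>2"
      by (simp add: power2_eq_square algebra_simps)
  qed
  also have "\<dots> = 2 * (\<Sum>l<d. (x l)\<^sup>2) + 2 * (\<Sum>l<d. (y l)\<^sup>2)"
    by (simp add: sum.distrib sum_distrib_left[symmetric] orth_mat_norm[OF assms(1)] orth_mat_norm[OF assms(2)])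
  finally show ?thesis using assms by linarith
qed

lemma double_sum_columns_le:
  fixes f :: "nat \<Rightarrow> 'j \<Rightarrow> real"
  assumes "\<And>i. i \<in> K \<Longrightarrow> (\<Sum>a<d. f a i) \<le> c"
  shows "(\<Sum>a<d. \<Sum>i\<in>K. f a i) \<le> c * real (card K)"
proof -
  have "(\<Sum>a<d. \<Sum>i\<in>K. f a i) = (\<Sum>i\<in>K. \<Sum>a<d. f a i)" by (rule sum.swap)
  also have "\<dots> \<le> (\<Sum>i\<in>K. c)" using assms by (rule sum_mono)
  finally show ?thesis by (simp add: mult.commute)
qed

text \<open>The d rows, each with rounding error \<delta>^2 S, add up to \<epsilon>^2 S: relative
  accuracy \<epsilon> at the typical size 1 / sqrt d of the entries of an orthogonal matrix.\<close>

definition mesh :: "real \<Rightarrow> nat \<Rightarrow> real" where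
  "mesh \<epsilon> d = \<epsilon> / sqrt (real d)"

lemma mesh_pos: "\<epsilon> > 0 \<Longrightarrow> d \<ge> 1 \<Longrightarrow> mesh \<epsilon> d > 0"
  and mesh_square: "(mesh \<epsilon> d)\<^sup>2 = \<epsilon>\<^sup>2 / real d"
  by (simp_all add: mesh_def power_divide)

text \<open>Rows are rounded one by one. The choice depends on the columns \<open>x\<close> and need
  not give an orthogonal matrix, but it lies in one fixed grid, as a union bound requires. The error
  is controlled by the total squared norm of the columns in \<open>K\<close>; no operator norm
  enters.\<close>

lemma exists_rounded_orth_mat:
  fixes x :: "nat \<Rightarrow> 'j \<Rightarrow> real"
  assumes Q: "orth_mat d Q" and d: "d \<ge> 1" and eps: "\<epsilon> > 0"
    and x: "\<And>i. i \<in> K \<Longrightarrow> (\<Sum>l<d. (x l i)\<^sup>2) \<le> c"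
  obtains m where "m \<in> int_ball ({..<d} \<times> {..<d}) (2 / \<epsilon>\<^sup>2 + 2)"
    "(\<Sum>a<d. \<Sum>i\<in>K. ((\<Sum>l<d. Q a l * x l i) - (\<Sum>l<d. mesh \<epsilon> d * real_of_int (m (a, l)) * x l i))\<^sup>2)
       \<le> \<epsilon>\<^sup>2 * c * real (card K)"
proof -
  define \<delta> where "\<delta> = mesh \<epsilon> d"
  have \<delta>: "\<delta> > 0" unfolding \<delta>_def using mesh_pos eps d by simp
  define S where "S = (\<Sum>l<d. \<Sum>i\<in>K. (x l i)\<^sup>2)"
  have S: "S \<le> c * real (card K)" unfolding S_def by (rule double_sum_columns_le) (rule x)
  have "\<exists>m :: nat \<Rightarrow> int. (\<forall>l\<in>{..<d}. \<bar>Q a l - \<delta> * real_of_int (m l)\<bar> \<le> \<delta>) \<and>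
      (\<Sum>i\<in>K. (\<Sum>l<d. (Q a l - \<delta> * real_of_int (m l)) * x l i)\<^sup>2) \<le> \<delta>\<^sup>2 * S" for a
    unfolding S_def by (rule exists_rounding[OF _ \<delta>, where L = "{..<d}" and q = "Q a" and K = K and x = x]) auto
  note * = this
  have "\<forall>a. \<exists>m :: nat \<Rightarrow> int. (\<forall>l\<in>{..<d}. \<bar>Q a l - \<delta> * real_of_int (m l)\<bar> \<le> \<delta>) \<and>
      (\<Sum>i\<in>K. (\<Sum>l<d. (Q a l - \<delta> * real_of_int (m l)) * x l i)\<^sup>2) \<le> \<delta>\<^sup>2 * S"
    using * by (rule allI)
  from choice[OF this] obtain \<mu> :: "nat \<Rightarrow> nat \<Rightarrow> int"
    where \<mu>1: "\<And>a l. l < d \<Longrightarrow> \<bar>Q a l - \<delta> * real_of_int (\<mu> a l)\<bar> \<le> \<delta>"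
      and \<mu>2: "\<And>a. (\<Sum>i\<in>K. (\<Sum>l<d. (Q a l - \<delta> * real_of_int (\<mu> a l)) * x l i)\<^sup>2) \<le> \<delta>\<^sup>2 * S"
    by auto
  define m where "m = restrict (\<lambda>(a, l). \<mu> a l) ({..<d} \<times> {..<d})"
  have m: "m (a, l) = \<mu> a l" if "a < d" "l < d" for a l using that by (simp add: m_def)
  have ball: "m \<in> int_ball ({..<d} \<times> {..<d}) (2 / \<epsilon>\<^sup>2 + 2)"
  proof -
    have "(\<Sum>p\<in>{..<d} \<times> {..<d}. (real_of_int (m p))\<^sup>2)
       \<le> 2 / \<delta>\<^sup>2 * (\<Sum>p\<in>{..<d} \<times> {..<d}. (Q (fst p) (snd p))\<^sup>2) + 2 * real (card ({..<d} \<times> {..<d}))"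
      by (rule rounded_sum_squares_le[OF \<delta>]) (auto simp: m \<mu>1)
    also have "(\<Sum>p\<in>{..<d} \<times> {..<d}. (Q (fst p) (snd p))\<^sup>2) = real d"
      using orth_mat_sum_squares[OF Q] by (simp add: sum.cartesian_product split_beta)
    also have "2 / \<delta>\<^sup>2 * real d + 2 * real (card ({..<d} \<times> {..<d})) = (2 / \<epsilon>\<^sup>2 + 2) * real (card ({..<d} \<times> {..<d}))"
      unfolding \<delta>_def mesh_square using d eps by (simp add: card_cartesian_product field_simps)
    finally show ?thesis by (auto simp: int_ball_def m_def)
  qed
  have "(\<Sum>a<d. \<Sum>i\<in>K. ((\<Sum>l<d. Q a l * x l i) - (\<Sum>l<d. \<delta> * real_of_int (m (a, l)) * x l i))\<^sup>2)
     = (\<Sum>a<d. \<Sum>i\<in>K. (\<Sum>l<d. (Q a l - \<delta> * real_of_int (\<mu> a l)) * x l i)\<^sup>2)"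
    by (intro sum.cong refl) (simp add: m sum_subtractf left_diff_distrib)
  also have "\<dots> \<le> (\<Sum>a<d. \<delta>\<^sup>2 * S)" by (intro sum_mono \<mu>2)
  also have "\<dots> = \<epsilon>\<^sup>2 * S" unfolding \<delta>_def mesh_square using d by simp
  also have "\<dots> \<le> \<epsilon>\<^sup>2 * c * real (card K)" using S mult_left_mono[OF S, of "\<epsilon>\<^sup>2"] by (simp add: mult.assoc)
  finally show ?thesis using that ball unfolding \<delta>_def by blast
qed

text \<open>Two weighted AM-GM inequalities, one for the noise cross term and one for v^2 - w^2,
  each paying (v - w)^2 / \<epsilon> in exchange for \<epsilon> z^2 or \<epsilon> v^2. The total (2
  / \<epsilon> + 1) \<epsilon>^2 c + \<epsilon> c + 4 \<epsilon> c is at most 8 \<epsilon>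
  c.\<close>

lemma gain_perturb_le:
  assumes s: "s\<^sup>2 \<le> 1" and e: "0 < \<epsilon>" "\<epsilon> \<le> 1"
    and E: "(\<Sum>a<d. \<Sum>i\<in>K. (V a i - W a i)\<^sup>2) \<le> \<epsilon>\<^sup>2 * c"
    and Z: "(\<Sum>a<d. \<Sum>i\<in>K. (Z (a, i))\<^sup>2) \<le> c"
    and V: "(\<Sum>a<d. \<Sum>i\<in>K. (V a i)\<^sup>2) \<le> 4 * c"
  shows "gain d s K V Z \<le> gain d s K W Z + 8 * \<epsilon> * c"
proof -
  have "gain d s K V Z \<le> (\<Sum>a<d. \<Sum>i\<in>K. (2 * s * W a i * Z (a, i) - (W a i)\<^sup>2)
      + ((2 / \<epsilon> + 1) * (V a i - W a i)\<^sup>2 + \<epsilon> * (Z (a, i))\<^sup>2 + \<epsilon> * (V a i)\<^sup>2))"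
    unfolding gain_def
  proof (intro sum_mono)
    fix a i
    define v w z where "v = V a i" and "w = W a i" and "z = Z (a, i)"
    have "0 \<le> (s * (v - w) - \<epsilon> * z)\<^sup>2 / \<epsilon>" using e by simp
    also have "\<dots> = s\<^sup>2 * (v - w)\<^sup>2 / \<epsilon> + \<epsilon> * z\<^sup>2 - 2 * s * (v - w) * z"
      using e by (simp add: power2_eq_square field_simps)
    finally have 1: "2 * s * (v - w) * z \<le> s\<^sup>2 * (v - w)\<^sup>2 / \<epsilon> + \<epsilon> * z\<^sup>2" by simp
    have "s\<^sup>2 * (v - w)\<^sup>2 / \<epsilon> \<le> 1 * (v - w)\<^sup>2 / \<epsilon>"
      using e s by (intro divide_right_mono mult_right_mono) auto
    then have 2: "2 * s * (v - w) * z \<le> (v - w)\<^sup>2 / \<epsilon> + \<epsilon> * z\<^sup>2" using 1 by simp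
    have "0 \<le> ((v - w) + \<epsilon> * v)\<^sup>2 / \<epsilon>" using e by simp
    also have "\<dots> = (v - w)\<^sup>2 / \<epsilon> + \<epsilon> * v\<^sup>2 + 2 * v * (v - w)"
      using e by (simp add: power2_eq_square field_simps)
    finally have 3: "- 2 * v * (v - w) \<le> (v - w)\<^sup>2 / \<epsilon> + \<epsilon> * v\<^sup>2" by simp
    have "2 * s * v * z - v\<^sup>2 = (2 * s * w * z - w\<^sup>2) + (2 * s * (v - w) * z + - 2 * v * (v - w) + (v - w)\<^sup>2)"
      by (simp add: power2_eq_square algebra_simps)
    also have "\<dots> \<le> (2 * s * w * z - w\<^sup>2) + ((2 / \<epsilon> + 1) * (v - w)\<^sup>2 + \<epsilon> * z\<^sup>2 + \<epsilon> * v\<^sup>2)"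
      using 2 3 by (simp add: distrib_right)
    finally show "2 * s * V a i * Z (a, i) - (V a i)\<^sup>2 \<le> (2 * s * W a i * Z (a, i) - (W a i)\<^sup>2)
      + ((2 / \<epsilon> + 1) * (V a i - W a i)\<^sup>2 + \<epsilon> * (Z (a, i))\<^sup>2 + \<epsilon> * (V a i)\<^sup>2)"
      by (simp add: v_def w_def z_def)
  qed
  also have "\<dots> = gain d s K W Z + ((2 / \<epsilon> + 1) * (\<Sum>a<d. \<Sum>i\<in>K. (V a i - W a i)\<^sup>2)
      + \<epsilon> * (\<Sum>a<d. \<Sum>i\<in>K. (Z (a, i))\<^sup>2) + \<epsilon> * (\<Sum>a<d. \<Sum>i\<in>K. (V a i)\<^sup>2))"
    unfolding gain_def by (simp only: sum.distrib sum_distrib_left)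
  also have "\<dots> \<le> gain d s K W Z + ((2 / \<epsilon> + 1) * (\<epsilon>\<^sup>2 * c) + \<epsilon> * c + \<epsilon> * (4 * c))"
    using e by (intro add_left_mono add_mono mult_left_mono E Z V) auto
  also have "(2 / \<epsilon> + 1) * (\<epsilon>\<^sup>2 * c) + \<epsilon> * c + \<epsilon> * (4 * c) = 7 * \<epsilon> * c + \<epsilon> * \<epsilon> * c"
    using e by (simp add: field_simps power2_eq_square)
  also have "\<dots> \<le> 7 * \<epsilon> * c + 1 * \<epsilon> * c"
  proof -
    have "0 \<le> c" using Z by (rule order.trans[rotated]) (intro sum_nonneg, auto)
    then show ?thesis using e by (intro add_left_mono mult_right_mono) auto
  qed
  finally show ?thesis by simp
qed

text \<open>Continuity of the gain in the matrix. Rational matrices make the suprema countable, and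
  hence the bad events measurable.\<close>

lemma gain_rational_dense:
  fixes r :: "nat \<Rightarrow> 'j \<Rightarrow> real"
  assumes "\<And>D. D \<in> ({..<d} \<times> {..<d}) \<rightarrow>\<^sub>E \<rat> \<Longrightarrow> gain d s F (\<lambda>a i. \<Sum>l<d. D (a, l) * r l i) Z \<le> t"
  shows "gain d s F (\<lambda>a i. \<Sum>l<d. D a l * r l i) Z \<le> t"
proof -
  define D' where "D' k = restrict (\<lambda>(a, l). of_int \<lfloor>D a l * real (Suc k)\<rfloor> / real (Suc k)) ({..<d} \<times> {..<d})" for k
  have in_C: "D' k \<in> ({..<d} \<times> {..<d}) \<rightarrow>\<^sub>E \<rat>" for k
    unfolding D'_def by (intro restrict_PiE_iff[THEN iffD2]) auto
  have lim: "(\<lambda>k. D' k (a, l)) \<longlonglongrightarrow> D a l" if "a < d" "l < d" for a l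
  proof (rule real_tendsto_sandwich)
    show "\<forall>\<^sub>F k in sequentially. D a l - 1 / real (Suc k) \<le> D' k (a, l)"
    proof (intro always_eventually allI)
      fix k
      have "D a l * real (Suc k) - 1 \<le> of_int \<lfloor>D a l * real (Suc k)\<rfloor>" by linarith
      then have "(D a l * real (Suc k) - 1) / real (Suc k) \<le> of_int \<lfloor>D a l * real (Suc k)\<rfloor> / real (Suc k)"
        by (rule divide_right_mono) simp
      then show "D a l - 1 / real (Suc k) \<le> D' k (a, l)"
        using that by (simp add: D'_def diff_divide_distrib)
    qed
    show "\<forall>\<^sub>F k in sequentially. D' k (a, l) \<le> D a l"
      using that by (intro always_eventually allI) (simp add: D'_def divide_le_eq del: of_nat_Suc)
    show "(\<lambda>k. D a l - 1 / real (Suc k)) \<longlonglongrightarrow> D a l"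
      using tendsto_diff[OF tendsto_const LIMSEQ_inverse_real_of_nat, of "D a l"]
      by (simp add: inverse_eq_divide)
  qed simp
  have "(\<lambda>k. gain d s F (\<lambda>a i. \<Sum>l<d. D' k (a, l) * r l i) Z) \<longlonglongrightarrow> gain d s F (\<lambda>a i. \<Sum>l<d. D a l * r l i) Z"
    unfolding gain_def by (intro tendsto_intros) (auto intro: lim)
  then show ?thesis
    by (rule LIMSEQ_le_const2) (use assms[OF in_C] in auto)
qed

section \<open>Deterministic consequences of the good event\<close>

definition moved :: "nat \<Rightarrow> (nat \<Rightarrow> nat) \<Rightarrow> (nat \<Rightarrow> nat) \<Rightarrow> nat set" where
  "moved n p q = {i \<in> {..<n}. p i \<noteq> q i}"

lemma finite_moved [simp]: "finite (moved n p q)"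
  and moved_subset: "moved n p q \<subseteq> {..<n}"
  and card_moved_le: "card (moved n p q) \<le> n"
proof -
  show s: "moved n p q \<subseteq> {..<n}" by (auto simp: moved_def)
  then show "finite (moved n p q)" by (rule finite_subset) simp
  show "card (moved n p q) \<le> n" using card_mono[OF _ s] by simp
qed

lemma overlap_eq:
  assumes "n \<ge> 1"
  shows "overlap n q p = 1 - real (card (moved n p q)) / real n"
proof -
  have "{i \<in> {..<n}. q i = p i} = {..<n} - moved n p q" by (auto simp: moved_def)
  then have "card {i \<in> {..<n}. q i = p i} = n - card (moved n p q)"
    by (simp add: card_Diff_subset moved_subset)
  then show ?thesis using assms card_moved_le[of n p q]
    by (simp add: overlap_def of_nat_diff diff_divide_distrib)
qed

text \<open>\<open>Q\<close> is the true rotation; \<open>M\<close> is either the estimated one or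
  its grid approximation, so it need not be orthogonal.\<close>

definition resid :: "nat \<Rightarrow> (nat \<Rightarrow> nat \<Rightarrow> real) \<Rightarrow> (nat \<Rightarrow> nat \<Rightarrow> real) \<Rightarrow> (nat \<times> nat \<Rightarrow> real) \<Rightarrow>
    (nat \<Rightarrow> nat) \<Rightarrow> (nat \<Rightarrow> nat) \<Rightarrow> nat \<Rightarrow> nat \<Rightarrow> real" where
  "resid d M Q X p q a i = (\<Sum>l<d. M a l * X (l, p i)) - (\<Sum>l<d. Q a l * X (l, q i))"

definition grid_mat :: "real \<Rightarrow> nat \<Rightarrow> (nat \<times> nat \<Rightarrow> int) \<Rightarrow> nat \<Rightarrow> nat \<Rightarrow> real" where
  "grid_mat \<epsilon> d m a l = mesh \<epsilon> d * real_of_int (m (a, l))"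

lemma resid_unmoved:
  assumes "i \<in> {..<n} - moved n p q"
  shows "resid d M Q X p q a i = (\<Sum>l<d. (M a l - Q a l) * X (l, q i))"
proof -
  have "p i = q i" using assms by (auto simp: moved_def)
  then show ?thesis by (simp add: resid_def left_diff_distrib sum_subtractf)
qed

text \<open>Only the moved columns are rounded; on the others Q - Qs is replaced by a free matrix
  \<open>D\<close>, independent of the grid point \<open>m\<close>. Rounding loses 8 * 20 / 50000 =
  0.0032 per unit of d k, just below the margin 1/300.\<close>

lemma moved_eq_empty_of_gain:
  assumes d: "d \<ge> 1" and s: "s\<^sup>2 \<le> 1"
    and Q: "orth_mat d Q" and Qs: "orth_mat d Qs"
    and p: "p permutes {..<n}" and q: "q permutes {..<n}"
    and X: "\<And>j. j < n \<Longrightarrow> (\<Sum>l<d. (X (l, j))\<^sup>2) \<le> 20 * real d"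
    and Z: "\<And>j. j < n \<Longrightarrow> (\<Sum>l<d. (Z (l, j))\<^sup>2) \<le> 20 * real d"
    and pos: "0 \<le> gain d s {..<n} (resid d Q Qs X p q) Z"
    and good: "\<And>m D. m \<in> int_ball ({..<d} \<times> {..<d}) (2 / (1/50000)\<^sup>2 + 2) \<Longrightarrow> D \<in> ({..<d} \<times> {..<d}) \<rightarrow>\<^sub>E \<rat> \<Longrightarrow>
       gain d s ({..<n} - moved n p q) (\<lambda>a i. \<Sum>l<d. D (a, l) * X (l, q i)) Z
       + gain d s (moved n p q) (resid d (grid_mat (1/50000) d m) Qs X p q) Z
       < - (real d * real (card (moved n p q)) / 300)"
  shows "moved n p q = {}"
proof (rule ccontr)
  assume "moved n p q \<noteq> {}"
  define K where "K = moved n p q"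
  define c where "c = 20 * real d * real (card K)"
  have "card K > 0" unfolding K_def using \<open>moved n p q \<noteq> {}\<close> by (simp add: card_gt_0_iff)
  then have c: "c > 0" unfolding c_def using d by simp
  have Kn: "p i < n" "q i < n" "i < n" if "i \<in> K" for i
  proof -
    show "i < n" using that moved_subset unfolding K_def by blast
    then show "p i < n" "q i < n" using permutes_in_image[OF p, of i] permutes_in_image[OF q, of i] by auto
  qed
  obtain m where m: "m \<in> int_ball ({..<d} \<times> {..<d}) (2 / (1/50000)\<^sup>2 + 2)"
    and E: "(\<Sum>a<d. \<Sum>i\<in>K. ((\<Sum>l<d. Q a l * X (l, p i)) - (\<Sum>l<d. mesh (1/50000) d * real_of_int (m (a, l)) * X (l, p i)))\<^sup>2)
       \<le> (1/50000)\<^sup>2 * (20 * real d) * real (card K)"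
    by (rule exists_rounded_orth_mat[OF Q d, where \<epsilon> = "1/50000" and K = K and x = "\<lambda>l i. X (l, p i)" and c = "20 * real d"])
      (use X Kn in auto)
  let ?V = "resid d Q Qs X p q" and ?W = "resid d (grid_mat (1/50000) d m) Qs X p q"
  have "gain d s K ?V Z \<le> gain d s K ?W Z + 8 * (1/50000) * c"
  proof (rule gain_perturb_le[OF s])
    show "(\<Sum>a<d. \<Sum>i\<in>K. (?V a i - ?W a i)\<^sup>2) \<le> (1/50000)\<^sup>2 * c"
      using E by (simp add: resid_def grid_mat_def c_def mult.assoc)
    show "(\<Sum>a<d. \<Sum>i\<in>K. (Z (a, i))\<^sup>2) \<le> c"
      unfolding c_def by (rule double_sum_columns_le) (use Z Kn in auto)
    have "(\<Sum>a<d. \<Sum>i\<in>K. (?V a i)\<^sup>2) \<le> (4 * (20 * real d)) * real (card K)"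
      unfolding resid_def
      by (rule double_sum_columns_le, rule orth_difference_column_le[OF Q Qs]) (use X Kn in auto)
    then show "(\<Sum>a<d. \<Sum>i\<in>K. (?V a i)\<^sup>2) \<le> 4 * c" by (simp add: c_def)
  qed simp_all
  moreover have "gain d s ({..<n} - K) (\<lambda>a i. \<Sum>l<d. (Q a l - Qs a l) * X (l, q i)) Z
      \<le> - (real d * real (card K) / 300) - gain d s K ?W Z"
  proof (rule gain_rational_dense[where D = "\<lambda>a l. Q a l - Qs a l" and r = "\<lambda>l i. X (l, q i)"])
    fix D :: "nat \<times> nat \<Rightarrow> real" assume D: "D \<in> ({..<d} \<times> {..<d}) \<rightarrow>\<^sub>E \<rat>"
    show "gain d s ({..<n} - K) (\<lambda>a i. \<Sum>l<d. D (a, l) * X (l, q i)) Z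
      \<le> - (real d * real (card K) / 300) - gain d s K ?W Z"
      using good[OF m D] unfolding K_def[symmetric] by linarith
  qed
  moreover have "gain d s {..<n} ?V Z = gain d s ({..<n} - K) ?V Z + gain d s K ?V Z"
  proof -
    have "{..<n} - ({..<n} - K) = K" using moved_subset unfolding K_def by (rule double_diff) simp
    then show ?thesis using gain_split[of "{..<n}" "{..<n} - K" d s ?V Z] by simp
  qed
  moreover have "gain d s ({..<n} - K) ?V Z = gain d s ({..<n} - K) (\<lambda>a i. \<Sum>l<d. (Q a l - Qs a l) * X (l, q i)) Z"
    by (rule gain_cong) (simp add: resid_unmoved K_def)
  ultimately have "0 \<le> - (real d * real (card K) / 300) + 8 * (1/50000) * c" using pos by linarith
  then show False using c unfolding c_def by simp
qed

text \<open>A lower bound on the smallest singular value of X through a net of directions. For a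
  unit vector, rounding costs at most 20 n / 4900 = n / 245, and half of the grid bound n / 60
  exceeds this by more than n / 240.\<close>

lemma sum_projections_ge:
  assumes d: "d \<ge> 1"
    and X: "\<And>j. j < n \<Longrightarrow> (\<Sum>l<d. (X (l, j))\<^sup>2) \<le> 20 * real d"
    and grid: "\<And>m. m \<in> int_ball {..<d} 9802 \<Longrightarrow> 1/4 \<le> (\<Sum>l<d. (mesh (1/70) d * real_of_int (m l))\<^sup>2) \<Longrightarrow>
       real n / 60 \<le> (\<Sum>j<n. (\<Sum>l<d. mesh (1/70) d * real_of_int (m l) * X (l, j))\<^sup>2)"
  shows "real n / 240 * (\<Sum>l<d. (v l)\<^sup>2) \<le> (\<Sum>j<n. (\<Sum>l<d. v l * X (l, j))\<^sup>2)"
proof (cases "(\<Sum>l<d. (v l)\<^sup>2) = 0")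
  case True
  then show ?thesis by (simp add: sum_nonneg)
next
  case False
  define N where "N = (\<Sum>l<d. (v l)\<^sup>2)"
  have N: "N > 0" using False unfolding N_def by (simp add: sum_nonneg less_le)
  define u where "u l = v l / sqrt N" for l
  have u1: "(\<Sum>l<d. (u l)\<^sup>2) = 1"
    using N by (simp add: u_def power_divide sum_divide_distrib[symmetric] N_def[symmetric])
  define \<delta> where "\<delta> = mesh (1/70) d"
  have \<delta>: "\<delta> > 0" unfolding \<delta>_def using mesh_pos d by simp
  have \<delta>2: "\<delta>\<^sup>2 * real d = 1/4900" unfolding \<delta>_def mesh_square using d by (simp add: power2_eq_square)
  obtain m0 :: "nat \<Rightarrow> int" where m1: "\<And>l. l \<in> {..<d} \<Longrightarrow> \<bar>u l - \<delta> * real_of_int (m0 l)\<bar> \<le> \<delta>"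
    and m2: "(\<Sum>j<n. (\<Sum>l<d. (u l - \<delta> * real_of_int (m0 l)) * X (l, j))\<^sup>2) \<le> \<delta>\<^sup>2 * (\<Sum>l<d. \<Sum>j<n. (X (l, j))\<^sup>2)"
    by (rule exists_rounding[OF _ \<delta>, where L = "{..<d}" and q = u and K = "{..<n}" and x = "\<lambda>l j. X (l, j)"]) auto
  define m where "m = restrict m0 {..<d}"
  have m: "m l = m0 l" if "l < d" for l using that by (simp add: m_def)
  have ball: "m \<in> int_ball {..<d} 9802"
  proof -
    have "(\<Sum>l<d. (real_of_int (m l))\<^sup>2) \<le> 2 / \<delta>\<^sup>2 * (\<Sum>l<d. (u l)\<^sup>2) + 2 * real (card {..<d})"
      by (rule rounded_sum_squares_le[OF \<delta>]) (use m1 m in auto)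
    moreover have "2 / \<delta>\<^sup>2 = 9800 * real d" using \<delta>2 \<delta> by (simp add: field_simps)
    ultimately have "(\<Sum>l<d. (real_of_int (m l))\<^sup>2) \<le> 9802 * real (card {..<d})" by (simp add: u1)
    then show ?thesis by (auto simp: int_ball_def m_def)
  qed
  define w where "w l = \<delta> * real_of_int (m l)" for l
  have half: "a\<^sup>2 / 2 - (a - b)\<^sup>2 \<le> b\<^sup>2" for a b :: real
  proof -
    have "0 \<le> (a - 2 * b)\<^sup>2" by simp
    then show ?thesis by (simp add: power2_eq_square algebra_simps)
  qed
  \<comment> \<open>Rounding may shorten the unit vector, but its squared length stays at least 1/2
    - 1/4900, above the cutoff in \<open>grid\<close>.\<close>
  have "1/4 \<le> (\<Sum>l<d. (w l)\<^sup>2)"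
  proof -
    have "(\<Sum>l<d. (u l)\<^sup>2 / 2 - \<delta>\<^sup>2) \<le> (\<Sum>l<d. (w l)\<^sup>2)"
    proof (rule sum_mono)
      fix l assume "l \<in> {..<d}"
      then have "(u l - w l)\<^sup>2 \<le> \<delta>\<^sup>2"
        using m1[of l] m[of l] \<delta> by (simp add: w_def abs_le_square_iff[symmetric])
      then show "(u l)\<^sup>2 / 2 - \<delta>\<^sup>2 \<le> (w l)\<^sup>2" using half[of "u l" "w l"] by linarith
    qed
    moreover have "(\<Sum>l<d. (u l)\<^sup>2 / 2 - \<delta>\<^sup>2) = 1/2 - \<delta>\<^sup>2 * real d"
      using u1 by (simp add: sum_subtractf sum_divide_distrib[symmetric] mult.commute)
    ultimately show ?thesis using \<delta>2 by simp
  qed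
  then have w: "real n / 60 \<le> (\<Sum>j<n. (\<Sum>l<d. w l * X (l, j))\<^sup>2)"
    using grid[OF ball] by (simp add: w_def \<delta>_def)
  have "(\<Sum>l<d. \<Sum>j<n. (X (l, j))\<^sup>2) \<le> 20 * real d * real (card {..<n})"
    by (rule double_sum_columns_le) (use X in auto)
  then have "\<delta>\<^sup>2 * (\<Sum>l<d. \<Sum>j<n. (X (l, j))\<^sup>2) \<le> \<delta>\<^sup>2 * (20 * real d * real n)"
    by (intro mult_left_mono) auto
  also have "\<dots> = (\<delta>\<^sup>2 * real d) * (20 * real n)" by simp
  also have "\<dots> = real n / 245" unfolding \<delta>2 by simp
  finally have err: "(\<Sum>j<n. (\<Sum>l<d. (w l - u l) * X (l, j))\<^sup>2) \<le> real n / 245"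
  proof -
    have "(\<Sum>j<n. (\<Sum>l<d. (w l - u l) * X (l, j))\<^sup>2) = (\<Sum>j<n. (\<Sum>l<d. (u l - \<delta> * real_of_int (m0 l)) * X (l, j))\<^sup>2)"
    proof (intro sum.cong refl)
      fix j
      have "(\<Sum>l<d. (w l - u l) * X (l, j)) = - (\<Sum>l<d. (u l - \<delta> * real_of_int (m0 l)) * X (l, j))"
        unfolding sum_negf[symmetric] by (intro sum.cong refl) (simp add: w_def m algebra_simps)
      then show "(\<Sum>l<d. (w l - u l) * X (l, j))\<^sup>2 = (\<Sum>l<d. (u l - \<delta> * real_of_int (m0 l)) * X (l, j))\<^sup>2"
        by simp
    qed
    then show "\<delta>\<^sup>2 * (\<Sum>l<d. \<Sum>j<n. (X (l, j))\<^sup>2) \<le> real n / 245 \<Longrightarrow> ?thesis" using m2 by linarith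
  qed
  have "real n / 240 \<le> (\<Sum>j<n. (\<Sum>l<d. w l * X (l, j))\<^sup>2) / 2 - (\<Sum>j<n. (\<Sum>l<d. (w l - u l) * X (l, j))\<^sup>2)"
    using w err by simp
  also have "\<dots> = (\<Sum>j<n. (\<Sum>l<d. w l * X (l, j))\<^sup>2 / 2 - ((\<Sum>l<d. w l * X (l, j)) - (\<Sum>l<d. u l * X (l, j)))\<^sup>2)"
    by (simp add: sum_subtractf sum_divide_distrib left_diff_distrib)
  also have "\<dots> \<le> (\<Sum>j<n. (\<Sum>l<d. u l * X (l, j))\<^sup>2)" by (intro sum_mono half)
  also have "\<dots> = (\<Sum>j<n. (\<Sum>l<d. v l * X (l, j))\<^sup>2) / N"
    using N by (simp add: u_def power_divide sum_divide_distrib[symmetric])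
  finally show ?thesis using N unfolding N_def[symmetric] by (simp add: field_simps)
qed

text \<open>The gain is a concave quadratic, so bounding it above for every matrix also bounds its
  curvature: with U = (Q - Qs) X one has 2 gain (U/2) = gain U + |U|^2 / 2. A lower bound on gain U
  therefore bounds |U|^2, and \<open>sing\<close> passes from |U|^2 to |Q - Qs|^2.\<close>

lemma ell2_le_of_gain:
  assumes d: "d \<ge> 1" and s: "60 * s\<^sup>2 \<le> 1" and n: "n \<ge> 1"
    and Q: "orth_mat d Q" and Qs: "orth_mat d Qs"
    and p: "p permutes {..<n}" and q: "q permutes {..<n}"
    and X: "\<And>j. j < n \<Longrightarrow> (\<Sum>l<d. (X (l, j))\<^sup>2) \<le> 20 * real d"
    and Z: "\<And>j. j < n \<Longrightarrow> (\<Sum>l<d. (Z (l, j))\<^sup>2) \<le> 20 * real d"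
    and pos: "0 \<le> gain d s {..<n} (resid d Q Qs X p q) Z"
    and k: "real (card (moved n p q)) \<le> c * real d"
    and good: "\<And>D. D \<in> ({..<d} \<times> {..<d}) \<rightarrow>\<^sub>E \<rat> \<Longrightarrow>
       gain d s {..<n} (\<lambda>a i. \<Sum>l<d. D (a, l) * X (l, q i)) Z \<le> (real d)\<^sup>2"
    and sing: "\<And>v. real n / 240 * (\<Sum>l<d. (v l)\<^sup>2) \<le> (\<Sum>j<n. (\<Sum>l<d. v l * X (l, j))\<^sup>2)"
  shows "ell2 d Qs Q / (2 * real d) \<le> (480 + 38880 * c) * real d / real n"
proof -
  define K where "K = moved n p q"
  define U where "U a i = (\<Sum>l<d. (Q a l - Qs a l) * X (l, q i))" for a i
  let ?V = "resid d Q Qs X p q"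
  define dk where "dk = real d * real (card K)"
  have Kn: "p i < n" "q i < n" "i < n" if "i \<in> K" for i
  proof -
    show "i < n" using that moved_subset unfolding K_def by blast
    then show "p i < n" "q i < n" using permutes_in_image[OF p, of i] permutes_in_image[OF q, of i] by auto
  qed
  have ZK: "(\<Sum>a<d. \<Sum>i\<in>K. (Z (a, i))\<^sup>2) \<le> 20 * dk"
    unfolding dk_def mult.assoc[symmetric] by (rule double_sum_columns_le) (use Z Kn in auto)
  have sZK: "s\<^sup>2 * (\<Sum>a<d. \<Sum>i\<in>K. (Z (a, i))\<^sup>2) \<le> dk"
  proof -
    have "s\<^sup>2 * (\<Sum>a<d. \<Sum>i\<in>K. (Z (a, i))\<^sup>2) \<le> 1/60 * (20 * dk)"
      using s ZK by (intro mult_mono) (auto simp: sum_nonneg)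
    moreover have "dk \<ge> 0" by (simp add: dk_def)
    ultimately show ?thesis by linarith
  qed
  \<comment> \<open>\<open>U\<close> differs from the true residual only on the moved columns.
    Exchanging the two there costs at most (1 + 161) d k, by crude bounds column by column.\<close>
  have 1: "gain d s K ?V Z \<le> dk"
  proof -
    have "gain d s K ?V Z \<le> (\<Sum>a<d. \<Sum>i\<in>K. s\<^sup>2 * (Z (a, i))\<^sup>2)"
      unfolding gain_def
    proof (intro sum_mono)
      fix a i
      have "0 \<le> (s * Z (a, i) - ?V a i)\<^sup>2" by simp
      then show "2 * s * ?V a i * Z (a, i) - (?V a i)\<^sup>2 \<le> s\<^sup>2 * (Z (a, i))\<^sup>2"
        by (simp add: power2_eq_square algebra_simps)
    qed
    then show ?thesis using sZK by (simp add: sum_distrib_left)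
  qed
  have 2: "- gain d s K U Z \<le> 161 * dk"
  proof -
    have "- gain d s K U Z \<le> (\<Sum>a<d. \<Sum>i\<in>K. s\<^sup>2 * (Z (a, i))\<^sup>2 + 2 * (U a i)\<^sup>2)"
      unfolding gain_def sum_negf[symmetric]
    proof (intro sum_mono)
      fix a i
      have "0 \<le> (s * Z (a, i) + U a i)\<^sup>2" by simp
      then show "- (2 * s * U a i * Z (a, i) - (U a i)\<^sup>2) \<le> s\<^sup>2 * (Z (a, i))\<^sup>2 + 2 * (U a i)\<^sup>2"
        by (simp add: power2_eq_square algebra_simps)
    qed
    also have "\<dots> = s\<^sup>2 * (\<Sum>a<d. \<Sum>i\<in>K. (Z (a, i))\<^sup>2) + 2 * (\<Sum>a<d. \<Sum>i\<in>K. (U a i)\<^sup>2)"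
      by (simp add: sum.distrib sum_distrib_left)
    also have "(\<Sum>a<d. \<Sum>i\<in>K. (U a i)\<^sup>2) \<le> (4 * (20 * real d)) * real (card K)"
    proof (rule double_sum_columns_le)
      fix i assume "i \<in> K"
      then show "(\<Sum>a<d. (U a i)\<^sup>2) \<le> 4 * (20 * real d)"
        unfolding U_def left_diff_distrib sum_subtractf
        by (intro orth_difference_column_le[OF Q Qs] X Kn)
    qed
    finally show ?thesis using sZK by (simp add: dk_def)
  qed
  have split: "gain d s {..<n} V Z = gain d s ({..<n} - K) V Z + gain d s K V Z" for V
  proof -
    have "{..<n} - ({..<n} - K) = K" using moved_subset unfolding K_def by (rule double_diff) simp
    then show ?thesis using gain_split[of "{..<n}" "{..<n} - K" d s V Z] by simp
  qed
  have "gain d s ({..<n} - K) ?V Z = gain d s ({..<n} - K) U Z"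
    by (rule gain_cong) (simp add: resid_unmoved K_def U_def)
  then have 3: "- 162 * dk \<le> gain d s {..<n} U Z"
    using pos 1 2 split[of ?V] split[of U] by linarith
  define S where "S = (\<Sum>a<d. \<Sum>i<n. (U a i)\<^sup>2)"
  have 4: "gain d s {..<n} (\<lambda>a i. \<Sum>l<d. ((Q a l - Qs a l) / 2) * X (l, q i)) Z \<le> (real d)\<^sup>2"
    by (rule gain_rational_dense[where D = "\<lambda>a l. (Q a l - Qs a l) / 2" and r = "\<lambda>l i. X (l, q i)"])
      (rule good)
  have U2: "(\<Sum>l<d. ((Q a l - Qs a l) / 2) * X (l, q i)) = U a i / 2" for a i
    by (simp add: U_def sum_divide_distrib)
  have 5: "2 * gain d s {..<n} (\<lambda>a i. U a i / 2) Z = gain d s {..<n} U Z + S / 2"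
    unfolding gain_def S_def sum_distrib_left sum_divide_distrib sum.distrib[symmetric]
    by (intro sum.cong refl) (simp add: power2_eq_square algebra_simps)
  have "S \<le> 4 * (real d)\<^sup>2 + 324 * dk" using 3 4 5 unfolding U2 by linarith
  also have "dk \<le> c * (real d)\<^sup>2"
    using mult_left_mono[OF k, of "real d"] by (simp add: dk_def K_def power2_eq_square mult_ac)
  finally have S: "S \<le> (4 + 324 * c) * (real d)\<^sup>2" by (simp add: distrib_right)
  have "real n / 240 * ell2 d Qs Q = (\<Sum>a<d. real n / 240 * (\<Sum>l<d. (Q a l - Qs a l)\<^sup>2))"
    by (simp add: ell2_def sum_distrib_left power2_commute)
  also have "\<dots> \<le> (\<Sum>a<d. \<Sum>j<n. (\<Sum>l<d. (Q a l - Qs a l) * X (l, j))\<^sup>2)"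
    by (intro sum_mono sing)
  also have "\<dots> = S"
    unfolding S_def U_def
  proof (rule sum.cong[OF refl])
    fix a
    show "(\<Sum>j<n. (\<Sum>l<d. (Q a l - Qs a l) * X (l, j))\<^sup>2) = (\<Sum>i<n. (\<Sum>l<d. (Q a l - Qs a l) * X (l, q i))\<^sup>2)"
      using sum.permute[OF q, of "\<lambda>j. (\<Sum>l<d. (Q a l - Qs a l) * X (l, j))\<^sup>2"] by (simp add: o_def)
  qed
  finally have "real n * ell2 d Qs Q \<le> 240 * ((4 + 324 * c) * (real d)\<^sup>2)" using S by simp
  then have "real n * ell2 d Qs Q / (2 * real d * real n) \<le> 240 * ((4 + 324 * c) * (real d)\<^sup>2) / (2 * real d * real n)"
    by (rule divide_right_mono) simp
  moreover have "real n * ell2 d Qs Q / (2 * real d * real n) = ell2 d Qs Q / (2 * real d)" using n by simp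
  moreover have "240 * ((4 + 324 * c) * (real d)\<^sup>2) / (2 * real d * real n) = (480 + 38880 * c) * real d / real n"
    using d n by (simp add: power2_eq_square field_simps)
  ultimately show ?thesis by simp
qed

section \<open>Probability of the bad events\<close>

lemma prob_space_gauss_model: "prob_space (gauss_model d n)"
  unfolding gauss_model_def by (intro prob_space_pair prob_space_std_gauss)

lemma borel_measurable_gauss_model_coords [measurable]:
  "(\<lambda>\<omega>. fst \<omega> i) \<in> borel_measurable (gauss_model d n)"
  "(\<lambda>\<omega>. snd \<omega> i) \<in> borel_measurable (gauss_model d n)"
  unfolding gauss_model_def
  by (rule measurable_compose[OF measurable_fst borel_measurable_std_gauss_coord],
      rule measurable_compose[OF measurable_snd borel_measurable_std_gauss_coord])

lemma emeasure_gauss_model_fst: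
  assumes "{X \<in> space (std_gauss ({..<d} \<times> {..<n})). P X} \<in> sets (std_gauss ({..<d} \<times> {..<n}))"
  shows "emeasure (gauss_model d n) {\<omega> \<in> space (gauss_model d n). P (fst \<omega>)}
     = emeasure (std_gauss ({..<d} \<times> {..<n})) {X \<in> space (std_gauss ({..<d} \<times> {..<n})). P X}"
proof -
  interpret G: prob_space "std_gauss ({..<d} \<times> {..<n})" by (rule prob_space_std_gauss)
  have eq: "{\<omega> \<in> space (gauss_model d n). P (fst \<omega>)}
     = {X \<in> space (std_gauss ({..<d} \<times> {..<n})). P X} \<times> space (std_gauss ({..<d} \<times> {..<n}))"
    by (auto simp: gauss_model_def space_pair_measure)
  show ?thesis unfolding eq using assms
    by (simp add: gauss_model_def G.emeasure_pair_measure_Times G.emeasure_space_1)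
qed

lemma emeasure_gauss_model_snd:
  assumes "{X \<in> space (std_gauss ({..<d} \<times> {..<n})). P X} \<in> sets (std_gauss ({..<d} \<times> {..<n}))"
  shows "emeasure (gauss_model d n) {\<omega> \<in> space (gauss_model d n). P (snd \<omega>)}
     = emeasure (std_gauss ({..<d} \<times> {..<n})) {X \<in> space (std_gauss ({..<d} \<times> {..<n})). P X}"
proof -
  interpret G: prob_space "std_gauss ({..<d} \<times> {..<n})" by (rule prob_space_std_gauss)
  have eq: "{\<omega> \<in> space (gauss_model d n). P (snd \<omega>)}
     = space (std_gauss ({..<d} \<times> {..<n})) \<times> {X \<in> space (std_gauss ({..<d} \<times> {..<n})). P X}"
    by (auto simp: gauss_model_def space_pair_measure)
  show ?thesis unfolding eq using assms
    by (simp add: gauss_model_def G.emeasure_pair_measure_Times G.emeasure_space_1)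
qed

lemma exp_half_power: "(1/2 :: real) ^ k \<le> exp (- (2/3) * real k)"
proof -
  have "exp (2/3) \<le> (2::real)"
    using ln2_ge_two_thirds exp_le_cancel_iff[of "2/3" "ln 2"] by simp
  then have "1/2 \<le> exp (- (2/3) :: real)" unfolding exp_minus by (simp add: field_simps)
  then have "(1/2 :: real) ^ k \<le> exp (- (2/3)) ^ k" by (intro power_mono) auto
  also have "\<dots> = exp (- (2/3) * real k)" by (simp add: exp_of_nat_mult[symmetric] mult.commute)
  finally show ?thesis .
qed

lemma sqrt2_le_exp_half: "sqrt 2 \<le> exp (1/2 :: real)"
proof -
  have "1 + 1/2 + (1/2)\<^sup>2 / 2 \<le> exp (1/2 :: real)" by (rule exp_lower_Taylor_quadratic) simp
  moreover have "sqrt 2 \<le> 1 + 1/2 + (1/2)\<^sup>2 / (2::real)" by (rule real_le_lsqrt) (auto simp: power2_eq_square)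
  ultimately show ?thesis by linarith
qed

lemma three_le_exp: "(3::real) \<le> exp (3/2)"
proof -
  have "1 + 3/2 + (3/2)\<^sup>2 / 2 \<le> exp (3/2 :: real)" by (rule exp_lower_Taylor_quadratic) simp
  then show ?thesis by (simp add: power2_eq_square)
qed

lemma emeasure_large_column:
  fixes n :: nat
  assumes "j < n"
  shows "emeasure (std_gauss ({..<d} \<times> {..<n})) {X \<in> space (std_gauss ({..<d} \<times> {..<n})). 20 * real d < (\<Sum>a<d. (X (a, j))\<^sup>2)}
     \<le> ennreal (exp (- 4 * real d))"
proof -
  let ?M = "std_gauss ({..<d} \<times> {..<n})"
  have "emeasure ?M {X \<in> space ?M. 20 * real d < (\<Sum>a<d. (X (a, j))\<^sup>2)}
     \<le> (\<integral>\<^sup>+X. ennreal (exp ((\<Sum>a<d. (X (a, j))\<^sup>2) / 4 - 5 * real d)) \<partial>?M)"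
    by (rule emeasure_le_nn_integral_exp) auto
  also have "\<dots> = (\<integral>\<^sup>+X. ennreal (exp (- 5 * real d)) * ennreal (exp ((\<Sum>a<d. (X (a, j))\<^sup>2) / 4)) \<partial>?M)"
    by (intro nn_integral_cong) (simp add: ennreal_mult[symmetric] exp_add[symmetric])
  also have "\<dots> = ennreal (exp (- 5 * real d)) * (\<integral>\<^sup>+X. ennreal (exp ((\<Sum>a<d. (X (a, j))\<^sup>2) / 4)) \<partial>?M)"
    by (rule nn_integral_cmult) measurable
  \<comment> \<open>A single column is the case \<open>F = {j}\<close> with the one unit vector u =
    1 and no linear part.\<close>
  also have "(\<integral>\<^sup>+X. ennreal (exp ((\<Sum>a<d. (X (a, j))\<^sup>2) / 4)) \<partial>?M) = ennreal (sqrt 2 ^ d)"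
    using nn_integral_std_gauss_exp_linear_plus_squares[where A = "{..<n}" and F = "{j}" and m = 1
        and u = "\<lambda>_ _. 1" and d = d and \<alpha> = "\<lambda>_ _. 0"] assms
    by simp
  also have "ennreal (exp (- 5 * real d)) * ennreal (sqrt 2 ^ d) \<le> ennreal (exp (- 5 * real d)) * ennreal (exp (1/2) ^ d)"
    using sqrt2_le_exp_half by (intro mult_left_mono ennreal_leI power_mono) auto
  also have "\<dots> \<le> ennreal (exp (- 4 * real d))"
    by (simp add: ennreal_mult[symmetric] exp_of_nat_mult[symmetric] exp_add[symmetric])
  finally show ?thesis .
qed

text \<open>The exponent 30 makes 1 + 2 * 30 / 4 = 16, so each column yields a factor 1/4; against
  exp (30 n / 60) this leaves exp (n / 2 - 4 n / 3).\<close>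

lemma emeasure_small_projection:
  fixes w :: "nat \<Rightarrow> real"
  assumes w: "1/4 \<le> (\<Sum>l<d. (w l)\<^sup>2)"
  shows "emeasure (std_gauss ({..<d} \<times> {..<n})) {X \<in> space (std_gauss ({..<d} \<times> {..<n})). (\<Sum>j<n. (\<Sum>l<d. w l * X (l, j))\<^sup>2) < real n / 60}
     \<le> ennreal (exp (- (5/6) * real n))"
proof -
  let ?I = "{..<d} \<times> {..<n}"
  let ?M = "std_gauss ?I"
  have inner: "(\<Sum>i | i \<in> ?I \<and> snd i = j. f i) = (\<Sum>l<d. f (l, j))" if "j < n" for j and f :: "nat \<times> nat \<Rightarrow> real"
  proof -
    have "{i. i \<in> ?I \<and> snd i = j} = (\<lambda>l. (l, j)) ` {..<d}" using that by auto
    moreover have "inj_on (\<lambda>l. (l, j)) {..<d}" by (auto simp: inj_on_def)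
    ultimately show ?thesis by (simp add: sum.reindex)
  qed
  have "emeasure ?M {X \<in> space ?M. (\<Sum>j<n. (\<Sum>l<d. w l * X (l, j))\<^sup>2) < real n / 60}
     \<le> (\<integral>\<^sup>+X. ennreal (exp (real n / 2 - 30 * (\<Sum>j<n. (\<Sum>l<d. w l * X (l, j))\<^sup>2))) \<partial>?M)"
    by (rule emeasure_le_nn_integral_exp) auto
  also have "\<dots> = (\<integral>\<^sup>+X. ennreal (exp (real n / 2)) * ennreal (exp (- (\<Sum>j<n. 30 * (\<Sum>i | i \<in> ?I \<and> snd i = j. w (fst i) * X i)\<^sup>2))) \<partial>?M)"
    by (intro nn_integral_cong)
      (simp add: ennreal_mult[symmetric] exp_add[symmetric] inner sum_distrib_left del: mem_Times_iff mem_Sigma_iff)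
  also have "\<dots> = ennreal (exp (real n / 2)) * (\<integral>\<^sup>+X. ennreal (exp (- (\<Sum>j<n. 30 * (\<Sum>i | i \<in> ?I \<and> snd i = j. w (fst i) * X i)\<^sup>2))) \<partial>?M)"
    by (rule nn_integral_cmult) measurable
  also have "(\<integral>\<^sup>+X. ennreal (exp (- (\<Sum>j<n. 30 * (\<Sum>i | i \<in> ?I \<and> snd i = j. w (fst i) * X i)\<^sup>2))) \<partial>?M)
     = ennreal (\<Prod>j<n. 1 / sqrt (1 + 2 * 30 * (\<Sum>i | i \<in> ?I \<and> snd i = j. (w (fst i))\<^sup>2)))"
    by (rule nn_integral_std_gauss_exp_projections) auto
  also have "(\<Prod>j<n. 1 / sqrt (1 + 2 * 30 * (\<Sum>i | i \<in> ?I \<and> snd i = j. (w (fst i))\<^sup>2))) \<le> (\<Prod>j<n. 1/4)"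
  proof (rule prod_mono, rule conjI)
    fix j assume "j \<in> {..<n}"
    then have e: "(\<Sum>i | i \<in> ?I \<and> snd i = j. (w (fst i))\<^sup>2) = (\<Sum>l<d. (w l)\<^sup>2)"
      using inner[of j "\<lambda>i. (w (fst i))\<^sup>2"] by simp
    have "4 \<le> sqrt (1 + 2 * 30 * (\<Sum>l<d. (w l)\<^sup>2))" using w by (intro real_le_rsqrt) simp
    then show "1 / sqrt (1 + 2 * 30 * (\<Sum>i | i \<in> ?I \<and> snd i = j. (w (fst i))\<^sup>2)) \<le> 1 / 4"
      unfolding e using w by (intro divide_left_mono) auto
    show "0 \<le> 1 / sqrt (1 + 2 * 30 * (\<Sum>i | i \<in> ?I \<and> snd i = j. (w (fst i))\<^sup>2))"
      by (auto intro!: sum_nonneg add_nonneg_nonneg)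
  qed
  also have "(\<Prod>j<n. 1/4 :: real) = (1/2) ^ (2 * n)" unfolding power_mult by (simp add: power2_eq_square)
  also have "\<dots> \<le> exp (- (2/3) * real (2 * n))" by (rule exp_half_power)
  finally have "emeasure ?M {X \<in> space ?M. (\<Sum>j<n. (\<Sum>l<d. w l * X (l, j))\<^sup>2) < real n / 60}
    \<le> ennreal (exp (real n / 2)) * ennreal (exp (- (2/3) * real (2 * n)))"
    by (simp add: mult_left_mono ennreal_leI)
  also have "\<dots> = ennreal (exp (- (5/6) * real n))"
    by (simp add: ennreal_mult[symmetric] exp_add[symmetric])
  finally show ?thesis .
qed

text \<open>The permutation and the grid point are fixed, for a later union bound; \<open>D\<close>
  stays inside the event because its supremum is bounded directly. The threshold 1/300 absorbs the
  rounding and costs exp (15 d k / 300).\<close>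

definition match_excess :: "nat \<Rightarrow> nat \<Rightarrow> real \<Rightarrow> (nat \<Rightarrow> nat \<Rightarrow> real) \<Rightarrow> (nat \<Rightarrow> nat) \<Rightarrow> (nat \<Rightarrow> nat) \<Rightarrow> (nat \<times> nat \<Rightarrow> int) \<Rightarrow>
    ((nat \<times> nat \<Rightarrow> real) \<times> (nat \<times> nat \<Rightarrow> real)) set" where
  "match_excess d n s Q q p m = {\<omega> \<in> space (gauss_model d n). \<exists>D \<in> ({..<d} \<times> {..<d}) \<rightarrow>\<^sub>E \<rat>.
     - (real d * real (card (moved n p q)) / 300) \<le>
       gain d s ({..<n} - moved n p q) (\<lambda>a i. \<Sum>l<d. D (a, l) * fst \<omega> (l, q i)) (snd \<omega>)
       + gain d s (moved n p q) (resid d (grid_mat (1/50000) d m) Q (fst \<omega>) p q) (snd \<omega>)}"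

lemma countable_rational_matrices: "countable (({..<d::nat} \<times> {..<d}) \<rightarrow>\<^sub>E (\<rat> :: real set))"
  by (intro countable_PiE) (auto simp: countable_rat)

lemma match_excess_sets [measurable]: "match_excess d n s Q q p m \<in> sets (gauss_model d n)"
  unfolding match_excess_def gain_def resid_def
  by (rule sets.sets_Collect_countable_Ex'[OF _ countable_rational_matrices]) measurable

text \<open>Given X, the noise is integrated first by the Chernoff bound. What remains is exp (-15/2
  |R|^2) for the residual R, integrated over X by the triangular argument.\<close>

lemma emeasure_match_excess_le:
  assumes s: "60 * s\<^sup>2 \<le> 1" and Q: "orth_mat d Q"
    and p: "p permutes {..<n}" and q: "q permutes {..<n}"
  shows "emeasure (gauss_model d n) (match_excess d n s Q q p m)
     \<le> ennreal (exp (real d * real (card (moved n p q)) / 20) * sqrt 2 ^ (d * d) * (1/2) ^ (d * card (moved n p q)))"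
proof -
  let ?M = "std_gauss ({..<d} \<times> {..<n})"
  interpret G: prob_space ?M by (rule prob_space_std_gauss)
  let ?K = "moved n p q"
  define t where "t = real d * real (card ?K) / 300"
  define R where "R X = resid d (grid_mat (1/50000) d m) Q X p q" for X
  \<comment> \<open>Rotating by Q^T preserves norms and turns the residual into B x_(p i) - x_(q i)
    with B = Q^T M, the form with leading coefficient one.\<close>
  define B where "B a l = (\<Sum>k<d. Q k a * grid_mat (1/50000) d m k l)" for a l
  have R: "(\<Sum>a<d. \<Sum>i\<in>?K. (R X a i)\<^sup>2) = (\<Sum>a<d. \<Sum>i\<in>?K. ((\<Sum>l<d. B a l * X (l, p i)) - X (a, q i))\<^sup>2)" for X
  proof -
    have "(\<Sum>a<d. (R X a i)\<^sup>2) = (\<Sum>a<d. ((\<Sum>l<d. B a l * X (l, p i)) - X (a, q i))\<^sup>2)" for i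
    proof -
      define y where "y k = (\<Sum>l<d. grid_mat (1/50000) d m k l * X (l, p i))" for k
      have y: "(\<Sum>l<d. Q l a * y l) = (\<Sum>l<d. B a l * X (l, p i))" for a
      proof -
        have "(\<Sum>l<d. Q l a * y l) = (\<Sum>k<d. \<Sum>l<d. Q k a * grid_mat (1/50000) d m k l * X (l, p i))"
          unfolding y_def by (simp add: sum_distrib_left mult.assoc)
        then show ?thesis unfolding B_def by (subst (asm) sum.swap) (simp add: sum_distrib_right)
      qed
      have "(\<Sum>a<d. (R X a i)\<^sup>2) = (\<Sum>k<d. (X (k, q i) - (\<Sum>l<d. Q l k * y l))\<^sup>2)"
        unfolding orth_mat_residual[OF Q] R_def resid_def y_def by (simp add: power2_commute)
      then show ?thesis unfolding y by (simp add: power2_commute)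
    qed
    then show ?thesis by (subst (1 2) sum.swap) simp
  qed
  have FK: "{..<n} - ({..<n} - ?K) = ?K" using moved_subset by (rule double_diff) simp
  define c where "c = exp (15 * t) * sqrt 2 ^ (d * d)"
  have c: "c \<ge> 0" by (simp add: c_def)
  have "emeasure (gauss_model d n) (match_excess d n s Q q p m)
     = (\<integral>\<^sup>+X. emeasure ?M (Pair X -` match_excess d n s Q q p m) \<partial>?M)"
    using match_excess_sets unfolding gauss_model_def by (rule G.emeasure_pair_measure_alt)
  also have "\<dots> \<le> (\<integral>\<^sup>+X. ennreal c * ennreal (exp (- (15/2) * (\<Sum>a<d. \<Sum>i\<in>?K. ((\<Sum>l<d. B a l * X (l, p i)) - X (a, q i))\<^sup>2))) \<partial>?M)"
  proof (rule nn_integral_mono)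
    fix X assume X: "X \<in> space ?M"
    have "Pair X -` match_excess d n s Q q p m = {Z \<in> space ?M. \<exists>D \<in> ({..<d} \<times> {..<d}) \<rightarrow>\<^sub>E \<rat>.
        - t \<le> gain d s ({..<n} - ?K) (\<lambda>a i. \<Sum>l<d. D (a, l) * X (l, q i)) Z + gain d s ({..<n} - ({..<n} - ?K)) (R X) Z}"
      using X unfolding FK match_excess_def t_def R_def by (auto simp: gauss_model_def space_pair_measure)
    then have "emeasure ?M (Pair X -` match_excess d n s Q q p m)
      \<le> ennreal (exp (15 * t) * sqrt 2 ^ (d * d) * exp (- (15/2) * (\<Sum>a<d. \<Sum>i\<in>{..<n} - ({..<n} - ?K). (R X a i)\<^sup>2)))"
      by (simp only:) (rule emeasure_gain_le[where r = "\<lambda>l i. X (l, q i)", OF _ _ s], auto)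
    then show "emeasure ?M (Pair X -` match_excess d n s Q q p m)
      \<le> ennreal c * ennreal (exp (- (15/2) * (\<Sum>a<d. \<Sum>i\<in>?K. ((\<Sum>l<d. B a l * X (l, p i)) - X (a, q i))\<^sup>2)))"
      unfolding FK R by (simp only: c_def[symmetric] ennreal_mult[OF c exp_ge_zero])
  qed
  also have "\<dots> = ennreal c * (\<integral>\<^sup>+X. ennreal (exp (- (15/2) * (\<Sum>a<d. \<Sum>i\<in>?K. ((\<Sum>l<d. B a l * X (l, p i)) - X (a, q i))\<^sup>2))) \<partial>?M)"
    by (rule nn_integral_cmult) measurable
  also have "\<dots> \<le> ennreal c * ennreal ((1/2) ^ (d * card ?K))"
    by (intro mult_left_mono nn_integral_exp_residual[OF p q]) (auto simp: moved_def)
  also have "\<dots> = ennreal (exp (real d * real (card ?K) / 20) * sqrt 2 ^ (d * d) * (1/2) ^ (d * card ?K))"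
    using c by (simp add: ennreal_mult[symmetric] c_def t_def)
  finally show ?thesis .
qed

section \<open>Union bounds for the four kinds of bad event\<close>

lemma measure_gauss_model_le:
  assumes "emeasure (gauss_model d n) S \<le> ennreal c" "0 \<le> c"
  shows "measure (gauss_model d n) S \<le> c"
proof -
  interpret prob_space "gauss_model d n" by (rule prob_space_gauss_model)
  show ?thesis using assms by (simp add: emeasure_eq_measure)
qed

definition large_column :: "nat \<Rightarrow> nat \<Rightarrow> nat \<Rightarrow> ((nat \<times> nat \<Rightarrow> real) \<times> (nat \<times> nat \<Rightarrow> real)) set" where
  "large_column d n j =
     {\<omega> \<in> space (gauss_model d n). 20 * real d < (\<Sum>a<d. (fst \<omega> (a, j))\<^sup>2)}
     \<union> {\<omega> \<in> space (gauss_model d n). 20 * real d < (\<Sum>a<d. (snd \<omega> (a, j))\<^sup>2)}"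

lemma large_column_sets [measurable]: "large_column d n j \<in> sets (gauss_model d n)"
  unfolding large_column_def by measurable

lemma measure_large_column_le:
  assumes "j < n"
  shows "measure (gauss_model d n) (large_column d n j) \<le> 2 * exp (- real d)"
proof -
  interpret prob_space "gauss_model d n" by (rule prob_space_gauss_model)
  let ?A = "{\<omega> \<in> space (gauss_model d n). 20 * real d < (\<Sum>a<d. (fst \<omega> (a, j))\<^sup>2)}"
  let ?B = "{\<omega> \<in> space (gauss_model d n). 20 * real d < (\<Sum>a<d. (snd \<omega> (a, j))\<^sup>2)}"
  have m: "{X \<in> space (std_gauss ({..<d} \<times> {..<n})). 20 * real d < (\<Sum>a<d. (X (a, j))\<^sup>2)}
      \<in> sets (std_gauss ({..<d} \<times> {..<n}))" by measurable
  have e: "ennreal (exp (- 4 * real d)) \<le> ennreal (exp (- real d))" by (intro ennreal_leI) simp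
  have "measure (gauss_model d n) ?A \<le> exp (- real d)"
    by (intro measure_gauss_model_le, subst emeasure_gauss_model_fst[OF m],
        rule order.trans[OF emeasure_large_column[OF assms] e]) simp
  moreover have "measure (gauss_model d n) ?B \<le> exp (- real d)"
    by (intro measure_gauss_model_le, subst emeasure_gauss_model_snd[OF m],
        rule order.trans[OF emeasure_large_column[OF assms] e]) simp
  moreover have "measure (gauss_model d n) (large_column d n j) \<le> measure (gauss_model d n) ?A + measure (gauss_model d n) ?B"
    unfolding large_column_def by (rule measure_Un_le) measurable
  ultimately show ?thesis by linarith
qed

definition rotation_excess :: "nat \<Rightarrow> nat \<Rightarrow> real \<Rightarrow> (nat \<Rightarrow> nat) \<Rightarrow> ((nat \<times> nat \<Rightarrow> real) \<times> (nat \<times> nat \<Rightarrow> real)) set" where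
  "rotation_excess d n s q = {\<omega> \<in> space (gauss_model d n). \<exists>D \<in> ({..<d} \<times> {..<d}) \<rightarrow>\<^sub>E \<rat>.
     (real d)\<^sup>2 \<le> gain d s {..<n} (\<lambda>a i. \<Sum>l<d. D (a, l) * fst \<omega> (l, q i)) (snd \<omega>)}"

lemma rotation_excess_sets [measurable]: "rotation_excess d n s q \<in> sets (gauss_model d n)"
  unfolding rotation_excess_def gain_def
  by (rule sets.sets_Collect_countable_Ex'[OF _ countable_rational_matrices]) measurable

text \<open>The Chernoff bound without moved columns: -15 d^2 from the threshold against at most d^2
  / 2 from sqrt 2 ^ (d * d).\<close>

lemma measure_rotation_excess_le:
  assumes s: "60 * s\<^sup>2 \<le> 1" and d: "d \<ge> 1"
  shows "measure (gauss_model d n) (rotation_excess d n s q) \<le> exp (- real d)"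
proof (rule measure_gauss_model_le)
  let ?M = "std_gauss ({..<d} \<times> {..<n})"
  interpret G: prob_space ?M by (rule prob_space_std_gauss)
  define c where "c = exp (15 * (- (real d)\<^sup>2)) * sqrt 2 ^ (d * d)"
  have "emeasure (gauss_model d n) (rotation_excess d n s q)
     = (\<integral>\<^sup>+X. emeasure ?M (Pair X -` rotation_excess d n s q) \<partial>?M)"
    using rotation_excess_sets unfolding gauss_model_def by (rule G.emeasure_pair_measure_alt)
  also have "\<dots> \<le> (\<integral>\<^sup>+X. ennreal c \<partial>?M)"
  proof (rule nn_integral_mono)
    fix X assume X: "X \<in> space ?M"
    have "Pair X -` rotation_excess d n s q = {Z \<in> space ?M. \<exists>D \<in> ({..<d} \<times> {..<d}) \<rightarrow>\<^sub>E \<rat>.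
        - (- (real d)\<^sup>2) \<le> gain d s {..<n} (\<lambda>a i. \<Sum>l<d. D (a, l) * X (l, q i)) Z + gain d s ({..<n} - {..<n}) (\<lambda>_ _. 0) Z}"
      using X unfolding rotation_excess_def by (auto simp: gauss_model_def space_pair_measure gain_def)
    also have "emeasure ?M \<dots> \<le> ennreal (exp (15 * (- (real d)\<^sup>2)) * sqrt 2 ^ (d * d)
        * exp (- (15/2) * (\<Sum>a<d. \<Sum>i\<in>{..<n} - {..<n}. 0\<^sup>2)))"
      by (rule emeasure_gain_le[where r = "\<lambda>l i. X (l, q i)", OF _ _ s]) auto
    finally show "emeasure ?M (Pair X -` rotation_excess d n s q) \<le> ennreal c" by (simp add: c_def)
  qed
  also have "\<dots> = ennreal c" by (simp add: G.emeasure_space_1)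
  also have "\<dots> \<le> ennreal (exp (- real d))"
  proof (rule ennreal_leI)
    have "c \<le> exp (15 * (- (real d)\<^sup>2)) * exp (1/2) ^ (d * d)"
      unfolding c_def using sqrt2_le_exp_half by (intro mult_left_mono power_mono) auto
    also have "\<dots> = exp (- (29/2) * (real d)\<^sup>2)"
      by (simp add: exp_of_nat_mult[symmetric] exp_add[symmetric] power2_eq_square)
    also have "\<dots> \<le> exp (- real d)"
    proof -
      have "real d * 1 \<le> real d * real d" using d by (intro mult_left_mono) auto
      then show ?thesis by (simp add: power2_eq_square)
    qed
    finally show "c \<le> exp (- real d)" .
  qed
  finally show "emeasure (gauss_model d n) (rotation_excess d n s q) \<le> ennreal (exp (- real d))" .
qed simp

definition small_projection :: "nat \<Rightarrow> nat \<Rightarrow> (nat \<Rightarrow> int) \<Rightarrow> ((nat \<times> nat \<Rightarrow> real) \<times> (nat \<times> nat \<Rightarrow> real)) set" where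
  "small_projection d n m = {\<omega> \<in> space (gauss_model d n).
     (\<Sum>j<n. (\<Sum>l<d. mesh (1/70) d * real_of_int (m l) * fst \<omega> (l, j))\<^sup>2) < real n / 60}"

text \<open>The radius is 2 * 70^2 + 2. The lower cutoff keeps the small-ball estimate uniform, and
  rounded unit vectors never fall below it.\<close>

definition direction_grid :: "nat \<Rightarrow> (nat \<Rightarrow> int) set" where
  "direction_grid d = {m \<in> int_ball {..<d} 9802. 1/4 \<le> (\<Sum>l<d. (mesh (1/70) d * real_of_int (m l))\<^sup>2)}"

lemma finite_direction_grid [simp]: "finite (direction_grid d)"
  unfolding direction_grid_def by simp

lemma small_projection_sets [measurable]: "small_projection d n m \<in> sets (gauss_model d n)"
  unfolding small_projection_def by measurable

text \<open>The net has at most exp (9804 d) points, 9802 plus log 3 rounded up. With 30000 d \<le>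
  n this takes less than n / 3 of the available 5 n / 6.\<close>

lemma measure_small_projections_le:
  assumes d: "30000 * real d \<le> real n" and n: "n \<ge> 1"
  shows "measure (gauss_model d n) (\<Union>m\<in>direction_grid d. small_projection d n m) \<le> 2 / real n"
proof -
  interpret prob_space "gauss_model d n" by (rule prob_space_gauss_model)
  have "measure (gauss_model d n) (\<Union>m\<in>direction_grid d. small_projection d n m)
     \<le> (\<Sum>m\<in>direction_grid d. measure (gauss_model d n) (small_projection d n m))"
    by (rule finite_measure_subadditive_finite) auto
  also have "\<dots> \<le> (\<Sum>m\<in>direction_grid d. exp (- (5/6) * real n))"
  proof (rule sum_mono, rule measure_gauss_model_le)
    fix m assume m: "m \<in> direction_grid d"
    have meas: "{X \<in> space (std_gauss ({..<d} \<times> {..<n})). (\<Sum>j<n. (\<Sum>l<d. mesh (1/70) d * real_of_int (m l) * X (l, j))\<^sup>2) < real n / 60}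
      \<in> sets (std_gauss ({..<d} \<times> {..<n}))" by measurable
    show "emeasure (gauss_model d n) (small_projection d n m) \<le> ennreal (exp (- (5/6) * real n))"
      unfolding small_projection_def emeasure_gauss_model_fst[OF meas]
      by (rule emeasure_small_projection) (use m in \<open>simp add: direction_grid_def\<close>)
  qed simp
  also have "\<dots> = real (card (direction_grid d)) * exp (- (5/6) * real n)" by simp
  also have "\<dots> \<le> exp (9804 * real d) * exp (- (5/6) * real n)"
  proof (rule mult_right_mono)
    have "real (card (direction_grid d)) \<le> real (card (int_ball {..<d} 9802))"
      unfolding direction_grid_def by (intro of_nat_mono card_mono) auto
    also have "\<dots> \<le> (3 * exp 9802) ^ d" using card_int_ball_le[of "{..<d}" 9802] by simp
    also have "\<dots> \<le> exp 9804 ^ d"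
    proof (rule power_mono)
      have "3 * exp 9802 \<le> exp (3/2) * exp (9802 :: real)" using three_le_exp by (intro mult_right_mono) auto
      also have "\<dots> \<le> exp 9804" by (simp add: exp_add[symmetric])
      finally show "3 * exp 9802 \<le> exp (9804 :: real)" .
    qed simp
    also have "\<dots> = exp (9804 * real d)" by (simp add: exp_of_nat_mult[symmetric] mult.commute)
    finally show "real (card (direction_grid d)) \<le> exp (9804 * real d)" .
  qed simp
  also have "\<dots> \<le> exp (- (real n / 2))" using d by (simp add: exp_add[symmetric])
  also have "\<dots> \<le> 2 / real n"
  proof -
    have "real n / 2 \<le> exp (real n / 2)" using exp_ge_add_one_self[of "real n / 2"] by linarith
    then show ?thesis using n unfolding exp_minus by (simp add: field_simps)
  qed
  finally show ?thesis .
qed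

text \<open>The factor 2 * 10^11 makes d k / 20 exceed (\<rho> + 2) d^2, the entropy of the grid
  together with the d^2 / 2 of the projected noise; here \<rho> + 2 is about 5 * 10^9.\<close>

definition far_perms :: "nat \<Rightarrow> nat \<Rightarrow> (nat \<Rightarrow> nat) \<Rightarrow> (nat \<Rightarrow> nat) set" where
  "far_perms d n q = {p. p permutes {..<n} \<and> 2 * 10^11 * real d < real (card (moved n p q))}"

definition matrix_grid :: "nat \<Rightarrow> (nat \<times> nat \<Rightarrow> int) set" where
  "matrix_grid d = int_ball ({..<d} \<times> {..<d}) (2 / (1/50000)\<^sup>2 + 2)"

lemma finite_far_perms [simp]: "finite (far_perms d n q)"
  unfolding far_perms_def by (rule finite_subset[of _ "{p. p permutes {..<n}}"]) (auto intro: finite_permutations)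

lemma finite_matrix_grid [simp]: "finite (matrix_grid d)"
  unfolding matrix_grid_def by simp

text \<open>Exponents per unit of d k: -2/3 from the residuals, 1/20 from the threshold and at most
  1/20 from grid and projected noise, in total -17/30.\<close>

lemma measure_match_excess_grid_le:
  assumes s: "60 * s\<^sup>2 \<le> 1" and Q: "orth_mat d Q" and q: "q permutes {..<n}"
    and p: "p \<in> far_perms d n q"
  shows "measure (gauss_model d n) (\<Union>m\<in>matrix_grid d. match_excess d n s Q q p m)
     \<le> exp (- (17/30) * (real d * real (card (moved n p q))))"
proof -
  interpret prob_space "gauss_model d n" by (rule prob_space_gauss_model)
  have pp: "p permutes {..<n}" and k: "2 * 10^11 * real d < real (card (moved n p q))"
    using p by (auto simp: far_perms_def)
  define k where "k = card (moved n p q)"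
  define \<rho> :: real where "\<rho> = 2 / (1/50000)\<^sup>2 + 2"
  have \<rho>: "\<rho> = 5000000002" by (simp add: \<rho>_def power2_eq_square)
  define x where "x = real d * real k"
  define b where "b = exp (x / 20) * sqrt 2 ^ (d * d) * (1/2) ^ (d * k)"
  have "measure (gauss_model d n) (\<Union>m\<in>matrix_grid d. match_excess d n s Q q p m)
     \<le> (\<Sum>m\<in>matrix_grid d. measure (gauss_model d n) (match_excess d n s Q q p m))"
    by (rule finite_measure_subadditive_finite) auto
  also have "\<dots> \<le> (\<Sum>m\<in>matrix_grid d. b)"
    unfolding b_def x_def k_def
    by (intro sum_mono measure_gauss_model_le emeasure_match_excess_le[OF s Q pp q]) simp
  also have "\<dots> = real (card (matrix_grid d)) * b" by simp
  also have "\<dots> \<le> (3 * exp \<rho>) ^ (d * d) * (exp (x / 20) * exp (1/2) ^ (d * d) * exp (- (2/3) * real (d * k)))"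
  proof (rule mult_mono)
    show "real (card (matrix_grid d)) \<le> (3 * exp \<rho>) ^ (d * d)"
      using card_int_ball_le[of "{..<d} \<times> {..<d}" \<rho>] by (simp add: matrix_grid_def \<rho>_def card_cartesian_product)
    show "b \<le> exp (x / 20) * exp (1/2) ^ (d * d) * exp (- (2/3) * real (d * k))"
      unfolding b_def using sqrt2_le_exp_half exp_half_power[of "d * k"]
      by (intro mult_mono power_mono) auto
  qed (auto simp: b_def)
  also have "\<dots> \<le> exp (3/2 + \<rho>) ^ (d * d) * (exp (x / 20) * exp (1/2) ^ (d * d) * exp (- (2/3) * real (d * k)))"
    using three_le_exp by (intro mult_right_mono power_mono) (auto simp: exp_add)
  also have "\<dots> = exp ((\<rho> + 2) * real (d * d) + x / 20 - 2/3 * x)"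
    by (simp add: exp_of_nat_mult[symmetric] exp_add[symmetric] x_def algebra_simps)
  also have "\<dots> \<le> exp (- (17/30) * x)"
  proof -
    define y where "y = real d * real d"
    have "200000000000 * y \<le> x" "0 \<le> y"
      using mult_left_mono[OF less_imp_le[OF k], of "real d"] by (simp_all add: x_def k_def y_def mult_ac)
    then have "(\<rho> + 2) * y + x / 20 - 2/3 * x \<le> - (17/30) * x"
      unfolding \<rho> by simp
    then show ?thesis by (simp add: y_def)
  qed
  finally show ?thesis by (simp add: x_def k_def)
qed

text \<open>Group by the number k of moved columns. As n^k \<le> exp (d k / 2), there remains 17/30
  - 1/2 = 1/15 per unit of d k, and k \<ge> 15, so each of the n values of k costs at most exp (-
  d).\<close>

lemma measure_match_excess_le:
  assumes s: "60 * s\<^sup>2 \<le> 1" and Q: "orth_mat d Q" and q: "q permutes {..<n}"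
    and d: "d \<ge> 1" "2 * ln (real n) \<le> real d" and n: "n \<ge> 1"
  shows "measure (gauss_model d n) (\<Union>p\<in>far_perms d n q. \<Union>m\<in>matrix_grid d. match_excess d n s Q q p m)
     \<le> real n * exp (- real d)"
proof -
  interpret prob_space "gauss_model d n" by (rule prob_space_gauss_model)
  define h where "h k = exp (- (17/30) * (real d * real k))" for k
  have "measure (gauss_model d n) (\<Union>p\<in>far_perms d n q. \<Union>m\<in>matrix_grid d. match_excess d n s Q q p m)
     \<le> (\<Sum>p\<in>far_perms d n q. measure (gauss_model d n) (\<Union>m\<in>matrix_grid d. match_excess d n s Q q p m))"
    by (rule finite_measure_subadditive_finite) (auto intro!: sets.finite_UN)
  also have "\<dots> \<le> (\<Sum>p\<in>far_perms d n q. h (card (moved n p q)))"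
    unfolding h_def by (intro sum_mono measure_match_excess_grid_le[OF s Q q])
  also have "\<dots> = (\<Sum>k\<in>{1..n}. \<Sum>p | p \<in> far_perms d n q \<and> card (moved n p q) = k. h (card (moved n p q)))"
  proof (rule sum.group[symmetric])
    show "(\<lambda>p. card (moved n p q)) ` far_perms d n q \<subseteq> {1..n}"
      using card_moved_le by (force simp: far_perms_def)
  qed auto
  also have "\<dots> \<le> (\<Sum>k\<in>{1..n}. exp (- real d))"
  proof (rule sum_mono)
    fix k
    let ?P = "{p. p \<in> far_perms d n q \<and> card (moved n p q) = k}"
    show "(\<Sum>p\<in>?P. h (card (moved n p q))) \<le> exp (- real d)"
    proof (cases "2 * 10^11 * real d < real k")
      case False
      then have "?P = {}" by (auto simp: far_perms_def)
      then show ?thesis by (simp only: sum.empty) simp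
    next
      case True
      have "card ?P \<le> card {p. p permutes {..<n} \<and> card {i \<in> {..<n}. p i \<noteq> q i} = k}"
        by (rule card_mono) (auto simp: far_perms_def moved_def intro: finite_subset[OF _ finite_permutations])
      also have "\<dots> \<le> n ^ k" by (rule card_permutations_at_distance_le[OF q])
      finally have "real (card ?P) \<le> real n ^ k" by (metis of_nat_le_iff of_nat_power)
      also have "\<dots> = exp (ln (real n)) ^ k" using n by simp
      also have "\<dots> \<le> exp (real d / 2) ^ k" using d by (intro power_mono) auto
      also have "\<dots> = exp (real d * real k / 2)" by (simp add: exp_of_nat_mult[symmetric] mult.commute)
      finally have c: "real (card ?P) \<le> exp (real d * real k / 2)" .
      have "(\<Sum>p\<in>?P. h (card (moved n p q))) = real (card ?P) * h k" by simp
      also have "\<dots> \<le> exp (real d * real k / 2) * h k" using c by (rule mult_right_mono) (simp add: h_def)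
      also have "\<dots> = exp (- (1/15) * (real d * real k))" by (simp add: h_def exp_add[symmetric])
      also have "\<dots> \<le> exp (- real d)"
      proof -
        have "15 \<le> real k" using True d(1) by simp
        then have "real d * 15 \<le> real d * real k" by (intro mult_left_mono) auto
        then show ?thesis by simp
      qed
      finally show ?thesis .
    qed
  qed
  finally show ?thesis by simp
qed

definition bad_event :: "nat \<Rightarrow> nat \<Rightarrow> real \<Rightarrow> (nat \<Rightarrow> nat \<Rightarrow> real) \<Rightarrow> (nat \<Rightarrow> nat) \<Rightarrow>
    ((nat \<times> nat \<Rightarrow> real) \<times> (nat \<times> nat \<Rightarrow> real)) set" where
  "bad_event d n s Q q = (\<Union>j<n. large_column d n j)
     \<union> (\<Union>p\<in>far_perms d n q. \<Union>m\<in>matrix_grid d. match_excess d n s Q q p m)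
     \<union> rotation_excess d n s q \<union> (\<Union>m\<in>direction_grid d. small_projection d n m)"

lemma bad_event_sets [measurable]: "bad_event d n s Q q \<in> sets (gauss_model d n)"
  unfolding bad_event_def by (auto intro!: sets.Un sets.finite_UN)

text \<open>The dimension assumption gives exp (- d) \<le> 1 / n^2, so n events of this size still
  cost only 1 / n; the four parts add up as 2 + 1 + 1 + 2.\<close>

lemma measure_bad_event_le:
  assumes s: "60 * s\<^sup>2 \<le> 1" and Q: "orth_mat d Q" and q: "q permutes {..<n}"
    and d: "d \<ge> 1" "2 * ln (real n) \<le> real d" "30000 * real d \<le> real n" and n: "n \<ge> 1"
  shows "measure (gauss_model d n) (bad_event d n s Q q) \<le> 6 / real n"
proof -
  interpret prob_space "gauss_model d n" by (rule prob_space_gauss_model)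
  have "exp (- real d) \<le> exp (- (2 * ln (real n)))" using d by simp
  also have "\<dots> = 1 / (real n)\<^sup>2" using n by (simp add: exp_minus exp_double inverse_eq_divide)
  finally have e: "exp (- real d) \<le> 1 / (real n)\<^sup>2" .
  have "real n * exp (- real d) \<le> real n * (1 / (real n)\<^sup>2)" using e by (rule mult_left_mono) simp
  also have "\<dots> = 1 / real n" using n by (simp add: power2_eq_square)
  finally have ne: "real n * exp (- real d) \<le> 1 / real n" .
  have e1: "exp (- real d) \<le> 1 / real n"
  proof -
    have "1 * exp (- real d) \<le> real n * exp (- real d)" using n by (intro mult_right_mono) auto
    then show ?thesis using ne by linarith
  qed
  have "measure (gauss_model d n) (\<Union>j<n. large_column d n j) \<le> (\<Sum>j<n. measure (gauss_model d n) (large_column d n j))"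
    by (rule finite_measure_subadditive_finite) auto
  also have "\<dots> \<le> (\<Sum>j<n. 2 * exp (- real d))" by (intro sum_mono measure_large_column_le) auto
  also have "\<dots> = 2 * (real n * exp (- real d))" by simp
  finally have 1: "measure (gauss_model d n) (\<Union>j<n. large_column d n j) \<le> 2 / real n" using ne by simp
  have 2: "measure (gauss_model d n) (\<Union>p\<in>far_perms d n q. \<Union>m\<in>matrix_grid d. match_excess d n s Q q p m) \<le> 1 / real n"
    using measure_match_excess_le[OF s Q q d(1,2) n] ne by linarith
  have 3: "measure (gauss_model d n) (rotation_excess d n s q) \<le> 1 / real n"
    using measure_rotation_excess_le[OF s d(1)] e1 by (rule order.trans)
  have 4: "measure (gauss_model d n) (\<Union>m\<in>direction_grid d. small_projection d n m) \<le> 2 / real n"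
    by (rule measure_small_projections_le[OF d(3) n])
  have m1: "(\<Union>j<n. large_column d n j) \<in> sets (gauss_model d n)"
    and m2: "(\<Union>p\<in>far_perms d n q. \<Union>m\<in>matrix_grid d. match_excess d n s Q q p m) \<in> sets (gauss_model d n)"
    and m4: "(\<Union>m\<in>direction_grid d. small_projection d n m) \<in> sets (gauss_model d n)"
    by (auto intro!: sets.finite_UN)
  have "measure (gauss_model d n) (bad_event d n s Q q)
    \<le> measure (gauss_model d n) (\<Union>j<n. large_column d n j)
     + measure (gauss_model d n) (\<Union>p\<in>far_perms d n q. \<Union>m\<in>matrix_grid d. match_excess d n s Q q p m)
     + measure (gauss_model d n) (rotation_excess d n s q)
     + measure (gauss_model d n) (\<Union>m\<in>direction_grid d. small_projection d n m)"
    unfolding bad_event_def using m1 m2 m4 rotation_excess_sets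
    by (intro order.trans[OF measure_Un_le] add_mono order.refl sets.Un) auto
  then show ?thesis using 1 2 3 4 by simp
qed

text \<open>The bad event is a union over all far permutations and all grid points, so outside it
  the bounds hold for every maximiser at once. The constant 10^16 dominates both 2 * 10^11 and 480 +
  38880 * 2 * 10^11.\<close>

lemma ml_pair_bounds_of_not_bad:
  assumes \<omega>: "(X, Z) \<in> space (gauss_model d n) - bad_event d n s Qs q"
    and s: "60 * s\<^sup>2 \<le> 1" and Qs: "orth_mat d Qs" and q: "q permutes {..<n}"
    and d: "d \<ge> 1" and n: "n \<ge> 1"
    and ml: "is_ml_pair d n X (obs d Qs q s X Z) p Q"
  shows "1 - 10^16 * real d / real n \<le> overlap n q p"
    and "ell2 d Qs Q / (2 * real d) \<le> 10^16 * real d / real n"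
proof -
  have p: "p permutes {..<n}" and Q: "orth_mat d Q" using ml by (auto simp: is_ml_pair_def)
  have sp: "(X, Z) \<in> space (gauss_model d n)"
    and b1: "\<And>j. j < n \<Longrightarrow> (X, Z) \<notin> large_column d n j"
    and b2: "\<And>p m. p \<in> far_perms d n q \<Longrightarrow> m \<in> matrix_grid d \<Longrightarrow> (X, Z) \<notin> match_excess d n s Qs q p m"
    and b3: "(X, Z) \<notin> rotation_excess d n s q"
    and b4: "\<And>m. m \<in> direction_grid d \<Longrightarrow> (X, Z) \<notin> small_projection d n m"
    using \<omega> by (auto simp: bad_event_def)
  have X: "(\<Sum>l<d. (X (l, j))\<^sup>2) \<le> 20 * real d" and Z: "(\<Sum>l<d. (Z (l, j))\<^sup>2) \<le> 20 * real d" if "j < n" for j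
    using b1[OF that] sp by (auto simp: large_column_def)
  have pos: "0 \<le> gain d s {..<n} (resid d Q Qs X p q) Z"
    using is_ml_pair_gain_nonneg[OF ml Qs q n] by (simp add: resid_def[abs_def])
  have k: "real (card (moved n p q)) \<le> 2 * 10^11 * real d"
  proof (rule ccontr)
    assume *: "\<not> ?thesis"
    then have far: "p \<in> far_perms d n q" using p by (simp add: far_perms_def)
    have s1: "s\<^sup>2 \<le> 1" using s zero_le_power2[of s] by linarith
    have "moved n p q = {}"
    proof (rule moved_eq_empty_of_gain[OF d s1 Q Qs p q X Z pos])
      fix m and D :: "nat \<times> nat \<Rightarrow> real"
      assume m: "m \<in> int_ball ({..<d} \<times> {..<d}) (2 / (1/50000)\<^sup>2 + 2)"
        and D: "D \<in> ({..<d} \<times> {..<d}) \<rightarrow>\<^sub>E \<rat>"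
      from m have "m \<in> matrix_grid d" by (simp add: matrix_grid_def)
      from b2[OF far this] D sp show "gain d s ({..<n} - moved n p q) (\<lambda>a i. \<Sum>l<d. D (a, l) * X (l, q i)) Z
        + gain d s (moved n p q) (resid d (grid_mat (1/50000) d m) Qs X p q) Z
        < - (real d * real (card (moved n p q)) / 300)"
        unfolding match_excess_def by (auto simp: not_le)
    qed
    then show False using * by simp
  qed
  have "real (card (moved n p q)) / real n \<le> 10^16 * real d / real n"
    using k by (intro divide_right_mono) auto
  then show "1 - 10^16 * real d / real n \<le> overlap n q p"
    using n by (simp add: overlap_eq)
  have "ell2 d Qs Q / (2 * real d) \<le> (480 + 38880 * (2 * 10^11)) * real d / real n"
  proof (rule ell2_le_of_gain[OF d s n Q Qs p q X Z pos k])
    fix D :: "nat \<times> nat \<Rightarrow> real" assume D: "D \<in> ({..<d} \<times> {..<d}) \<rightarrow>\<^sub>E \<rat>"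
    show "gain d s {..<n} (\<lambda>a i. \<Sum>l<d. D (a, l) * X (l, q i)) Z \<le> (real d)\<^sup>2"
    proof (rule ccontr)
      assume "\<not> ?thesis"
      then have "(real d)\<^sup>2 \<le> gain d s {..<n} (\<lambda>a i. \<Sum>l<d. D (a, l) * fst (X, Z) (l, q i)) (snd (X, Z))"
        by simp
      with D have "(X, Z) \<in> rotation_excess d n s q"
        unfolding rotation_excess_def using sp by blast
      then show False using b3 by contradiction
    qed
  next
    fix v :: "nat \<Rightarrow> real"
    show "real n / 240 * (\<Sum>l<d. (v l)\<^sup>2) \<le> (\<Sum>j<n. (\<Sum>l<d. v l * X (l, j))\<^sup>2)"
    proof (rule sum_projections_ge[OF d X])
      fix m assume "m \<in> int_ball {..<d} 9802" "1/4 \<le> (\<Sum>l<d. (mesh (1/70) d * real_of_int (m l))\<^sup>2)"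
      then have "m \<in> direction_grid d" by (simp add: direction_grid_def)
      from b4[OF this] sp show "real n / 60 \<le> (\<Sum>j<n. (\<Sum>l<d. mesh (1/70) d * real_of_int (m l) * X (l, j))\<^sup>2)"
        by (auto simp: small_projection_def)
    qed
  qed
  also have "\<dots> \<le> 10^16 * real d / real n" by (intro divide_right_mono mult_right_mono) auto
  finally show "ell2 d Qs Q / (2 * real d) \<le> 10^16 * real d / real n" .
qed

text \<open>The measurable events \<open>E n\<close> are witnesses inside the set of outcomes on
  which every maximiser satisfies the bounds; this avoids a proof that the latter set is
  measurable.\<close>

theorem theorem1:
  shows "\<exists>c1 c2 c3 :: real. c1 > 0 \<and> c2 > 0 \<and> c3 > 0 \<and>
    (\<forall>(d :: nat \<Rightarrow> nat) (\<sigma> :: nat \<Rightarrow> real) (Qs :: nat \<Rightarrow> nat \<Rightarrow> nat \<Rightarrow> real) (ps :: nat \<Rightarrow> nat \<Rightarrow> nat).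
      (\<forall>n. d n \<ge> 1 \<and> real (d n) \<ge> 2 * ln (real n) \<and> \<sigma> n > 0 \<and>
           orth_mat (d n) (Qs n) \<and> ps n permutes {..<n}) \<longrightarrow>
      (\<exists>E :: nat \<Rightarrow> (((nat \<times> nat) \<Rightarrow> real) \<times> ((nat \<times> nat) \<Rightarrow> real)) set.
         (\<forall>n. E n \<in> sets (gauss_model (d n) n)) \<and>
         (\<forall>n. \<forall>(X, Z) \<in> E n. \<forall>p Q.
             is_ml_pair (d n) n X (obs (d n) (Qs n) (ps n) (\<sigma> n) X Z) p Q \<longrightarrow>
               overlap n (ps n) p \<ge> 1 - max (60 * (\<sigma> n)\<^sup>2)
                   (max (c1 * real (d n) / real n) (c2 * ln (real n) / (real (d n) * ln (real (d n))))) \<and>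
               ell2 (d n) (Qs n) Q / (2 * real (d n)) \<le>
                 c1 * real (d n) / real n + c2 * (\<sigma> n)\<^sup>2 +
                 c3 * max (real (d n) * ln (real n) / real n) (sqrt (ln (real n) / real n))) \<and>
         ((\<lambda>n. measure (gauss_model (d n) n) (E n)) \<longlonglongrightarrow> 1)))"
proof (rule exI[of _ "10^16 :: real"], rule exI[of _ "120 :: real"], rule exI[of _ "1 :: real"],
    intro conjI allI impI)
  fix d :: "nat \<Rightarrow> nat" and \<sigma> :: "nat \<Rightarrow> real" and Qs :: "nat \<Rightarrow> nat \<Rightarrow> nat \<Rightarrow> real" and ps :: "nat \<Rightarrow> nat \<Rightarrow> nat"
  assume H: "\<forall>n. d n \<ge> 1 \<and> real (d n) \<ge> 2 * ln (real n) \<and> \<sigma> n > 0 \<and>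
           orth_mat (d n) (Qs n) \<and> ps n permutes {..<n}"
  then have d: "d n \<ge> 1" and dl: "2 * ln (real n) \<le> real (d n)" and Qs: "orth_mat (d n) (Qs n)"
    and ps: "ps n permutes {..<n}" for n by auto
  \<comment> \<open>In both regimes the overlap bound is nonpositive, and ell2 / (2 d) \<le> 2 is
    covered by 120 \<sigma>^2 > 2 or by 10^16 d / n \<ge> 2; this is why the constant is 120 = 2 *
    60. Otherwise d is far below n / 30000, as the net of directions requires.\<close>
  define easy where "easy n \<longleftrightarrow> 1 < 60 * (\<sigma> n)\<^sup>2 \<or> 2 * real n \<le> 10^16 * real (d n)" for n
  \<comment> \<open>For n = 0 the overlap is 0 through division by zero and the claim can fail, so
    \<open>E 0\<close> is empty; the limit does not see it.\<close>
  define E where "E n = (if n = 0 then {} else if easy n then space (gauss_model (d n) n)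
      else space (gauss_model (d n) n) - bad_event (d n) n (\<sigma> n) (Qs n) (ps n))" for n
  show "\<exists>E :: nat \<Rightarrow> (((nat \<times> nat) \<Rightarrow> real) \<times> ((nat \<times> nat) \<Rightarrow> real)) set.
         (\<forall>n. E n \<in> sets (gauss_model (d n) n)) \<and>
         (\<forall>n. \<forall>(X, Z) \<in> E n. \<forall>p Q.
             is_ml_pair (d n) n X (obs (d n) (Qs n) (ps n) (\<sigma> n) X Z) p Q \<longrightarrow>
               overlap n (ps n) p \<ge> 1 - max (60 * (\<sigma> n)\<^sup>2)
                   (max (10^16 * real (d n) / real n) (120 * ln (real n) / (real (d n) * ln (real (d n))))) \<and>
               ell2 (d n) (Qs n) Q / (2 * real (d n)) \<le>
                 10^16 * real (d n) / real n + 120 * (\<sigma> n)\<^sup>2 +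
                 1 * max (real (d n) * ln (real n) / real n) (sqrt (ln (real n) / real n))) \<and>
         ((\<lambda>n. measure (gauss_model (d n) n) (E n)) \<longlonglongrightarrow> 1)"
  proof (intro exI[of _ E] conjI allI)
    fix n
    show "E n \<in> sets (gauss_model (d n) n)" by (simp add: E_def sets.Diff)
  next
    fix n
    show "\<forall>(X, Z) \<in> E n. \<forall>p Q.
             is_ml_pair (d n) n X (obs (d n) (Qs n) (ps n) (\<sigma> n) X Z) p Q \<longrightarrow>
               overlap n (ps n) p \<ge> 1 - max (60 * (\<sigma> n)\<^sup>2)
                   (max (10^16 * real (d n) / real n) (120 * ln (real n) / (real (d n) * ln (real (d n))))) \<and>
               ell2 (d n) (Qs n) Q / (2 * real (d n)) \<le>
                 10^16 * real (d n) / real n + 120 * (\<sigma> n)\<^sup>2 +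
                 1 * max (real (d n) * ln (real n) / real n) (sqrt (ln (real n) / real n))"
    proof (clarify)
      fix X Z p Q
      assume XZ: "(X, Z) \<in> E n" and ml: "is_ml_pair (d n) n X (obs (d n) (Qs n) (ps n) (\<sigma> n) X Z) p Q"
      have n: "n \<ge> 1" using XZ by (cases "n = 0") (auto simp: E_def)
      have Q: "orth_mat (d n) Q" using ml by (simp add: is_ml_pair_def)
      define y where "y = 10^16 * real (d n) / real n"
      define u where "u = 120 * ln (real n) / (real (d n) * ln (real (d n)))"
      define v where "v = max (real (d n) * ln (real n) / real n) (sqrt (ln (real n) / real n))"
      have v: "0 \<le> v" using n by (simp add: v_def le_max_iff_disj)
      have y: "0 \<le> y" by (simp add: y_def)
      have "1 - max (60 * (\<sigma> n)\<^sup>2) (max y u) \<le> overlap n (ps n) p \<and>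
          ell2 (d n) (Qs n) Q / (2 * real (d n)) \<le> y + 120 * (\<sigma> n)\<^sup>2 + v"
      proof (cases "easy n")
        case True
        have o: "0 \<le> overlap n (ps n) p" by (simp add: overlap_def)
        have "ell2 (d n) (Qs n) Q / (2 * real (d n)) \<le> 4 * real (d n) / (2 * real (d n))"
          by (rule divide_right_mono[OF ell2_le[OF Qs Q]]) simp
        then have l: "ell2 (d n) (Qs n) Q / (2 * real (d n)) \<le> 2" using d[of n] by simp
        have "1 < 60 * (\<sigma> n)\<^sup>2 \<or> 2 \<le> y"
          using True n by (auto simp: easy_def y_def le_divide_eq)
        then show ?thesis
        proof
          assume "1 < 60 * (\<sigma> n)\<^sup>2"
          then show ?thesis using o l v y by (intro conjI) linarith+
        next
          assume "2 \<le> y"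
          moreover have "0 \<le> 120 * (\<sigma> n)\<^sup>2" by simp
          ultimately show ?thesis using o l v by (intro conjI) linarith+
        qed
      next
        case False
        then have s: "60 * (\<sigma> n)\<^sup>2 \<le> 1" by (simp add: easy_def)
        have \<omega>: "(X, Z) \<in> space (gauss_model (d n) n) - bad_event (d n) n (\<sigma> n) (Qs n) (ps n)"
          using XZ False n by (simp add: E_def)
        have "1 - y \<le> overlap n (ps n) p" "ell2 (d n) (Qs n) Q / (2 * real (d n)) \<le> y"
          using ml_pair_bounds_of_not_bad[OF \<omega> s Qs ps d n ml] by (simp_all add: y_def)
        moreover have "0 \<le> 120 * (\<sigma> n)\<^sup>2" by simp
        ultimately show ?thesis using v by (intro conjI) linarith+
      qed
      then show "overlap n (ps n) p \<ge> 1 - max (60 * (\<sigma> n)\<^sup>2)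
                   (max (10^16 * real (d n) / real n) (120 * ln (real n) / (real (d n) * ln (real (d n))))) \<and>
               ell2 (d n) (Qs n) Q / (2 * real (d n)) \<le>
                 10^16 * real (d n) / real n + 120 * (\<sigma> n)\<^sup>2 +
                 1 * max (real (d n) * ln (real n) / real n) (sqrt (ln (real n) / real n))"
        unfolding y_def u_def v_def by simp
    qed
  next
    have prob: "prob_space (gauss_model (d n) n)" for n by (rule prob_space_gauss_model)
    have lower: "1 - 6 / real n \<le> measure (gauss_model (d n) n) (E n)" if n: "n \<ge> 1" for n
    proof (cases "easy n")
      case True
      then show ?thesis using n prob_space.prob_space[OF prob, of n] by (simp add: E_def)
    next
      case False
      then have s: "60 * (\<sigma> n)\<^sup>2 \<le> 1" and dn: "30000 * real (d n) \<le> real n" by (auto simp: easy_def)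
      have "measure (gauss_model (d n) n) (bad_event (d n) n (\<sigma> n) (Qs n) (ps n)) \<le> 6 / real n"
        by (rule measure_bad_event_le[OF s Qs ps d dl dn n])
      then show ?thesis using False n
        by (simp add: E_def prob_space.prob_compl[OF prob bad_event_sets])
    qed
    show "(\<lambda>n. measure (gauss_model (d n) n) (E n)) \<longlonglongrightarrow> 1"
    proof (rule real_tendsto_sandwich)
      show "\<forall>\<^sub>F n in sequentially. 1 - 6 / real n \<le> measure (gauss_model (d n) n) (E n)"
        using lower by (intro eventually_sequentiallyI[of 1]) auto
      show "\<forall>\<^sub>F n in sequentially. measure (gauss_model (d n) n) (E n) \<le> 1"
        by (intro always_eventually allI prob_space.prob_le_1[OF prob])
      show "(\<lambda>n. 1 - 6 / real n) \<longlonglongrightarrow> 1"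
        using tendsto_diff[OF tendsto_const lim_const_over_n, of 1 "6 :: real"] by simp
    qed simp
  qed
qed simp_all

end
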